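(* Suppose that assumption (H) (recalled in the context) is satisfied, let $s\in\{1,\dots,d^2\}$ and $c_0>0$, and let $\mathfrak{k}_\infty:=\lambda_{\min}(C_\infty)>0$. Then for any $\epsilon_0\in(0,1)$ it holds that $$\mathbb{P}\Big(\inf_{V\in\mathcal{C}(s,c_0)}\frac{\|VX\|_{L^2}^2}{\|V\|_2^2}\ \geq\ \frac{\mathfrak{k}_\infty}{2}\Big)\ \geq\ 1-\epsilon_0$$ for all $$T\ \geq\ T_0(\epsilon_0,s,c_0):=\mathfrak{T}_0(\epsilon_0,s,c_0)\Big((4s+1)\log d-2s\big(\log\tfrac{2s}{21}-1\big)+\log\tfrac{2}{\epsilon_0}\Big),$$ where $$\mathfrak{T}_0(\epsilon_0,s,c_0)=\frac{144\,\mathfrak{p}_0\mathfrak{K}_\infty(c_0+2)^2\big(\mathfrak{k}_\infty+18(c_0+2)^2\mathfrak{K}_\infty\big)}{\mathfrak{r}_0\,\mathfrak{k}_\infty^2}.$$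
   Context: Model. Let $d\geq1$, $A_0\in\mathbb{R}^{d\times d}$, and let $W$ be a standard $d$-dimensional Brownian motion (extended to a two-sided one). Assumption (H): $A_0$ is diagonalisable (over $\mathbb{C}$), $A_0=P_0\,\mathrm{diag}(\theta_1,\dots,\theta_d)P_0^{-1}$, where the columns of $P_0$ are eigenvectors of $A_0$, and $\mathfrak{r}_0:=\min_{1\leq j\leq d}\mathrm{Re}(\theta_j)>0$. The process $X$ is the stationary solution of the Ornstein-Uhlenbeck equation $dX_t=-A_0X_t\,dt+dW_t$, i.e. $X_t=\int_{-\infty}^t\exp(-(t-s)A_0)\,dW_s$, so that $X_t\sim\mathcal{N}(0,C_\infty)$ with $C_\infty:=\int_0^\infty\exp(-sA_0)\exp(-sA_0^\top)\,ds$. It is observed on $[0,T]$, $T>0$. Notation. $\|A\|_p$ ($1\leq p<\infty$) is the entrywise $\ell_p$-norm of a matrix ($\|\cdot\|_2$ is the Frobenius norm), $\|\cdot\|_{\mathrm{op}}$ is the spectral operator norm. For $V\in\mathbb{R}^{d\times d}$, $\|VX\|_{L^2}^2:=\frac1T\int_0^T (VX_t)^\top(VX_t)\,dt$. For an index set $J\subset\{1,\dots,d\}^2$, $(A_{|J})_{ij}:=A_{ij}1_{(i,j)\in J}$. $\mathcal{C}(s,c_0):=\{A\in\mathbb{R}^{d\times d}\setminus\{0\}:\ \|A\|_1\leq(1+c_0)\|A_{|\mathcal{I}_s(A)}\|_1\}$, where $\mathcal{I}_s(A)$ is a set of coordinates of the $s$ largest (in absolute value) entries of $A$. Constants: $\mathfrak{K}_\infty:=\lambda_{\max}(C_\infty)$,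 $\mathfrak{p}_0:=\|P_0\|_{\mathrm{op}}\|P_0^{-1}\|_{\mathrm{op}}$. $\log$ is the natural logarithm. *)

theory Defs
  imports "HOL-Probability.Probability"
begin

section \<open>Matrices\<close>

text \<open>Matrices are of type \<open>real ^ 'd ^ 'd\<close>, so \<open>d = CARD('d)\<close>. On this type
  \<open>(*)\<close> is the componentwise product, and the library function \<open>norm\<close> is the
  Frobenius norm.\<close>

definition matrix_power :: "real ^ 'd ^ 'd \<Rightarrow> nat \<Rightarrow> real ^ 'd ^ 'd" where
  "matrix_power A k = (((**) A) ^^ k) (mat 1)"

definition matrix_exp :: "real ^ 'd ^ 'd \<Rightarrow> real ^ 'd ^ 'd" where
  "matrix_exp A = (\<Sum>k. (1 / fact k) *\<^sub>R matrix_power A k)"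

definition diag_matrix :: "('d \<Rightarrow> complex) \<Rightarrow> complex ^ 'd ^ 'd" where
  "diag_matrix \<theta> = (\<chi> i j. if i = j then \<theta> i else 0)"

definition diagonalises :: "complex ^ 'd ^ 'd \<Rightarrow> ('d \<Rightarrow> complex) \<Rightarrow> real ^ 'd ^ 'd \<Rightarrow> bool" where
  "diagonalises P \<theta> A \<longleftrightarrow>
     invertible P \<and> map_matrix complex_of_real A = P ** diag_matrix \<theta> ** matrix_inv P"

definition min_Re :: "('d::finite \<Rightarrow> complex) \<Rightarrow> real" where
  "min_Re \<theta> = Min (range (\<lambda>j. Re (\<theta> j)))"

definition assumption_H :: "real ^ 'd ^ 'd \<Rightarrow> complex ^ 'd ^ 'd \<Rightarrow> ('d::finite \<Rightarrow> complex) \<Rightarrow> bool" where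
  "assumption_H A0 P0 \<theta> \<longleftrightarrow> diagonalises P0 \<theta> A0 \<and> min_Re \<theta> > 0"

text \<open>\<open>norm\<close> on \<open>complex ^ 'd\<close> is the Hermitian norm, so \<open>onorm\<close> below is the spectral norm.\<close>

definition spectral_norm :: "complex ^ 'd ^ 'd \<Rightarrow> real" where
  "spectral_norm P = onorm ((*v) P)"

definition condition_number :: "complex ^ 'd ^ 'd \<Rightarrow> real" where
  "condition_number P = spectral_norm P * spectral_norm (matrix_inv P)"

definition real_eigenvalues :: "real ^ 'd ^ 'd \<Rightarrow> real set" where
  "real_eigenvalues A = {l. \<exists>v. v \<noteq> 0 \<and> A *v v = l *s v}"

text \<open>These are only used for symmetric matrices, all of whose eigenvalues are real.\<close>

definition lambda_min :: "real ^ 'd ^ 'd \<Rightarrow> real" where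
  "lambda_min A = Min (real_eigenvalues A)"

definition lambda_max :: "real ^ 'd ^ 'd \<Rightarrow> real" where
  "lambda_max A = Max (real_eigenvalues A)"

definition C_inf :: "real ^ 'd ^ 'd \<Rightarrow> real ^ 'd ^ 'd" where
  "C_inf A0 = (LINT s:{0..}|lborel.
      matrix_exp (- (s *\<^sub>R A0)) ** matrix_exp (- (s *\<^sub>R transpose A0)))"

section \<open>The cone of approximately sparse matrices\<close>

definition l1_norm :: "real ^ 'd ^ 'd \<Rightarrow> real" where
  "l1_norm A = (\<Sum>i\<in>UNIV. \<Sum>j\<in>UNIV. \<bar>A $ i $ j\<bar>)"

definition restrict_matrix :: "real ^ 'd ^ 'd \<Rightarrow> ('d \<times> 'd) set \<Rightarrow> real ^ 'd ^ 'd" where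
  "restrict_matrix A J = (\<chi> i j. if (i, j) \<in> J then A $ i $ j else 0)"

definition largest_coords :: "nat \<Rightarrow> real ^ 'd ^ 'd \<Rightarrow> ('d \<times> 'd) set \<Rightarrow> bool" where
  "largest_coords s A J \<longleftrightarrow> card J = s \<and>
     (\<forall>(i, j) \<in> J. \<forall>(k, l) \<in> - J. \<bar>A $ k $ l\<bar> \<le> \<bar>A $ i $ j\<bar>)"

text \<open>Ties make the set of the \<open>s\<close> largest coordinates non-unique, but
  \<open>l1_norm (restrict_matrix A J)\<close> does not depend on which one is taken.\<close>

definition sparse_cone :: "nat \<Rightarrow> real \<Rightarrow> (real ^ 'd ^ 'd) set" where
  "sparse_cone s c0 = {A. A \<noteq> 0 \<and>
     (\<exists>J. largest_coords s A J \<and> l1_norm A \<le> (1 + c0) * l1_norm (restrict_matrix A J))}"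

section \<open>Brownian motion, Wiener integral, Ornstein-Uhlenbeck process\<close>

definition two_sided_brownian_motion ::
    "'a measure \<Rightarrow> (real \<Rightarrow> 'a \<Rightarrow> real ^ 'd) \<Rightarrow> bool" where
  "two_sided_brownian_motion M W \<longleftrightarrow>
     (\<forall>t. W t \<in> borel_measurable M) \<and>
     (AE \<omega> in M. W 0 \<omega> = 0) \<and>
     (AE \<omega> in M. continuous_on UNIV (\<lambda>t. W t \<omega>)) \<and>
     (\<forall>(t :: nat \<Rightarrow> real) n. strict_mono t \<longrightarrow>
        prob_space.indep_vars M (\<lambda>_. borel) (\<lambda>k \<omega>. W (t (Suc k)) \<omega> - W (t k) \<omega>) {..<n}) \<and>
     (\<forall>r t. r < t \<longrightarrow>
        prob_space.indep_vars M (\<lambda>_. borel) (\<lambda>i \<omega>. (W t \<omega> - W r \<omega>) $ i) UNIV \<and>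
        (\<forall>i. distributed M lborel (\<lambda>\<omega>. (W t \<omega> - W r \<omega>) $ i)
               (\<lambda>x. ennreal (normal_density 0 (sqrt (t - r)) x))))"

text \<open>The step function with the value \<open>C k\<close> on \<open>{\<tau> k<..\<tau> (Suc k)}\<close> for \<open>k < n\<close>, and its
  integral with respect to \<open>W\<close>.\<close>

definition step_function ::
    "nat \<Rightarrow> (nat \<Rightarrow> real) \<Rightarrow> (nat \<Rightarrow> real ^ 'd ^ 'd) \<Rightarrow> real \<Rightarrow> real ^ 'd ^ 'd" where
  "step_function n \<tau> C u = (\<Sum>k<n. indicator {\<tau> k<..\<tau> (Suc k)} u *\<^sub>R C k)"

definition step_integral ::
    "(real \<Rightarrow> 'a \<Rightarrow> real ^ 'd) \<Rightarrow> nat \<Rightarrow> (nat \<Rightarrow> real) \<Rightarrow> (nat \<Rightarrow> real ^ 'd ^ 'd) \<Rightarrow>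
     'a \<Rightarrow> real ^ 'd" where
  "step_integral W n \<tau> C \<omega> = (\<Sum>k<n. C k *v (W (\<tau> (Suc k)) \<omega> - W (\<tau> k) \<omega>))"

text \<open>\<open>Y\<close> is (a version of) the Wiener integral over the whole real line of the deterministic
  square-integrable function \<open>f\<close>: it is the mean-square limit of the integrals of step functions
  converging to \<open>f\<close> in \<open>L\<^sup>2\<close>. By the Wiener isometry the limit does not depend, up to null sets,
  on the approximating sequence.\<close>

definition has_wiener_integral ::
    "'a measure \<Rightarrow> (real \<Rightarrow> 'a \<Rightarrow> real ^ 'd) \<Rightarrow> (real \<Rightarrow> real ^ 'd ^ 'd) \<Rightarrow>
     ('a \<Rightarrow> real ^ 'd) \<Rightarrow> bool" where
  "has_wiener_integral M W f Y \<longleftrightarrow>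
     f \<in> borel_measurable borel \<and> Y \<in> borel_measurable M \<and>
     (\<exists>n \<tau> C. (\<forall>m. mono (\<tau> m)) \<and>
        (\<lambda>m. \<integral>\<^sup>+ u. ennreal ((norm (f u - step_function (n m) (\<tau> m) (C m) u))\<^sup>2) \<partial>lborel)
          \<longlonglongrightarrow> 0 \<and>
        (\<lambda>m. \<integral>\<^sup>+ \<omega>. ennreal ((norm (Y \<omega> - step_integral W (n m) (\<tau> m) (C m) \<omega>))\<^sup>2) \<partial>M)
          \<longlonglongrightarrow> 0)"

text \<open>The stationary solution on \<open>{0..}\<close> of \<open>dX\<^sub>t = - A\<^sub>0 X\<^sub>t dt + dW\<^sub>t\<close>, given by its moving average
  representation. Wiener integrals are defined up to null sets only; the version with
  continuous paths is taken, which is unique up to indistinguishability and for which the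
  path integrals over \<open>{0..T}\<close> are meaningful.\<close>

definition stationary_OU ::
    "'a measure \<Rightarrow> real ^ 'd ^ 'd \<Rightarrow> (real \<Rightarrow> 'a \<Rightarrow> real ^ 'd) \<Rightarrow>
     (real \<Rightarrow> 'a \<Rightarrow> real ^ 'd) \<Rightarrow> bool" where
  "stationary_OU M A0 W X \<longleftrightarrow>
     (\<forall>\<omega>\<in>space M. continuous_on {0..} (\<lambda>t. X t \<omega>)) \<and>
     (\<forall>t\<ge>0. has_wiener_integral M W
        (\<lambda>u. indicator {..t} u *\<^sub>R matrix_exp (- ((t - u) *\<^sub>R A0))) (X t))"

definition emp_sqnorm :: "real \<Rightarrow> real ^ 'd ^ 'd \<Rightarrow> (real \<Rightarrow> real ^ 'd) \<Rightarrow> real" where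
  "emp_sqnorm T V x = (1 / T) * (LINT t:{0..T}|lborel. (V *v x t) \<bullet> (V *v x t))"

section \<open>The time horizon\<close>

definition horizon_factor ::
    "real ^ 'd ^ 'd \<Rightarrow> complex ^ 'd ^ 'd \<Rightarrow> ('d::finite \<Rightarrow> complex) \<Rightarrow> real \<Rightarrow> real" where
  "horizon_factor A0 P0 \<theta> c0 =
     144 * condition_number P0 * lambda_max (C_inf A0) * (c0 + 2)\<^sup>2
       * (lambda_min (C_inf A0) + 18 * (c0 + 2)\<^sup>2 * lambda_max (C_inf A0))
     / (min_Re \<theta> * (lambda_min (C_inf A0))\<^sup>2)"

definition horizon ::
    "real ^ 'd ^ 'd \<Rightarrow> complex ^ 'd ^ 'd \<Rightarrow> ('d::finite \<Rightarrow> complex) \<Rightarrow> real \<Rightarrow> nat \<Rightarrow> real \<Rightarrow> real" where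
  "horizon A0 P0 \<theta> \<epsilon>0 s c0 = horizon_factor A0 P0 \<theta> c0 *
     ((4 * real s + 1) * ln (real CARD('d)) - 2 * real s * (ln (2 * real s / 21) - 1) + ln (2 / \<epsilon>0))"

end

theory Submission
  imports Defs
begin

text \<open>For a fixed matrix \<open>V\<close> with \<open>norm V \<le> 1\<close>, a Riemann sum of \<open>\<parallel>V X\<parallel>\<^sup>2\<close> is the squared norm of a finite
  Gaussian vector. Its covariance form \<open>\<Gamma>\<close> has trace at most \<open>K\<close> and, by the decay of the covariance
  of \<open>X\<close> and Schur's test, norm about \<open>L = 2 * p0 * K / (r0 * T)\<close>, where \<open>K\<close> is the largest
  eigenvalue of the stationary covariance and \<open>p0\<close>, \<open>r0\<close> are the condition number and the rate of decay
  of the drift drift_semigroup. The exponential moment at \<open>\<mu>\<close> of such a squared norm is at most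
  \<open>exp (\<mu> * trace \<Gamma> / (1 - 2 * \<mu> * L))\<close> for either sign of \<open>\<mu>\<close>, so \<open>\<parallel>V X\<parallel>\<^sup>2\<close> satisfies a two-sided
  Bernstein inequality. A union bound over lattice nets of the balls of all coordinate subspaces of
  dimension \<open>2 s\<close> turns this into a uniform bound for \<open>2 s\<close>-sparse matrices. Finally a matrix of the cone
  is a sum of \<open>s\<close>-sparse blocks whose norms add up to at most \<open>2 + c0\<close> times its norm, and by
  polarization the bound extends to the cone.\<close>

section \<open>Exponential moments of Gaussian quadratic forms\<close>

text \<open>Gaussianity enters only through joint characteristic functions: these survive the
  mean-square limits that define the Wiener integral, and an auxiliary standard normal vector turns
  them into exponential moments, so no covariance form has to be diagonalised. Discretising time
  keeps all vectors finite; Fatou's lemma removes the discretisation. Both tails are needed although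
  only a lower bound is claimed: net, polarization and block argument all control the absolute value
  of the difference \<open>D\<close> of the empirical and the stationary form. The constants:
  comparison with a net of radius 1/3 multiplies the level \<open>x\<close> by 3, and the block
  argument, used once in each argument of \<open>D\<close>, multiplies it by
  \<open>(2 + c0)\<^sup>2\<close>; so \<open>3 * x * (2 + c0)\<^sup>2\<close> has to be half the
  smallest eigenvalue. The 21 inside the logarithm of the horizon bounds the number of net points
  per coordinate, and the binomial bound \<open>(exp 1 * d\<^sup>2 / (2 * s)) ^ (2 * s)\<close> for
  the choice of the support gives the other terms in \<open>s\<close>.\<close>

lemma prob_space_std_normal_distribution: "prob_space std_normal_distribution"
  by (rule prob_space_normal_density) simp

text \<open>Completing the square: up to a constant the integrand is the density of a normal
  variable with mean \<open>b / D\<close> and variance \<open>1 / D\<close>; the hypothesis is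
  exactly \<open>D > 0\<close>.\<close>

lemma nn_integral_std_normal_exp_quadratic:
  fixes a b :: real
  assumes "2 * a < 1"
  shows "(\<integral>\<^sup>+ y. ennreal (exp (a * y\<^sup>2 + b * y)) \<partial>std_normal_distribution)
    = ennreal (exp (b\<^sup>2 / (2 * (1 - 2 * a))) / sqrt (1 - 2 * a))"
proof -
  define D where "D = 1 - 2 * a"
  have D: "D > 0" using assms by (simp add: D_def)
  have sq: "sqrt D > 0" "(sqrt D)\<^sup>2 = D" using D by auto
  have "(\<integral>\<^sup>+ y. ennreal (exp (a * y\<^sup>2 + b * y)) \<partial>std_normal_distribution)
      = (\<integral>\<^sup>+ y. ennreal (std_normal_density y) * ennreal (exp (a * y\<^sup>2 + b * y)) \<partial>lborel)"
    by (subst nn_integral_density) auto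
  also have "\<dots> = (\<integral>\<^sup>+ y. ennreal (exp (b\<^sup>2 / (2 * D)) / sqrt D) * ennreal (normal_density (b / D) (1 / sqrt D) y) \<partial>lborel)"
  proof (rule nn_integral_cong)
    fix y :: real
    have e: "- (y - b / D)\<^sup>2 / (2 * (1 / sqrt D)\<^sup>2) + b\<^sup>2 / (2 * D) = - y\<^sup>2 / 2 + (a * y\<^sup>2 + b * y)"
    proof -
      have "a = (1 - D) / 2" by (simp add: D_def)
      moreover have "(1 / sqrt D)\<^sup>2 = 1 / D" using sq by (simp add: power_divide)
      ultimately show ?thesis using D by (simp only:) (simp add: field_simps power2_eq_square)
    qed
    have s: "sqrt (2 * pi * (1 / sqrt D)\<^sup>2) = sqrt (2 * pi) / sqrt D"
      using D by (simp add: power_divide real_sqrt_divide)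
    have "std_normal_density y * exp (a * y\<^sup>2 + b * y) = 1 / sqrt (2 * pi) * exp (- y\<^sup>2 / 2 + (a * y\<^sup>2 + b * y))"
      unfolding normal_density_def by (simp add: exp_add[symmetric] algebra_simps)
    also have "\<dots> = exp (b\<^sup>2 / (2 * D)) / sqrt D * normal_density (b / D) (1 / sqrt D) y"
      unfolding e[symmetric] exp_add normal_density_def s using sq by (simp add: field_simps)
    finally show "ennreal (std_normal_density y) * ennreal (exp (a * y\<^sup>2 + b * y)) =
      ennreal (exp (b\<^sup>2 / (2 * D)) / sqrt D) * ennreal (normal_density (b / D) (1 / sqrt D) y)"
      using sq by (simp add: ennreal_mult[symmetric])
  qed
  also have "\<dots> = ennreal (exp (b\<^sup>2 / (2 * D)) / sqrt D) * (\<integral>\<^sup>+ y. ennreal (normal_density (b / D) (1 / sqrt D) y) \<partial>lborel)"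
    by (rule nn_integral_cmult) auto
  also have "(\<integral>\<^sup>+ y. ennreal (normal_density (b / D) (1 / sqrt D) y) \<partial>lborel) = 1"
    using sq by (subst nn_integral_eq_integral) auto
  finally show ?thesis by (simp add: D_def)
qed

definition quad_form :: "'i set \<Rightarrow> ('i \<Rightarrow> 'i \<Rightarrow> real) \<Rightarrow> ('i \<Rightarrow> real) \<Rightarrow> real" where
  "quad_form I A x = (\<Sum>i\<in>I. \<Sum>j\<in>I. A i j * x i * x j)"

lemma quad_form_insert:
  assumes "finite I" "i \<notin> I" and sym: "\<And>j k. A j k = A k j"
  shows "quad_form (insert i I) A (x(i := y))
    = quad_form I A x + 2 * y * (\<Sum>j\<in>I. A i j * x j) + A i i * y\<^sup>2"
proof -
  have n: "(if j = i then u else v) = v" if "j \<in> I" for j and u v :: real using that assms by auto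
  have "quad_form (insert i I) A (x(i := y)) =
    A i i * y * y + (\<Sum>j\<in>I. A i j * y * x j) + ((\<Sum>j\<in>I. A j i * x j * y) + quad_form I A x)"
    using assms(1,2) unfolding quad_form_def by (simp add: sum.distrib n cong: sum.cong)
  moreover have "(\<Sum>j\<in>I. A i j * y * x j) = y * (\<Sum>j\<in>I. A i j * x j)"
    by (simp add: sum_distrib_left mult_ac)
  moreover have "(\<Sum>j\<in>I. A j i * x j * y) = y * (\<Sum>j\<in>I. A i j * x j)"
    unfolding sum_distrib_left by (intro sum.cong) (simp_all add: sym[of _ i])
  ultimately show ?thesis by (simp add: power2_eq_square)
qed

lemma measurable_quad_form [measurable]:
  "quad_form I A \<in> borel_measurable (PiM I (\<lambda>_. std_normal_distribution))"
  unfolding quad_form_def[abs_def] by measurable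

text \<open>The Gaussian variables are integrated out one at a time. Integrating out the coordinate \<open>i\<close>
  replaces the form by its Schur complement, which again lies between \<open>0\<close> and \<open>L\<close>; the bounds
  on the form give \<open>\<beta> \<le> A i i * (L - A i i)\<close> for the sum \<open>\<beta>\<close> of the squares of the other
  entries of its row \<open>i\<close>, which is what controls the increase of the trace.\<close>

lemma nn_integral_exp_quad_form_le:
  fixes A :: "'i \<Rightarrow> 'i \<Rightarrow> real"
  assumes "finite I" and L: "L > 0" "2 * \<mu> * L < 1"
    and "\<And>i j. A i j = A j i"
    and "\<And>x. 0 \<le> quad_form I A x" "\<And>x. quad_form I A x \<le> L * (\<Sum>i\<in>I. (x i)\<^sup>2)"
  shows "(\<integral>\<^sup>+ x. ennreal (exp (\<mu> * quad_form I A x)) \<partial>PiM I (\<lambda>_. std_normal_distribution))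
    \<le> ennreal (exp (\<mu> * (\<Sum>i\<in>I. A i i) / (1 - 2 * \<mu> * L)))"
  using assms(1,4-)
proof (induction I arbitrary: A rule: finite_induct)
  case empty
  interpret prob_space "PiM {} (\<lambda>_::'i. std_normal_distribution)" by (intro prob_space_PiM prob_space_std_normal_distribution)
  show ?case by (simp add: quad_form_def emeasure_space_1)
next
  case (insert i I)
  note sym = insert.prems(1) and pos = insert.prems(2) and upp = insert.prems(3)
  interpret N: prob_space std_normal_distribution by (rule prob_space_std_normal_distribution)
  interpret product_sigma_finite "\<lambda>_::'i. std_normal_distribution" ..
  define a where "a = A i i"
  define b where "b x = (\<Sum>j\<in>I. A i j * x j)" for x
  define \<beta> where "\<beta> = (\<Sum>j\<in>I. (A i j)\<^sup>2)"
  define D where "D = 1 - 2 * \<mu> * a"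
  define E where "E = 1 - 2 * \<mu> * L"
  \<comment> \<open>Integrating out \<open>y\<close> leaves
    \<open>exp (\<mu> * quad_form I A' x)\<close>. The correction has the sign of
    \<open>\<mu>\<close>, hence the case distinctions in the bounds on \<open>A'\<close>.\<close>
  define A' where "A' j k = A j k + 2 * \<mu> / D * (A i j * A i k)" for j k
  have expand: "quad_form (insert i I) A (x(i := y)) = quad_form I A x + 2 * y * b x + a * y\<^sup>2" for x y
    unfolding b_def a_def by (rule quad_form_insert[OF insert.hyps sym])
  have sq: "(\<Sum>j\<in>insert i I. ((x(i := y)) j)\<^sup>2) = (\<Sum>j\<in>I. (x j)\<^sup>2) + y\<^sup>2" for x y
  proof -
    have "(\<Sum>j\<in>I. ((x(i := y)) j)\<^sup>2) = (\<Sum>j\<in>I. (x j)\<^sup>2)"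
      using insert.hyps by (intro sum.cong) auto
    then show ?thesis using insert.hyps by (simp add: add.commute)
  qed
  have p: "0 \<le> quad_form I A x + 2 * y * b x + a * y\<^sup>2" for x y
    using pos[of "x(i := y)"] by (simp only: expand)
  have u: "quad_form I A x + 2 * y * b x + a * y\<^sup>2 \<le> L * ((\<Sum>j\<in>I. (x j)\<^sup>2) + y\<^sup>2)" for x y
    using upp[of "x(i := y)"] by (simp only: expand sq)
  have a: "0 \<le> a" "a \<le> L" using p[of "\<lambda>_. 0" 1] u[of "\<lambda>_. 0" 1] by (simp_all add: quad_form_def b_def)
  have E: "E > 0" using L by (simp add: E_def)
  have D: "D > 0"
  proof (cases "\<mu> \<ge> 0")
    case True
    then have "2 * \<mu> * a \<le> 2 * \<mu> * L" using a by (intro mult_left_mono) auto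
    then show ?thesis using L by (simp add: D_def)
  next
    case False
    then have "2 * \<mu> * a \<le> 0" using a by (simp add: mult_nonpos_nonneg)
    then show ?thesis by (simp add: D_def)
  qed
  \<comment> \<open>This is the diagonal entry at \<open>i\<close> of the operator inequality
    \<open>A\<^sup>2 \<le> L * A\<close>. Both bounds are tested along the row \<open>A i\<close>,
    with last coordinates \<open>a - L\<close> and \<open>a\<close>; the unknown value of the form
    at the row then cancels.\<close>
  have \<beta>: "\<beta> \<le> a * (L - a)"
  proof -
    have b1: "b (A i) = \<beta>" by (simp add: b_def \<beta>_def power2_eq_square)
    have "0 \<le> quad_form I A (A i) - 2 * (L - a) * \<beta> + a * (L - a)\<^sup>2"
      using p[of "A i" "- (L - a)"] by (simp add: b1 algebra_simps power2_eq_square)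
    moreover have "quad_form I A (A i) + 2 * a * \<beta> + a * a\<^sup>2 \<le> L * (\<beta> + a\<^sup>2)"
      using u[of "A i" a] by (simp add: b1 \<beta>_def[symmetric])
    ultimately have "L * \<beta> \<le> L * (a * (L - a))"
      by (simp add: algebra_simps power2_eq_square)
    then show ?thesis using L(1) by simp
  qed
  have q': "quad_form I A' x = quad_form I A x + 2 * \<mu> / D * (b x)\<^sup>2" for x
  proof -
    have "(b x)\<^sup>2 = (\<Sum>j\<in>I. \<Sum>k\<in>I. A i j * x j * (A i k * x k))"
      unfolding b_def power2_eq_square sum_product ..
    then show ?thesis
      unfolding quad_form_def A'_def
      by (simp add: algebra_simps sum.distrib sum_distrib_left)
  qed
  \<comment> \<open>This \<open>y\<close> is the stationary point of
    \<open>2 * \<mu> * q - y\<^sup>2\<close> in the new coordinate, with \<open>q\<close> the old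
    form. The resulting identity gives the lower bound on \<open>A'\<close> for negative
    \<open>\<mu>\<close> and the upper bound for positive \<open>\<mu>\<close>; the other bounds
    follow from \<open>q'\<close>.\<close>
  have key: "2 * \<mu> * quad_form I A' x
      = 2 * \<mu> * (quad_form I A x + 2 * y * b x + a * y\<^sup>2) - y\<^sup>2" if "y = 2 * \<mu> * b x / D" for x y
  proof -
    have y: "D * y = 2 * \<mu> * b x" using that D by simp
    have "2 * \<mu> * (2 * y * b x + a * y\<^sup>2) - y\<^sup>2 = 2 * y * (2 * \<mu> * b x) - D * y\<^sup>2"
      by (simp add: D_def algebra_simps)
    also have "\<dots> = y * (D * y)" unfolding y[symmetric] by (simp add: power2_eq_square)
    also have "\<dots> = 2 * \<mu> * (2 * \<mu> / D * (b x)\<^sup>2)" unfolding y that by (simp add: power2_eq_square)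
    finally show ?thesis by (simp add: q' algebra_simps)
  qed
  have pos': "0 \<le> quad_form I A' x" for x
  proof (cases "\<mu> \<ge> 0")
    case True
    have "0 \<le> quad_form I A x" using p[of x 0] by simp
    then show ?thesis using True D by (simp add: q')
  next
    case False
    have "2 * \<mu> * quad_form I A' x \<le> 0"
      using p[of x "2 * \<mu> * b x / D"] False
      by (subst key[OF refl]) (smt (verit) mult_nonneg_nonpos2 zero_le_power2)
    then show ?thesis using False by (simp add: mult_le_0_iff)
  qed
  have upp': "quad_form I A' x \<le> L * (\<Sum>i\<in>I. (x i)\<^sup>2)" for x
  proof (cases "\<mu> > 0")
    case True
    define y where "y = 2 * \<mu> * b x / D"
    have "2 * \<mu> * quad_form I A' x \<le> 2 * \<mu> * (L * ((\<Sum>j\<in>I. (x j)\<^sup>2) + y\<^sup>2)) - y\<^sup>2"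
      unfolding key[OF y_def] using u[of x y] True by (intro diff_right_mono mult_left_mono) auto
    also have "\<dots> = 2 * \<mu> * (L * (\<Sum>j\<in>I. (x j)\<^sup>2)) - E * y\<^sup>2" by (simp add: E_def algebra_simps)
    also have "\<dots> \<le> 2 * \<mu> * (L * (\<Sum>j\<in>I. (x j)\<^sup>2))" using E by simp
    finally show ?thesis using True by simp
  next
    case False
    have "2 * \<mu> / D \<le> 0" using False D by (intro divide_nonpos_pos) auto
    then have "2 * \<mu> / D * (b x)\<^sup>2 \<le> 0" by (intro mult_nonpos_nonneg) auto
    then show ?thesis using u[of x 0] by (simp add: q')
  qed
  have tr': "(\<Sum>j\<in>I. A' j j) = (\<Sum>j\<in>I. A j j) + 2 * \<mu> / D * \<beta>"
    unfolding A'_def \<beta>_def by (simp add: sum.distrib sum_distrib_left power2_eq_square)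
  have "(\<integral>\<^sup>+ x. ennreal (exp (\<mu> * quad_form (insert i I) A x)) \<partial>PiM (insert i I) (\<lambda>_. std_normal_distribution))
    = (\<integral>\<^sup>+ x. \<integral>\<^sup>+ y. ennreal (exp (\<mu> * quad_form (insert i I) A (x(i := y)))) \<partial>std_normal_distribution \<partial>PiM I (\<lambda>_. std_normal_distribution))"
    by (rule product_nn_integral_insert[OF insert.hyps]) measurable
  also have "\<dots> = (\<integral>\<^sup>+ x. ennreal (1 / sqrt D) * ennreal (exp (\<mu> * quad_form I A' x)) \<partial>PiM I (\<lambda>_. std_normal_distribution))"
  proof (rule nn_integral_cong)
    fix x
    have "(\<integral>\<^sup>+ y. ennreal (exp (\<mu> * quad_form (insert i I) A (x(i := y)))) \<partial>std_normal_distribution)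
      = (\<integral>\<^sup>+ y. ennreal (exp (\<mu> * quad_form I A x)) * ennreal (exp (\<mu> * a * y\<^sup>2 + (2 * \<mu> * b x) * y)) \<partial>std_normal_distribution)"
      unfolding expand by (intro nn_integral_cong)
        (simp add: ennreal_mult[symmetric] exp_add[symmetric] algebra_simps)
    also have "\<dots> = ennreal (exp (\<mu> * quad_form I A x)) * ennreal (exp ((2 * \<mu> * b x)\<^sup>2 / (2 * D)) / sqrt D)"
      using D by (subst nn_integral_cmult, simp, subst nn_integral_std_normal_exp_quadratic) (simp_all add: D_def mult.assoc)
    also have "\<dots> = ennreal (exp (\<mu> * quad_form I A x + (2 * \<mu> * b x)\<^sup>2 / (2 * D)) / sqrt D)"
      using D by (simp add: ennreal_mult[symmetric] exp_add)
    also have "\<mu> * quad_form I A x + (2 * \<mu> * b x)\<^sup>2 / (2 * D) = \<mu> * quad_form I A' x"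
      unfolding q' using D by (simp add: field_simps power2_eq_square)
    finally show "(\<integral>\<^sup>+ y. ennreal (exp (\<mu> * quad_form (insert i I) A (x(i := y)))) \<partial>std_normal_distribution)
      = ennreal (1 / sqrt D) * ennreal (exp (\<mu> * quad_form I A' x))"
      using D by (simp add: ennreal_mult[symmetric] del: fun_upd_apply)
  qed
  also have "\<dots> = ennreal (1 / sqrt D) * (\<integral>\<^sup>+ x. ennreal (exp (\<mu> * quad_form I A' x)) \<partial>PiM I (\<lambda>_. std_normal_distribution))"
    by (rule nn_integral_cmult) measurable
  also have "\<dots> \<le> ennreal (1 / sqrt D) * ennreal (exp (\<mu> * (\<Sum>i\<in>I. A' i i) / E))"
    unfolding E_def using sym by (intro mult_left_mono insert.IH pos' upp') (auto simp: A'_def mult.commute)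
  also have "\<dots> = ennreal (1 / sqrt D * exp (\<mu> * (\<Sum>i\<in>I. A' i i) / E))"
    using D by (simp add: ennreal_mult[symmetric])
  also have "\<dots> \<le> ennreal (exp (\<mu> * (\<Sum>j\<in>insert i I. A j j) / E))"
  proof (rule ennreal_leI)
    \<comment> \<open>The factor \<open>1 / sqrt D\<close> costs at most
      \<open>\<mu> * a / D\<close> in the exponent and the increase of the trace at most
      \<open>\<mu> * a / E - \<mu> * a / D\<close>. The sum is \<open>\<mu> * a / E\<close>, the
      share of the diagonal entry just removed.\<close>
    have "ln (1 / D) \<le> 1 / D - 1" using D by (intro ln_le_minus_one) simp
    moreover have "ln (1 / D) = - ln D" using D by (simp add: ln_div)
    moreover have "1 / D - 1 = 2 * \<mu> * a / D" using D by (simp add: D_def field_simps)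
    ultimately have l: "- ln D / 2 \<le> \<mu> * a / D" by simp
    have "\<mu> * (2 * \<mu> / D * \<beta>) = 2 * \<mu>\<^sup>2 / D * \<beta>" by (simp add: power2_eq_square)
    also have "\<dots> \<le> 2 * \<mu>\<^sup>2 / D * (a * (L - a))" using \<beta> D by (intro mult_left_mono) auto
    also have "\<dots> = \<mu> * a - \<mu> * a * E / D"
      using D by (simp add: D_def E_def field_simps power2_eq_square)
    finally have "\<mu> * (2 * \<mu> / D * \<beta>) / E \<le> (\<mu> * a - \<mu> * a * E / D) / E"
      using E by (intro divide_right_mono) auto
    also have "\<dots> = \<mu> * a / E - \<mu> * a / D" using E by (simp add: diff_divide_distrib)
    finally have "- ln D / 2 + \<mu> * (\<Sum>i\<in>I. A' i i) / E \<le> \<mu> * (\<Sum>j\<in>insert i I. A j j) / E"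
      using l insert.hyps by (simp add: tr' a_def[symmetric] distrib_left add_divide_distrib)
    moreover have "1 / sqrt D = exp (- ln D / 2)"
      using D by (simp add: ln_sqrt[symmetric] exp_minus divide_simps)
    ultimately show "1 / sqrt D * exp (\<mu> * (\<Sum>i\<in>I. A' i i) / E) \<le> exp (\<mu> * (\<Sum>j\<in>insert i I. A j j) / E)"
      by (simp add: exp_add[symmetric])
  qed
  finally show ?case by (simp add: E_def)
qed


section \<open>Sums of squares of jointly Gaussian variables\<close>

lemma quad_form_scale: "quad_form I A (\<lambda>i. c * h i) = c\<^sup>2 * quad_form I A h"
  unfolding quad_form_def sum_distrib_left by (intro sum.cong refl) (simp add: power2_eq_square)

text \<open>Uniqueness of characteristic functions identifies the law of \<open>Z\<close>. The
  comparison is with a scaled standard normal variable rather than with a normal density, which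
  covers the degenerate case \<open>v = 0\<close>.\<close>

lemma (in prob_space) nn_integral_exp_of_char:
  assumes Z [measurable]: "Z \<in> borel_measurable M" and v: "v \<ge> 0"
    and char: "\<And>t. char (distr M borel Z) t = exp (- (v * t\<^sup>2) / 2)"
  shows "(\<integral>\<^sup>+ \<omega>. ennreal (exp (c * Z \<omega>)) \<partial>M) = ennreal (exp (c\<^sup>2 * v / 2))"
proof -
  interpret N: real_distribution std_normal_distribution by (rule real_dist_normal_dist)
  have "distr M borel Z = distr std_normal_distribution borel (\<lambda>x. sqrt v * x)"
  proof (rule Levy_uniqueness)
    show "char (distr M borel Z) = char (distr std_normal_distribution borel (\<lambda>x. sqrt v * x))"
    proof
      fix t
      have "char (distr std_normal_distribution borel (\<lambda>x. sqrt v * x)) t = char std_normal_distribution (t * sqrt v)"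
        by (simp add: char_def integral_distr mult_ac)
      then show "char (distr M borel Z) t = char (distr std_normal_distribution borel (\<lambda>x. sqrt v * x)) t"
        using v by (simp add: char char_std_normal_distribution power_mult_distrib mult_ac)
    qed
  qed (auto intro: real_distribution_distr N.real_distribution_distr)
  then have "(\<integral>\<^sup>+ x. ennreal (exp (c * x)) \<partial>distr M borel Z)
      = (\<integral>\<^sup>+ x. ennreal (exp (c * x)) \<partial>distr std_normal_distribution borel (\<lambda>x. sqrt v * x))" by simp
  then have "(\<integral>\<^sup>+ \<omega>. ennreal (exp (c * Z \<omega>)) \<partial>M)
      = (\<integral>\<^sup>+ x. ennreal (exp (c * (sqrt v * x))) \<partial>std_normal_distribution)"
    by (simp add: nn_integral_distr)
  also have "\<dots> = (\<integral>\<^sup>+ x. ennreal (exp (0 * x\<^sup>2 + (c * sqrt v) * x)) \<partial>std_normal_distribution)"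
    by (simp add: mult_ac)
  also have "\<dots> = ennreal (exp (c\<^sup>2 * v / 2))"
    using v by (subst nn_integral_std_normal_exp_quadratic) (simp_all add: power_mult_distrib)
  finally show ?thesis .
qed

lemma nn_integral_PiM_std_normal_exp:
  assumes "finite I"
  shows "(\<integral>\<^sup>+ x. ennreal (exp (\<Sum>i\<in>I. y i * x i)) \<partial>PiM I (\<lambda>_. std_normal_distribution))
    = ennreal (exp ((\<Sum>i\<in>I. (y i)\<^sup>2) / 2))"
proof -
  interpret N: prob_space std_normal_distribution by (rule prob_space_std_normal_distribution)
  interpret product_sigma_finite "\<lambda>_. std_normal_distribution" ..
  have "(\<integral>\<^sup>+ x. ennreal (exp (\<Sum>i\<in>I. y i * x i)) \<partial>PiM I (\<lambda>_. std_normal_distribution))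
      = (\<integral>\<^sup>+ x. (\<Prod>i\<in>I. ennreal (exp (y i * x i))) \<partial>PiM I (\<lambda>_. std_normal_distribution))"
    using assms by (simp add: exp_sum prod_ennreal)
  also have "\<dots> = (\<Prod>i\<in>I. \<integral>\<^sup>+ x. ennreal (exp (y i * x)) \<partial>std_normal_distribution)"
    using assms by (intro product_nn_integral_prod) auto
  also have "\<dots> = (\<Prod>i\<in>I. ennreal (exp ((y i)\<^sup>2 / 2)))"
    using nn_integral_std_normal_exp_quadratic[of 0] by simp
  also have "\<dots> = ennreal (exp ((\<Sum>i\<in>I. (y i)\<^sup>2) / 2))"
    using assms by (simp add: prod_ennreal exp_sum sum_divide_distrib)
  finally show ?thesis .
qed

lemma integral_PiM_std_normal_iexp:
  assumes "finite I"
  shows "(LINT x|PiM I (\<lambda>_. std_normal_distribution). iexp (\<Sum>i\<in>I. y i * x i))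
    = complex_of_real (exp (- (\<Sum>i\<in>I. (y i)\<^sup>2) / 2))"
proof -
  interpret N: prob_space std_normal_distribution by (rule prob_space_std_normal_distribution)
  interpret product_sigma_finite "\<lambda>_. std_normal_distribution" ..
  have "(LINT x|PiM I (\<lambda>_. std_normal_distribution). iexp (\<Sum>i\<in>I. y i * x i))
      = (LINT x|PiM I (\<lambda>_. std_normal_distribution). (\<Prod>i\<in>I. iexp (y i * x i)))"
    using assms by (simp add: exp_sum sum_distrib_left)
  also have "\<dots> = (\<Prod>i\<in>I. LINT x|std_normal_distribution. iexp (y i * x))"
    using assms by (intro product_integral_prod N.integrable_iexp) auto
  also have "\<dots> = (\<Prod>i\<in>I. char std_normal_distribution (y i))"
    by (simp add: char_def)
  also have "\<dots> = complex_of_real (exp (- (\<Sum>i\<in>I. (y i)\<^sup>2) / 2))"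
    using assms by (simp add: char_std_normal_distribution exp_sum sum_divide_distrib
        sum_negf[symmetric] del: sum_negf)
  finally show ?thesis .
qed

text \<open>Since \<open>exp (y\<^sup>2 / 2)\<close> and \<open>exp (- y\<^sup>2 / 2)\<close> are the moment generating and the characteristic
  function of an independent standard normal variable, the exponential moment of a sum of squares is
  that of the covariance form at a standard normal vector.\<close>

lemma (in prob_space) nn_integral_exp_sum_squares_eq:
  assumes I: "finite I" and G [measurable]: "\<And>i. i \<in> I \<Longrightarrow> G i \<in> borel_measurable M"
    and pos: "\<And>h. 0 \<le> quad_form I A h"
    and char: "\<And>h. (LINT \<omega>|M. iexp (\<Sum>i\<in>I. h i * G i \<omega>)) = exp (- quad_form I A h / 2)"
  shows "(\<integral>\<^sup>+ \<omega>. ennreal (exp (\<mu> * (\<Sum>i\<in>I. (G i \<omega>)\<^sup>2))) \<partial>M)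
    = (\<integral>\<^sup>+ h. ennreal (exp (\<mu> * quad_form I A h)) \<partial>PiM I (\<lambda>_. std_normal_distribution))"
proof -
  let ?P = "PiM I (\<lambda>_. std_normal_distribution)"
  interpret P: prob_space ?P
    by (intro prob_space_PiM prob_space_std_normal_distribution)
  interpret MP: pair_prob_space M ?P ..
  \<comment> \<open>With this \<open>c\<close>, half of \<open>(c * G i \<omega>)\<^sup>2\<close> is
    \<open>\<bar>\<mu>\<bar> * (G i \<omega>)\<^sup>2\<close>, the exponent that the standard normal
    integral produces.\<close>
  define c where "c = sqrt (2 * \<bar>\<mu>\<bar>)"
  have c2: "c\<^sup>2 = 2 * \<bar>\<mu>\<bar>" by (simp add: c_def)
  have meas [measurable]: "(\<lambda>p. \<Sum>i\<in>I. c * G i (fst p) * snd p i) \<in> borel_measurable (M \<Otimes>\<^sub>M ?P)"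
    by measurable
  have sq: "(\<Sum>i\<in>I. (c * G i \<omega>)\<^sup>2) / 2 = \<bar>\<mu>\<bar> * (\<Sum>i\<in>I. (G i \<omega>)\<^sup>2)" for \<omega>
    by (simp add: power_mult_distrib c2 sum_distrib_left[symmetric])
  have lin: "(\<Sum>i\<in>I. c * G i \<omega> * h i) = (\<Sum>i\<in>I. (c * h i) * G i \<omega>)" for \<omega> h
    by (simp add: mult_ac)
  show ?thesis
  proof (cases "\<mu> \<ge> 0")
    case True
    have "(\<integral>\<^sup>+ \<omega>. ennreal (exp (\<mu> * (\<Sum>i\<in>I. (G i \<omega>)\<^sup>2))) \<partial>M)
      = (\<integral>\<^sup>+ \<omega>. \<integral>\<^sup>+ h. ennreal (exp (\<Sum>i\<in>I. c * G i \<omega> * h i)) \<partial>?P \<partial>M)"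
      using True by (simp add: nn_integral_PiM_std_normal_exp[OF I] sq)
    also have "\<dots> = (\<integral>\<^sup>+ h. \<integral>\<^sup>+ \<omega>. ennreal (exp (\<Sum>i\<in>I. c * G i \<omega> * h i)) \<partial>M \<partial>?P)"
      by (rule MP.Fubini'[symmetric]) (simp add: case_prod_beta')
    also have "\<dots> = (\<integral>\<^sup>+ h. ennreal (exp (\<mu> * quad_form I A h)) \<partial>?P)"
    proof (rule nn_integral_cong)
      fix h
      define Z where "Z \<omega> = (\<Sum>i\<in>I. h i * G i \<omega>)" for \<omega>
      have Z [measurable]: "Z \<in> borel_measurable M" unfolding Z_def by measurable
      have "char (distr M borel Z) t = exp (- (quad_form I A h * t\<^sup>2) / 2)" for t
      proof -
        have "char (distr M borel Z) t = (LINT \<omega>|M. iexp (\<Sum>i\<in>I. (t * h i) * G i \<omega>))"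
          by (simp add: char_def integral_distr Z_def sum_distrib_left mult_ac)
        then show ?thesis unfolding char quad_form_scale by (simp add: mult_ac)
      qed
      from nn_integral_exp_of_char[OF Z pos this, of c]
      have "(\<integral>\<^sup>+ \<omega>. ennreal (exp (c * Z \<omega>)) \<partial>M) = ennreal (exp (\<mu> * quad_form I A h))"
        using True by (simp add: c2)
      then show "(\<integral>\<^sup>+ \<omega>. ennreal (exp (\<Sum>i\<in>I. c * G i \<omega> * h i)) \<partial>M) = ennreal (exp (\<mu> * quad_form I A h))"
        by (simp add: Z_def lin sum_distrib_left mult_ac)
    qed
    finally show ?thesis .
  next
    \<comment> \<open>Imaginary exponentials are bounded, so Fubini applies in its form for
      integrable functions, and the inner integral over \<open>M\<close> is the given characteristic
      function itself.\<close>
    case False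
    have "complex_of_real (LINT \<omega>|M. exp (\<mu> * (\<Sum>i\<in>I. (G i \<omega>)\<^sup>2)))
      = (LINT \<omega>|M. LINT h|?P. iexp (\<Sum>i\<in>I. c * G i \<omega> * h i))"
      using False sq unfolding integral_PiM_std_normal_iexp[OF I] by simp
    also have "\<dots> = (LINT h|?P. LINT \<omega>|M. iexp (\<Sum>i\<in>I. c * G i \<omega> * h i))"
      by (rule MP.Fubini_integral[symmetric]) (simp add: case_prod_beta', intro MP.integrable_iexp, auto)
    also have "\<dots> = complex_of_real (LINT h|?P. exp (\<mu> * quad_form I A h))"
      using False unfolding lin char quad_form_scale c2 by simp
    finally have eq: "(LINT \<omega>|M. exp (\<mu> * (\<Sum>i\<in>I. (G i \<omega>)\<^sup>2))) = (LINT h|?P. exp (\<mu> * quad_form I A h))"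
      by (simp only: of_real_eq_iff)
    have "integrable M (\<lambda>\<omega>. exp (\<mu> * (\<Sum>i\<in>I. (G i \<omega>)\<^sup>2)))"
      using False by (intro integrable_const_bound[where B = 1])
        (auto intro!: AE_I2 mult_nonpos_nonneg sum_nonneg)
    moreover have "integrable ?P (\<lambda>h. exp (\<mu> * quad_form I A h))"
      using False pos by (intro P.integrable_const_bound[where B = 1])
        (auto intro!: AE_I2 mult_nonpos_nonneg)
    ultimately show ?thesis by (simp add: nn_integral_eq_integral eq)
  qed
qed

lemma (in prob_space) nn_integral_exp_sum_squares_le:
  assumes "finite I" "\<And>i. i \<in> I \<Longrightarrow> G i \<in> borel_measurable M"
    and "L > 0" "2 * \<mu> * L < 1" "\<And>i j. A i j = A j i"
    and "\<And>h. 0 \<le> quad_form I A h" "\<And>h. quad_form I A h \<le> L * (\<Sum>i\<in>I. (h i)\<^sup>2)"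
    and "\<And>h. (LINT \<omega>|M. iexp (\<Sum>i\<in>I. h i * G i \<omega>)) = exp (- quad_form I A h / 2)"
  shows "(\<integral>\<^sup>+ \<omega>. ennreal (exp (\<mu> * (\<Sum>i\<in>I. (G i \<omega>)\<^sup>2))) \<partial>M)
    \<le> ennreal (exp (\<mu> * (\<Sum>i\<in>I. A i i) / (1 - 2 * \<mu> * L)))"
  using nn_integral_exp_sum_squares_eq[OF assms(1,2,6,8), of \<mu>]
    nn_integral_exp_quad_form_le[OF assms(1,3-7)] by simp

section \<open>Characteristic functions of Wiener integrals\<close>

lemma norm_matrix_eq:
  fixes A :: "real ^ 'n ^ 'm"
  shows "(norm A)\<^sup>2 = (\<Sum>i\<in>UNIV. \<Sum>j\<in>UNIV. (A $ i $ j)\<^sup>2)"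
  by (simp add: norm_vec_def L2_set_def sum_nonneg)

lemma norm_transpose:
  fixes A :: "real ^ 'n ^ 'm"
  shows "norm (transpose A) = norm A"
proof -
  have "(norm (transpose A))\<^sup>2 = (norm A)\<^sup>2"
    unfolding norm_matrix_eq transpose_def by (subst sum.swap) simp
  then show ?thesis by simp
qed

lemma norm_matrix_vector_mult_le:
  fixes A :: "real ^ 'n ^ 'm"
  shows "norm (A *v x) \<le> norm A * norm x"
proof (rule power2_le_imp_le)
  have "(norm (A *v x))\<^sup>2 = (\<Sum>i\<in>UNIV. ((A $ i) \<bullet> x)\<^sup>2)"
    by (simp add: norm_vec_def L2_set_def sum_nonneg matrix_vector_mult_def inner_vec_def)
  also have "\<dots> \<le> (\<Sum>i\<in>UNIV. (norm (A $ i) * norm x)\<^sup>2)"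
    by (intro sum_mono) (simp add: abs_le_square_iff[symmetric] Cauchy_Schwarz_ineq2)
  also have "\<dots> = (\<Sum>i\<in>UNIV. (norm (A $ i))\<^sup>2) * (norm x)\<^sup>2"
    by (simp add: power_mult_distrib sum_distrib_right)
  also have "(\<Sum>i\<in>UNIV. (norm (A $ i))\<^sup>2) = (norm A)\<^sup>2"
    by (simp add: norm_vec_def[of A] L2_set_def sum_nonneg)
  finally show "(norm (A *v x))\<^sup>2 \<le> (norm A * norm x)\<^sup>2" by (simp add: power_mult_distrib)
qed simp

lemma norm_vector_matrix_mult_le:
  fixes A :: "real ^ 'n ^ 'm"
  shows "norm (x v* A) \<le> norm A * norm x"
  using norm_matrix_vector_mult_le[of "transpose A" x] by (simp add: norm_transpose)

lemma linear_vector_matrix_mult: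
  fixes x :: "real ^ 'm"
  shows "linear (\<lambda>A :: real ^ 'n ^ 'm. x v* A)"
  by (rule linearI)
    (simp_all add: vec_eq_iff vector_matrix_mult_def algebra_simps sum.distrib sum_distrib_left)

lemma borel_measurable_vector_matrix_mult [measurable (raw)]:
  fixes x :: "real ^ 'm" and f :: "'a \<Rightarrow> real ^ 'n ^ 'm"
  assumes "f \<in> borel_measurable M"
  shows "(\<lambda>u. x v* f u) \<in> borel_measurable M"
  by (rule borel_measurable_continuous_on[OF _ assms])
    (intro linear_continuous_on linear_conv_bounded_linear[THEN iffD1] linear_vector_matrix_mult)

lemma (in prob_space) integral_iexp_normal:
  assumes "distributed M lborel X (\<lambda>x. ennreal (normal_density 0 \<sigma> x))" "\<sigma> > 0"
  shows "(LINT \<omega>|M. iexp (c * X \<omega>)) = exp (- (c\<^sup>2 * \<sigma>\<^sup>2) / 2)"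
proof -
  define Z where "Z \<omega> = X \<omega> / \<sigma>" for \<omega>
  have "distributed M lborel Z (\<lambda>x. ennreal (std_normal_density x))"
    using normal_standard_normal_convert[OF assms(2), of X 0] assms(1) by (simp add: Z_def[abs_def])
  then have d: "distr M lborel Z = std_normal_distribution" and m: "Z \<in> measurable M lborel"
    by (auto simp: distributed_def)
  have "(LINT \<omega>|M. iexp (c * X \<omega>)) = (LINT \<omega>|M. iexp ((c * \<sigma>) * Z \<omega>))"
    using assms(2) by (simp add: Z_def[abs_def])
  also have "\<dots> = (LINT x|distr M lborel Z. iexp ((c * \<sigma>) * x))"
    by (rule integral_distr[symmetric, OF m]) measurable
  also have "\<dots> = char std_normal_distribution (c * \<sigma>)"
    by (simp add: d char_def)
  finally show ?thesis by (simp add: char_std_normal_distribution power_mult_distrib)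
qed

lemma (in prob_space) integral_iexp_sum_indep:
  assumes "indep_vars (\<lambda>_. borel) Y I"
  shows "(LINT \<omega>|M. iexp (\<Sum>i\<in>I. Y i \<omega>)) = (\<Prod>i\<in>I. LINT \<omega>|M. iexp (Y i \<omega>))"
proof -
  have [measurable]: "Y i \<in> borel_measurable M" if "i \<in> I" for i
    using assms that by (simp add: indep_vars_def)
  have "(LINT \<omega>|M. iexp (\<Sum>i\<in>I. Y i \<omega>)) = char (distr M borel (\<lambda>\<omega>. \<Sum>i\<in>I. Y i \<omega>)) 1"
    unfolding char_def by (subst integral_distr) auto
  also have "\<dots> = (\<Prod>i\<in>I. char (distr M borel (Y i)) 1)"
    by (rule char_distr_sum[OF assms])
  also have "\<dots> = (\<Prod>i\<in>I. LINT \<omega>|M. iexp (Y i \<omega>))"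
    unfolding char_def by (intro prod.cong refl, subst integral_distr) auto
  finally show ?thesis .
qed

context prob_space
begin

context
  fixes W :: "real \<Rightarrow> 'a \<Rightarrow> real ^ 'd"
  assumes W: "two_sided_brownian_motion M W"
begin

lemma measurable_brownian_motion [measurable]: "W t \<in> borel_measurable M"
  using W by (simp add: two_sided_brownian_motion_def)

lemma integral_iexp_increment:
  assumes "r < t"
  shows "(LINT \<omega>|M. iexp (v \<bullet> (W t \<omega> - W r \<omega>))) = exp (- ((norm v)\<^sup>2 * (t - r)) / 2)"
proof -
  define X where "X i \<omega> = (W t \<omega> - W r \<omega>) $ i" for i \<omega>
  have ind: "indep_vars (\<lambda>_. borel) X UNIV"
    and nor: "\<And>i. distributed M lborel (X i) (\<lambda>x. ennreal (normal_density 0 (sqrt (t - r)) x))"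
    using W assms by (simp_all add: two_sided_brownian_motion_def X_def[abs_def])
  have ind': "indep_vars (\<lambda>_. borel) (\<lambda>i \<omega>. v $ i * X i \<omega>) UNIV"
    by (rule indep_vars_compose2[OF ind]) measurable
  have "(LINT \<omega>|M. iexp (v \<bullet> (W t \<omega> - W r \<omega>))) = (LINT \<omega>|M. iexp (\<Sum>i\<in>UNIV. v $ i * X i \<omega>))"
    by (simp add: inner_vec_def X_def)
  also have "\<dots> = (\<Prod>i\<in>UNIV. LINT \<omega>|M. iexp (v $ i * X i \<omega>))"
    by (rule integral_iexp_sum_indep[OF ind'])
  also have "\<dots> = (\<Prod>i\<in>UNIV. complex_of_real (exp (- ((v $ i)\<^sup>2 * (sqrt (t - r))\<^sup>2) / 2)))"
    using assms by (intro prod.cong refl integral_iexp_normal nor) simp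
  also have "\<dots> = complex_of_real (exp (\<Sum>i\<in>UNIV. - ((v $ i)\<^sup>2 * (t - r)) / 2))"
    using assms by (simp add: exp_sum)
  also have "(\<Sum>i\<in>UNIV. - ((v $ i)\<^sup>2 * (t - r)) / 2) = - ((norm v)\<^sup>2 * (t - r)) / 2"
    by (simp add: norm_vec_def L2_set_def sum_nonneg sum_negf sum_distrib_right sum_divide_distrib)
  finally show ?thesis .
qed

lemma integral_iexp_increments:
  fixes p :: "nat \<Rightarrow> real"
  assumes p: "strict_mono p"
  shows "(LINT \<omega>|M. iexp (\<Sum>k<n. w k \<bullet> (W (p (Suc k)) \<omega> - W (p k) \<omega>)))
    = exp (- (\<Sum>k<n. (norm (w k))\<^sup>2 * (p (Suc k) - p k)) / 2)"
proof -
  have ind: "indep_vars (\<lambda>_. borel) (\<lambda>k \<omega>. W (p (Suc k)) \<omega> - W (p k) \<omega>) {..<n}"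
    using W p by (simp add: two_sided_brownian_motion_def)
  have ind': "indep_vars (\<lambda>_. borel) (\<lambda>k \<omega>. w k \<bullet> (W (p (Suc k)) \<omega> - W (p k) \<omega>)) {..<n}"
    by (rule indep_vars_compose2[OF ind]) measurable
  have "(LINT \<omega>|M. iexp (\<Sum>k<n. w k \<bullet> (W (p (Suc k)) \<omega> - W (p k) \<omega>)))
      = (\<Prod>k<n. LINT \<omega>|M. iexp (w k \<bullet> (W (p (Suc k)) \<omega> - W (p k) \<omega>)))"
    by (rule integral_iexp_sum_indep[OF ind'])
  also have "\<dots> = (\<Prod>k<n. complex_of_real (exp (- ((norm (w k))\<^sup>2 * (p (Suc k) - p k)) / 2)))"
    using p by (intro prod.cong refl integral_iexp_increment) (simp add: strict_mono_Suc_iff)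
  also have "\<dots> = complex_of_real (exp (\<Sum>k<n. - ((norm (w k))\<^sup>2 * (p (Suc k) - p k)) / 2))"
    by (simp add: exp_sum)
  finally show ?thesis by (simp add: sum_negf sum_divide_distrib)
qed

text \<open>The increments over the intervals \<open>{a j<..b j}\<close> are not independent; the independence only
  enters after passing to the common refinement of these intervals.\<close>

lemma integral_iexp_overlapping_increments:
  fixes a b :: "'j \<Rightarrow> real"
  assumes J: "finite J" and ab: "\<And>j. j \<in> J \<Longrightarrow> a j \<le> b j"
  shows "(LINT \<omega>|M. iexp (\<Sum>j\<in>J. v j \<bullet> (W (b j) \<omega> - W (a j) \<omega>)))
    = exp (- (LINT u|lborel. (norm (\<Sum>j\<in>J. indicator {a j<..b j} u *\<^sub>R v j))\<^sup>2) / 2)"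
proof -
  define P where "P = a ` J \<union> b ` J"
  have P: "finite P" using J by (simp add: P_def)
  define l where "l = sorted_list_of_set P"
  define N where "N = length l"
  \<comment> \<open>Independence of increments is available along strictly increasing infinite
    sequences, so the sorted endpoints are continued in unit steps. The continuation gets no weight,
    as every \<open>\<beta> j\<close> is below \<open>N\<close>.\<close>
  define p where "p k = (if k < N then l ! k else l ! (N - 1) + real (k + 1 - N))" for k
  have l: "set l = P" "sorted_wrt (<) l" using P by (simp_all add: l_def)
  have p: "strict_mono p"
    unfolding strict_mono_Suc_iff
  proof
    fix k show "p k < p (Suc k)"
    proof (cases "Suc k < N")
      case True
      then show ?thesis using l(2) by (simp add: p_def N_def sorted_wrt_nth_less)
    next
      case False
      then consider "Suc k = N" | "k \<ge> N" by linarith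
      then show ?thesis
      proof cases
        case 1
        then have "N - 1 = k" "k < N" by auto
        then show ?thesis by (simp add: p_def 1)
      qed (simp add: p_def)
    qed
  qed
  define \<kappa> where "\<kappa> x = (SOME k. k < N \<and> p k = x)" for x
  have \<kappa>: "\<kappa> x < N \<and> p (\<kappa> x) = x" if x: "x \<in> P" for x
  proof -
    obtain k where "k < length l" "l ! k = x" using x l(1) by (metis in_set_conv_nth)
    then have "k < N \<and> p k = x" by (simp add: p_def N_def)
    then show ?thesis unfolding \<kappa>_def by (rule someI)
  qed
  define \<alpha> \<beta> where "\<alpha> j = \<kappa> (a j)" and "\<beta> j = \<kappa> (b j)" for j
  have \<alpha>\<beta>: "\<beta> j < N" "p (\<alpha> j) = a j" "p (\<beta> j) = b j" if "j \<in> J" for j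
    using that \<kappa>[of "a j"] \<kappa>[of "b j"] unfolding \<alpha>_def \<beta>_def P_def by blast+
  have le: "\<alpha> j \<le> \<beta> j" if "j \<in> J" for j
    using ab[OF that] \<alpha>\<beta>(2,3)[OF that] strict_mono_less_eq[OF p, of "\<alpha> j" "\<beta> j"] by simp
  define \<iota> :: "'j \<Rightarrow> nat \<Rightarrow> real" where "\<iota> j k = (if \<alpha> j \<le> k \<and> k < \<beta> j then 1 else 0)" for j k
  have tele: "f (b j) - f (a j) = (\<Sum>k<N. \<iota> j k *\<^sub>R (f (p (Suc k)) - f (p k)))"
    if j: "j \<in> J" for j and f :: "real \<Rightarrow> 'e::real_vector"
  proof -
    have "f (b j) - f (a j) = (\<Sum>k=\<alpha> j..<\<beta> j. f (p (Suc k)) - f (p k))"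
      using sum_Suc_diff'[OF le[OF j], of "\<lambda>k. f (p k)"] \<alpha>\<beta>[OF j] by simp
    also have "\<dots> = (\<Sum>k<N. \<iota> j k *\<^sub>R (f (p (Suc k)) - f (p k)))"
      using \<alpha>\<beta>(1)[OF j] by (intro sum.mono_neutral_cong_left) (auto simp: \<iota>_def)
    finally show ?thesis .
  qed
  define w where "w k = (\<Sum>j\<in>J. \<iota> j k *\<^sub>R v j)" for k
  have W_eq: "(\<Sum>j\<in>J. v j \<bullet> (W (b j) \<omega> - W (a j) \<omega>)) = (\<Sum>k<N. w k \<bullet> (W (p (Suc k)) \<omega> - W (p k) \<omega>))" for \<omega>
  proof -
    have "(\<Sum>j\<in>J. v j \<bullet> (W (b j) \<omega> - W (a j) \<omega>)) =
      (\<Sum>j\<in>J. \<Sum>k<N. \<iota> j k * (v j \<bullet> (W (p (Suc k)) \<omega> - W (p k) \<omega>)))"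
      by (intro sum.cong refl, subst tele[of _ "\<lambda>t. W t \<omega>"]) (simp_all add: inner_sum_right)
    also have "\<dots> = (\<Sum>k<N. w k \<bullet> (W (p (Suc k)) \<omega> - W (p k) \<omega>))"
      by (subst sum.swap) (simp add: w_def inner_sum_left)
    finally show ?thesis .
  qed
  define I where "I k = {p k<..p (Suc k)}" for k
  \<comment> \<open>The indicator of a half-open interval is an increment of the step function
    \<open>H u\<close>. Hence \<open>tele\<close>, stated for functions into any vector space,
    refines the indicators in the same way as the increments of \<open>W\<close>.\<close>
  define H :: "real \<Rightarrow> real \<Rightarrow> real" where "H u t = (if u \<le> t then 1 else 0)" for u t
  have H: "indicator {x<..y} u = H u y - H u x" if "x \<le> y" for x y u
    using that by (auto simp: H_def indicator_def)
  have pS: "p k \<le> p (Suc k)" for k using p by (simp add: strict_mono_less_eq)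
  have I_eq: "(\<Sum>j\<in>J. indicator {a j<..b j} u *\<^sub>R v j) = (\<Sum>k<N. indicator (I k) u *\<^sub>R w k)" for u
  proof -
    have "(\<Sum>j\<in>J. indicator {a j<..b j} u *\<^sub>R v j)
      = (\<Sum>j\<in>J. \<Sum>k<N. (\<iota> j k * indicator (I k) u) *\<^sub>R v j)"
    proof (intro sum.cong refl)
      fix j assume j: "j \<in> J"
      have "indicator {a j<..b j} u = (\<Sum>k<N. \<iota> j k * indicator (I k) u)"
        using tele[OF j, of "H u"] by (simp add: H[OF ab[OF j]] H[OF pS] I_def)
      then show "indicator {a j<..b j} u *\<^sub>R v j = (\<Sum>k<N. (\<iota> j k * indicator (I k) u) *\<^sub>R v j)"
        by (simp only: scaleR_sum_left)
    qed
    also have "\<dots> = (\<Sum>k<N. indicator (I k) u *\<^sub>R w k)"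
      by (subst sum.swap) (simp add: w_def scaleR_sum_right mult.commute)
    finally show ?thesis .
  qed
  have disj: "i = k" if "u \<in> I i" "u \<in> I k" for u i k
  proof (rule ccontr)
    assume "i \<noteq> k"
    then consider "Suc i \<le> k" | "Suc k \<le> i" by linarith
    then show False
      using that strict_mono_less_eq[OF p, of "Suc i" k] strict_mono_less_eq[OF p, of "Suc k" i]
      by cases (auto simp: I_def)
  qed
  have N_eq: "(norm (\<Sum>k<N. indicator (I k) u *\<^sub>R w k))\<^sup>2 = (\<Sum>k<N. indicator (I k) u * (norm (w k))\<^sup>2)" for u
  proof (cases "\<exists>i<N. u \<in> I i")
    case True
    then obtain i where i: "i < N" "u \<in> I i" by auto
    then have 0: "indicator (I k) u = (0::real)" if "k \<noteq> i" for k
      using disj that by (auto simp: indicator_def)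
    have "(\<Sum>k<N. indicator (I k) u *\<^sub>R w k) = (\<Sum>k\<in>{i}. indicator (I k) u *\<^sub>R w k)"
      using i 0 by (intro sum.mono_neutral_right) auto
    moreover have "(\<Sum>k<N. indicator (I k) u * (norm (w k))\<^sup>2) = (\<Sum>k\<in>{i}. indicator (I k) u * (norm (w k))\<^sup>2)"
      using i 0 by (intro sum.mono_neutral_right) auto
    ultimately show ?thesis using i by simp
  next
    case False
    then show ?thesis by (auto simp: indicator_def intro!: sum.neutral)
  qed
  have "(LINT u|lborel. (norm (\<Sum>j\<in>J. indicator {a j<..b j} u *\<^sub>R v j))\<^sup>2)
      = (\<Sum>k<N. (p (Suc k) - p k) * (norm (w k))\<^sup>2)"
    unfolding I_eq N_eq using pS
    by (subst Bochner_Integration.integral_sum) (auto simp: I_def)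
  then show ?thesis
    unfolding W_eq integral_iexp_increments[OF p] by (simp add: mult.commute)
qed

end

end

section \<open>Mean-square limits\<close>

lemma norm_iexp_diff_le: "norm (iexp x - iexp y) \<le> \<bar>x - y\<bar>"
proof -
  have "iexp x - iexp y = iexp y * (iexp (x - y) - 1)"
    by (simp add: right_diff_distrib exp_add[symmetric])
  moreover have "norm (iexp (x - y) - 1) \<le> \<bar>x - y\<bar>"
    using iexp_approx1[of "x - y" 0] by simp
  ultimately show ?thesis by (simp add: norm_mult)
qed

text \<open>Passing to real integrals needs finiteness, and finitely many of the nonnegative
  integrals may be infinite; integrability is therefore only eventual.\<close>

lemma L2_null_imp_real_integral_null:
  fixes h :: "nat \<Rightarrow> 'a \<Rightarrow> 'b::euclidean_space"
  assumes [measurable]: "\<And>m. h m \<in> borel_measurable N"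
    and lim: "(\<lambda>m. \<integral>\<^sup>+ u. ennreal ((norm (h m u))\<^sup>2) \<partial>N) \<longlonglongrightarrow> 0"
  shows "eventually (\<lambda>m. integrable N (\<lambda>u. (norm (h m u))\<^sup>2)) sequentially"
    and "(\<lambda>m. LINT u|N. (norm (h m u))\<^sup>2) \<longlonglongrightarrow> 0"
proof -
  have "eventually (\<lambda>m. (\<integral>\<^sup>+ u. ennreal ((norm (h m u))\<^sup>2) \<partial>N) < \<infinity>) sequentially"
    using lim by (rule order_tendstoD) simp
  then show "eventually (\<lambda>m. integrable N (\<lambda>u. (norm (h m u))\<^sup>2)) sequentially"
    by eventually_elim (simp add: integrable_iff_bounded)
  have "(\<lambda>m. enn2real (\<integral>\<^sup>+ u. ennreal ((norm (h m u))\<^sup>2) \<partial>N)) \<longlonglongrightarrow> 0"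
    using lim tendsto_enn2real[of _ 0] by simp
  then show "(\<lambda>m. LINT u|N. (norm (h m u))\<^sup>2) \<longlonglongrightarrow> 0"
    by (simp add: integral_eq_nn_integral)
qed

text \<open>The Cauchy-Schwarz inequality is used in the form \<open>2 x y \<le> \<eta> x\<^sup>2 + y\<^sup>2 / \<eta>\<close>, with \<open>\<eta>\<close>
  of the order of the \<open>L\<^sup>2\<close> distance; the summand \<open>1 / (m + 1)\<close> keeps \<open>\<eta>\<close> positive.\<close>

lemma AM_GM_weighted: "2 * x * y \<le> \<eta> * x\<^sup>2 + y\<^sup>2 / \<eta>" if "\<eta> > 0" for x y \<eta> :: real
proof -
  have "0 \<le> (\<eta> * x - y)\<^sup>2 / \<eta>" using that by simp
  also have "\<dots> = \<eta> * x\<^sup>2 + y\<^sup>2 / \<eta> - 2 * x * y"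
    using that by (simp add: power2_eq_square field_simps)
  finally show ?thesis by simp
qed

lemma divide_sqrt_add_le: "e / (sqrt e + \<delta>) \<le> sqrt e" if "e \<ge> 0" "\<delta> > 0" for e \<delta> :: real
proof -
  have "e = sqrt e * sqrt e" using that by simp
  also have "\<dots> \<le> sqrt e * (sqrt e + \<delta>)" using that by (intro mult_left_mono) auto
  finally show ?thesis using that by (simp add: divide_le_eq add_nonneg_pos)
qed

text \<open>The difference of the squares is dominated by a function \<open>b\<close> built from the
  squares of \<open>G m - g\<close> and of \<open>g\<close>. This yields the estimate and also, for
  large \<open>m\<close>, the integrability of the square of \<open>G m\<close>, which is not
  assumed.\<close>

lemma tendsto_integral_norm_square:
  fixes g :: "'a \<Rightarrow> 'b::euclidean_space"
  assumes [measurable]: "g \<in> borel_measurable N" "\<And>m. G m \<in> borel_measurable N"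
    and g: "integrable N (\<lambda>u. (norm (g u))\<^sup>2)"
    and lim: "(\<lambda>m. \<integral>\<^sup>+ u. ennreal ((norm (G m u - g u))\<^sup>2) \<partial>N) \<longlonglongrightarrow> 0"
  shows "(\<lambda>m. LINT u|N. (norm (G m u))\<^sup>2) \<longlonglongrightarrow> (LINT u|N. (norm (g u))\<^sup>2)"
proof -
  define e where "e m = (LINT u|N. (norm (G m u - g u))\<^sup>2)" for m
  define \<eta> where "\<eta> m = sqrt (e m) + 1 / real (Suc m)" for m
  define S where "S = (LINT u|N. (norm (g u))\<^sup>2)"
  have e: "e \<longlonglongrightarrow> 0" and int: "eventually (\<lambda>m. integrable N (\<lambda>u. (norm (G m u - g u))\<^sup>2)) sequentially"
    using L2_null_imp_real_integral_null[OF _ lim] by (simp_all add: e_def[abs_def])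
  have e0: "e m \<ge> 0" for m unfolding e_def by (intro integral_nonneg_AE) simp
  have \<eta>0: "\<eta> m > 0" for m unfolding \<eta>_def using e0[of m] by (intro add_nonneg_pos) auto
  have "eventually (\<lambda>m. norm ((LINT u|N. (norm (G m u))\<^sup>2) - S) \<le> e m + \<eta> m * S + sqrt (e m)) sequentially"
    using int
  proof eventually_elim
    case (elim m)
    define b where "b u = (norm (G m u - g u))\<^sup>2 + (\<eta> m * (norm (g u))\<^sup>2 + (norm (G m u - g u))\<^sup>2 / \<eta> m)" for u
    have b: "\<bar>(norm (G m u))\<^sup>2 - (norm (g u))\<^sup>2\<bar> \<le> b u" for u
    proof -
      have "(norm (G m u))\<^sup>2 - (norm (g u))\<^sup>2 = (norm (G m u - g u))\<^sup>2 + 2 * (g u \<bullet> (G m u - g u))"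
        by (simp add: power2_norm_eq_inner inner_diff inner_commute)
      moreover have "\<bar>g u \<bullet> (G m u - g u)\<bar> \<le> norm (g u) * norm (G m u - g u)"
        by (rule Cauchy_Schwarz_ineq2)
      moreover have "0 \<le> (norm (G m u - g u))\<^sup>2" by simp
      ultimately have "\<bar>(norm (G m u))\<^sup>2 - (norm (g u))\<^sup>2\<bar> \<le> (norm (G m u - g u))\<^sup>2 + 2 * (norm (g u) * norm (G m u - g u))"
        by linarith
      then have "\<bar>(norm (G m u))\<^sup>2 - (norm (g u))\<^sup>2\<bar> \<le> (norm (G m u - g u))\<^sup>2 + 2 * norm (g u) * norm (G m u - g u)"
        by (simp add: mult.assoc)
      then show ?thesis
        unfolding b_def using AM_GM_weighted[OF \<eta>0[of m], of "norm (g u)" "norm (G m u - g u)"] by linarith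
    qed
    have bi: "integrable N b" unfolding b_def using elim g by (intro Bochner_Integration.integrable_add) auto
    have "integrable N (\<lambda>u. (norm (G m u))\<^sup>2 - (norm (g u))\<^sup>2)"
      by (rule Bochner_Integration.integrable_bound[OF bi]) (use b in \<open>auto intro!: AE_I2 order_trans[OF _ abs_ge_self]\<close>)
    from Bochner_Integration.integrable_add[OF this g]
    have gi: "integrable N (\<lambda>u. (norm (G m u))\<^sup>2)" by simp
    have "norm ((LINT u|N. (norm (G m u))\<^sup>2) - S) = norm (LINT u|N. (norm (G m u))\<^sup>2 - (norm (g u))\<^sup>2)"
      unfolding S_def using gi g by simp
    also have "\<dots> \<le> (LINT u|N. b u)"
      using bi b gi g by (intro order_trans[OF integral_norm_bound integral_mono]) auto
    also have "\<dots> = e m + (\<eta> m * S + e m / \<eta> m)"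
      unfolding b_def e_def S_def using elim g by simp
    also have "\<dots> \<le> e m + \<eta> m * S + sqrt (e m)"
      using divide_sqrt_add_le[OF e0, of "1 / real (Suc m)" m] by (simp add: \<eta>_def)
    finally show ?case .
  qed
  moreover have "(\<lambda>m. e m + \<eta> m * S + sqrt (e m)) \<longlonglongrightarrow> 0"
  proof -
    have s: "(\<lambda>m. sqrt (e m)) \<longlonglongrightarrow> 0" using tendsto_real_sqrt[OF e] by simp
    have "\<eta> \<longlonglongrightarrow> 0" unfolding \<eta>_def using tendsto_add[OF s LIMSEQ_inverse_real_of_nat] by (simp add: inverse_eq_divide)
    from tendsto_add[OF tendsto_add[OF e tendsto_mult_left_zero[OF this]] s] show ?thesis by simp
  qed
  ultimately have "(\<lambda>m. (LINT u|N. (norm (G m u))\<^sup>2) - S) \<longlonglongrightarrow> 0"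
    by (rule Lim_null_comparison)
  then show ?thesis unfolding S_def by (simp add: LIM_zero_iff)
qed

lemma (in prob_space) tendsto_integral_iexp:
  fixes Z :: "'a \<Rightarrow> real"
  assumes [measurable]: "Z \<in> borel_measurable M" "\<And>m. Y m \<in> borel_measurable M"
    and lim: "(\<lambda>m. \<integral>\<^sup>+ \<omega>. ennreal ((norm (Y m \<omega> - Z \<omega>))\<^sup>2) \<partial>M) \<longlonglongrightarrow> 0"
  shows "(\<lambda>m. LINT \<omega>|M. iexp (Y m \<omega>)) \<longlonglongrightarrow> (LINT \<omega>|M. iexp (Z \<omega>))"
proof -
  define e where "e m = (LINT \<omega>|M. (norm (Y m \<omega> - Z \<omega>))\<^sup>2)" for m
  define \<eta> where "\<eta> m = sqrt (e m) + 1 / real (Suc m)" for m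
  have e: "e \<longlonglongrightarrow> 0" and int: "eventually (\<lambda>m. integrable M (\<lambda>u. (norm (Y m u - Z u))\<^sup>2)) sequentially"
    using L2_null_imp_real_integral_null[OF _ lim] by (simp_all add: e_def[abs_def])
  have e0: "e m \<ge> 0" for m unfolding e_def by (intro integral_nonneg_AE) simp
  have \<eta>0: "\<eta> m > 0" for m unfolding \<eta>_def using e0[of m] by (intro add_nonneg_pos) auto
  have "eventually (\<lambda>m. norm ((LINT \<omega>|M. iexp (Y m \<omega>)) - (LINT \<omega>|M. iexp (Z \<omega>))) \<le> (\<eta> m + sqrt (e m)) / 2) sequentially"
    using int
  proof eventually_elim
    case (elim m)
    have i: "integrable M (\<lambda>\<omega>. iexp (Y m \<omega>))" "integrable M (\<lambda>\<omega>. iexp (Z \<omega>))"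
      by (rule integrable_iexp, simp_all)+
    have "norm ((LINT \<omega>|M. iexp (Y m \<omega>)) - (LINT \<omega>|M. iexp (Z \<omega>))) = norm (LINT \<omega>|M. iexp (Y m \<omega>) - iexp (Z \<omega>))"
      using i by simp
    also have "\<dots> \<le> (LINT \<omega>|M. (\<eta> m + (norm (Y m \<omega> - Z \<omega>))\<^sup>2 / \<eta> m) / 2)"
    proof (rule order_trans[OF integral_norm_bound integral_mono])
      show "integrable M (\<lambda>\<omega>. (\<eta> m + (norm (Y m \<omega> - Z \<omega>))\<^sup>2 / \<eta> m) / 2)" using elim by simp
      fix \<omega>
      show "norm (iexp (Y m \<omega>) - iexp (Z \<omega>)) \<le> (\<eta> m + (norm (Y m \<omega> - Z \<omega>))\<^sup>2 / \<eta> m) / 2"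
        using norm_iexp_diff_le[of "Y m \<omega>" "Z \<omega>"] AM_GM_weighted[OF \<eta>0[of m], of 1 "\<bar>Y m \<omega> - Z \<omega>\<bar>"] by simp
    qed (use i in simp)
    also have "\<dots> = (\<eta> m + e m / \<eta> m) / 2" unfolding e_def using elim by (simp add: prob_space)
    also have "\<dots> \<le> (\<eta> m + sqrt (e m)) / 2"
      using divide_sqrt_add_le[OF e0, of "1 / real (Suc m)" m]
      unfolding \<eta>_def by (intro divide_right_mono add_left_mono) simp_all
    finally show ?case .
  qed
  moreover have "(\<lambda>m. (\<eta> m + sqrt (e m)) / 2) \<longlonglongrightarrow> 0"
  proof -
    have s: "(\<lambda>m. sqrt (e m)) \<longlonglongrightarrow> 0" using tendsto_real_sqrt[OF e] by simp
    have "\<eta> \<longlonglongrightarrow> 0" unfolding \<eta>_def using tendsto_add[OF s LIMSEQ_inverse_real_of_nat] by (simp add: inverse_eq_divide)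
    from tendsto_divide[OF tendsto_add[OF this s] tendsto_const[of 2]] show ?thesis by simp
  qed
  ultimately have "(\<lambda>m. (LINT \<omega>|M. iexp (Y m \<omega>)) - (LINT \<omega>|M. iexp (Z \<omega>))) \<longlonglongrightarrow> 0"
    by (rule Lim_null_comparison)
  then show ?thesis by (simp add: LIM_zero_iff)
qed


text \<open>Keeping \<open>h\<close> apart from \<open>D\<close> allows linear images of the
  approximation errors, weighted by the norms of test vectors. The factor \<open>card K\<close> in
  the constants comes from the Cauchy-Schwarz inequality.\<close>

lemma nn_integral_norm_sum_square_null:
  fixes D :: "'k \<Rightarrow> nat \<Rightarrow> 'a \<Rightarrow> 'b::euclidean_space" and h :: "'k \<Rightarrow> nat \<Rightarrow> 'a \<Rightarrow> 'c::euclidean_space"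
  assumes K: "finite K" and [measurable]: "\<And>k m. k \<in> K \<Longrightarrow> D k m \<in> borel_measurable N"
    and lim: "\<And>k. k \<in> K \<Longrightarrow> (\<lambda>m. \<integral>\<^sup>+ u. ennreal ((norm (D k m u))\<^sup>2) \<partial>N) \<longlonglongrightarrow> 0"
    and le: "\<And>k m u. k \<in> K \<Longrightarrow> norm (h k m u) \<le> c k * norm (D k m u)"
    and c: "\<And>k. c k \<ge> 0"
  shows "(\<lambda>m. \<integral>\<^sup>+ u. ennreal ((norm (\<Sum>k\<in>K. h k m u))\<^sup>2) \<partial>N) \<longlonglongrightarrow> 0"
proof (rule tendsto_sandwich[OF _ _ tendsto_const])
  define C where "C k = (c k)\<^sup>2 * real (card K)" for k
  show "eventually (\<lambda>m. (\<integral>\<^sup>+ u. ennreal ((norm (\<Sum>k\<in>K. h k m u))\<^sup>2) \<partial>N)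
      \<le> (\<Sum>k\<in>K. ennreal (C k) * (\<integral>\<^sup>+ u. ennreal ((norm (D k m u))\<^sup>2) \<partial>N))) sequentially"
  proof (rule always_eventually, rule allI)
    fix m
    have "(\<integral>\<^sup>+ u. ennreal ((norm (\<Sum>k\<in>K. h k m u))\<^sup>2) \<partial>N)
        \<le> (\<integral>\<^sup>+ u. (\<Sum>k\<in>K. ennreal (C k) * ennreal ((norm (D k m u))\<^sup>2)) \<partial>N)"
    proof (rule nn_integral_mono)
      fix u
      have "norm (\<Sum>k\<in>K. h k m u) \<le> (\<Sum>k\<in>K. c k * norm (D k m u))"
        by (rule order_trans[OF norm_sum sum_mono]) (rule le)
      then have "(norm (\<Sum>k\<in>K. h k m u))\<^sup>2 \<le> (\<Sum>k\<in>K. c k * norm (D k m u))\<^sup>2"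
        by (rule power_mono) simp
      also have "\<dots> \<le> (\<Sum>k\<in>K. (c k * norm (D k m u))\<^sup>2) * card K"
        by (rule sum_squared_le_sum_of_squares)
      also have "\<dots> = (\<Sum>k\<in>K. C k * (norm (D k m u))\<^sup>2)"
        by (simp add: C_def sum_distrib_left power_mult_distrib mult_ac)
      finally have "ennreal ((norm (\<Sum>k\<in>K. h k m u))\<^sup>2) \<le> ennreal (\<Sum>k\<in>K. C k * (norm (D k m u))\<^sup>2)"
        by (rule ennreal_leI)
      also have "\<dots> = (\<Sum>k\<in>K. ennreal (C k * (norm (D k m u))\<^sup>2))"
        by (rule sum_ennreal[symmetric]) (simp add: C_def)
      also have "\<dots> = (\<Sum>k\<in>K. ennreal (C k) * ennreal ((norm (D k m u))\<^sup>2))"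
        by (intro sum.cong refl ennreal_mult) (simp_all add: C_def)
      finally show "ennreal ((norm (\<Sum>k\<in>K. h k m u))\<^sup>2) \<le> (\<Sum>k\<in>K. ennreal (C k) * ennreal ((norm (D k m u))\<^sup>2))" .
    qed
    also have "\<dots> = (\<Sum>k\<in>K. ennreal (C k) * (\<integral>\<^sup>+ u. ennreal ((norm (D k m u))\<^sup>2) \<partial>N))"
      by (subst nn_integral_sum) (auto intro!: sum.cong nn_integral_cmult)
    finally show "(\<integral>\<^sup>+ u. ennreal ((norm (\<Sum>k\<in>K. h k m u))\<^sup>2) \<partial>N)
      \<le> (\<Sum>k\<in>K. ennreal (C k) * (\<integral>\<^sup>+ u. ennreal ((norm (D k m u))\<^sup>2) \<partial>N))" .
  qed
  have "(\<lambda>m. \<Sum>k\<in>K. ennreal (C k) * (\<integral>\<^sup>+ u. ennreal ((norm (D k m u))\<^sup>2) \<partial>N)) \<longlonglongrightarrow> (\<Sum>k\<in>K. ennreal (C k) * 0)"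
    by (intro tendsto_sum ennreal_tendsto_cmult lim) simp_all
  then show "(\<lambda>m. \<Sum>k\<in>K. ennreal (C k) * (\<integral>\<^sup>+ u. ennreal ((norm (D k m u))\<^sup>2) \<partial>N)) \<longlonglongrightarrow> 0" by simp
qed simp

text \<open>Both sides are continuous under mean-square approximation, so step functions suffice.
  Each \<open>k\<close> brings its own sequence of partitions, which is why overlapping increments
  have to be covered.\<close>

lemma (in prob_space) integral_iexp_wiener:
  fixes W :: "real \<Rightarrow> 'a \<Rightarrow> real ^ 'd" and f :: "'k \<Rightarrow> real \<Rightarrow> real ^ 'd ^ 'd"
  assumes W: "two_sided_brownian_motion M W" and K: "finite K"
    and Y: "\<And>k. k \<in> K \<Longrightarrow> has_wiener_integral M W (f k) (Y k)"
    and int: "integrable lborel (\<lambda>u. (norm (\<Sum>k\<in>K. x k v* f k u))\<^sup>2)"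
  shows "(LINT \<omega>|M. iexp (\<Sum>k\<in>K. x k \<bullet> Y k \<omega>))
    = exp (- (LINT u|lborel. (norm (\<Sum>k\<in>K. x k v* f k u))\<^sup>2) / 2)"
proof -
  note measurable_brownian_motion[OF W, measurable]
  have f [measurable]: "f k \<in> borel_measurable borel" and Ym [measurable]: "Y k \<in> borel_measurable M"
    if "k \<in> K" for k using Y[OF that] by (simp_all add: has_wiener_integral_def)
  have "\<forall>k. \<exists>n \<tau> C. k \<in> K \<longrightarrow> (\<forall>m. mono (\<tau> m)) \<and>
      (\<lambda>m. \<integral>\<^sup>+ u. ennreal ((norm (f k u - step_function (n m) (\<tau> m) (C m) u))\<^sup>2) \<partial>lborel) \<longlonglongrightarrow> 0 \<and>
      (\<lambda>m. \<integral>\<^sup>+ \<omega>. ennreal ((norm (Y k \<omega> - step_integral W (n m) (\<tau> m) (C m) \<omega>))\<^sup>2) \<partial>M) \<longlonglongrightarrow> 0"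
    using Y unfolding has_wiener_integral_def by blast
  then obtain n \<tau> C where \<tau>: "\<And>k m. k \<in> K \<Longrightarrow> mono (\<tau> k m)"
    and limf: "\<And>k. k \<in> K \<Longrightarrow> (\<lambda>m. \<integral>\<^sup>+ u. ennreal ((norm (f k u - step_function (n k m) (\<tau> k m) (C k m) u))\<^sup>2) \<partial>lborel) \<longlonglongrightarrow> 0"
    and limY: "\<And>k. k \<in> K \<Longrightarrow> (\<lambda>m. \<integral>\<^sup>+ \<omega>. ennreal ((norm (Y k \<omega> - step_integral W (n k m) (\<tau> k m) (C k m) \<omega>))\<^sup>2) \<partial>M) \<longlonglongrightarrow> 0"
    by (simp only: choice_iff) blast
  define F where "F k m = step_function (n k m) (\<tau> k m) (C k m)" for k m
  define S where "S k m = step_integral W (n k m) (\<tau> k m) (C k m)" for k m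
  have [measurable]: "F k m \<in> borel_measurable borel" for k m
    unfolding F_def step_function_def[abs_def] by measurable
  have [measurable]: "S k m \<in> borel_measurable M" for k m
    unfolding S_def step_integral_def[abs_def]
    by (intro borel_measurable_sum borel_measurable_continuous_on[OF matrix_vector_mult_linear_continuous_on]) measurable
  define Z where "Z m \<omega> = (\<Sum>k\<in>K. x k \<bullet> S k m \<omega>)" for m \<omega>
  define g where "g m u = (\<Sum>k\<in>K. x k v* F k m u)" for m u
  have step: "(LINT \<omega>|M. iexp (Z m \<omega>)) = exp (- (LINT u|lborel. (norm (g m u))\<^sup>2) / 2)" for m
  proof -
    \<comment> \<open>Process index and interval index are merged into one family; passing to
      \<open>x k v* C k m i\<close> lets the test vector act directly on the increments.\<close>
    define J where "J = Sigma K (\<lambda>k. {..<n k m})"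
    define a where "a = (\<lambda>(k, i). \<tau> k m i)"
    define b where "b = (\<lambda>(k, i). \<tau> k m (Suc i))"
    define v where "v = (\<lambda>(k, i). x k v* C k m i)"
    have J: "finite J" using K by (simp add: J_def)
    have "Z m \<omega> = (\<Sum>k\<in>K. \<Sum>i<n k m. (x k v* C k m i) \<bullet> (W (\<tau> k m (Suc i)) \<omega> - W (\<tau> k m i) \<omega>))" for \<omega>
      unfolding Z_def S_def step_integral_def by (simp add: inner_sum_right dot_lmul_matrix)
    also have "\<dots> \<omega> = (\<Sum>j\<in>J. v j \<bullet> (W (b j) \<omega> - W (a j) \<omega>))" for \<omega>
      unfolding J_def using K by (subst sum.Sigma) (auto simp: v_def a_def b_def intro!: sum.cong)
    finally have Z: "Z m \<omega> = (\<Sum>j\<in>J. v j \<bullet> (W (b j) \<omega> - W (a j) \<omega>))" for \<omega> .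
    have "g m u = (\<Sum>k\<in>K. \<Sum>i<n k m. indicator {\<tau> k m i<..\<tau> k m (Suc i)} u *\<^sub>R (x k v* C k m i))" for u
      unfolding g_def F_def step_function_def
      by (simp only: linear_sum[OF linear_vector_matrix_mult] linear_scale[OF linear_vector_matrix_mult])
    also have "\<dots> u = (\<Sum>j\<in>J. indicator {a j<..b j} u *\<^sub>R v j)" for u
      unfolding J_def using K by (subst sum.Sigma) (auto simp: v_def a_def b_def simp del: sum_indicator_scaleR intro!: sum.cong)
    finally have g: "g m u = (\<Sum>j\<in>J. indicator {a j<..b j} u *\<^sub>R v j)" for u .
    have ab: "a j \<le> b j" if "j \<in> J" for j
      using that \<tau> by (auto simp: J_def a_def b_def split: prod.splits intro: monoD)
    show ?thesis unfolding Z g by (rule integral_iexp_overlapping_increments[OF W J ab])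
  qed
  have "(\<lambda>m. \<integral>\<^sup>+ u. ennreal ((norm (\<Sum>k\<in>K. x k v* (F k m u - f k u)))\<^sup>2) \<partial>lborel) \<longlonglongrightarrow> 0"
  proof (rule nn_integral_norm_sum_square_null[where D = "\<lambda>k m u. F k m u - f k u" and c = "\<lambda>k. norm (x k)"])
    show "(\<lambda>m. \<integral>\<^sup>+ u. ennreal ((norm (F k m u - f k u))\<^sup>2) \<partial>lborel) \<longlonglongrightarrow> 0" if "k \<in> K" for k
      using limf[OF that] by (simp add: F_def norm_minus_commute)
    show "norm (x k v* (F k m u - f k u)) \<le> norm (x k) * norm (F k m u - f k u)" for k m u
      using norm_vector_matrix_mult_le[of "x k" "F k m u - f k u"] by (simp add: mult.commute)
  qed (use K in simp_all)
  then have "(\<lambda>m. \<integral>\<^sup>+ u. ennreal ((norm (g m u - (\<Sum>k\<in>K. x k v* f k u)))\<^sup>2) \<partial>lborel) \<longlonglongrightarrow> 0"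
    by (simp only: g_def linear_diff[OF linear_vector_matrix_mult] sum_subtractf)
  then have "(\<lambda>m. LINT u|lborel. (norm (g m u))\<^sup>2) \<longlonglongrightarrow> (LINT u|lborel. (norm (\<Sum>k\<in>K. x k v* f k u))\<^sup>2)"
    by (intro tendsto_integral_norm_square int) (simp_all add: g_def)
  then have "(\<lambda>m. complex_of_real (exp (- (LINT u|lborel. (norm (g m u))\<^sup>2) / 2))) \<longlonglongrightarrow>
      complex_of_real (exp (- (LINT u|lborel. (norm (\<Sum>k\<in>K. x k v* f k u))\<^sup>2) / 2))"
    by (intro tendsto_intros) auto
  moreover have "(\<lambda>m. \<integral>\<^sup>+ \<omega>. ennreal ((norm (\<Sum>k\<in>K. x k \<bullet> (S k m \<omega> - Y k \<omega>)))\<^sup>2) \<partial>M) \<longlonglongrightarrow> 0"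
  proof (rule nn_integral_norm_sum_square_null[where D = "\<lambda>k m \<omega>. S k m \<omega> - Y k \<omega>" and c = "\<lambda>k. norm (x k)"])
    show "(\<lambda>m. \<integral>\<^sup>+ \<omega>. ennreal ((norm (S k m \<omega> - Y k \<omega>))\<^sup>2) \<partial>M) \<longlonglongrightarrow> 0" if "k \<in> K" for k
      using limY[OF that] by (simp add: S_def norm_minus_commute)
    show "norm (x k \<bullet> (S k m \<omega> - Y k \<omega>)) \<le> norm (x k) * norm (S k m \<omega> - Y k \<omega>)" for k m \<omega>
      using Cauchy_Schwarz_ineq2[of "x k" "S k m \<omega> - Y k \<omega>"] by simp
  qed (use K in simp_all)
  then have "(\<lambda>m. \<integral>\<^sup>+ \<omega>. ennreal ((norm (Z m \<omega> - (\<Sum>k\<in>K. x k \<bullet> Y k \<omega>)))\<^sup>2) \<partial>M) \<longlonglongrightarrow> 0"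
    by (simp add: Z_def inner_diff_right sum_subtractf)
  then have "(\<lambda>m. LINT \<omega>|M. iexp (Z m \<omega>)) \<longlonglongrightarrow> (LINT \<omega>|M. iexp (\<Sum>k\<in>K. x k \<bullet> Y k \<omega>))"
    by (intro tendsto_integral_iexp) (simp_all add: Z_def)
  ultimately show ?thesis unfolding step by (rule LIMSEQ_unique[rotated])
qed

section \<open>Coordinate subspaces\<close>

text \<open>Supports are sets of basis vectors instead of indices, so that matrices can be treated
  as vectors of a Euclidean space.\<close>

definition supported_on :: "'a::euclidean_space set \<Rightarrow> 'a \<Rightarrow> bool" where
  "supported_on J v \<longleftrightarrow> (\<forall>b\<in>Basis - J. v \<bullet> b = 0)"

definition coord_proj :: "'a::euclidean_space set \<Rightarrow> 'a \<Rightarrow> 'a" where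
  "coord_proj J v = (\<Sum>b\<in>J. (v \<bullet> b) *\<^sub>R b)"

lemma inner_sum_Basis:
  assumes "J \<subseteq> Basis" "b \<in> Basis"
  shows "(\<Sum>c\<in>J. x c *\<^sub>R c) \<bullet> b = (if b \<in> J then x b else 0)"
proof -
  have fin: "finite J" using assms(1) finite_Basis by (rule finite_subset)
  have "(\<Sum>c\<in>J. x c *\<^sub>R c) \<bullet> b = (\<Sum>c\<in>J. if c = b then x b else 0)"
    unfolding inner_sum_left using assms by (intro sum.cong) (auto simp: inner_Basis)
  then show ?thesis using fin by simp
qed

lemma supported_on_coord_proj: "J \<subseteq> Basis \<Longrightarrow> supported_on J (coord_proj J v)"
  by (auto simp: supported_on_def coord_proj_def inner_sum_Basis)

lemma coord_proj_inner: "J \<subseteq> Basis \<Longrightarrow> b \<in> Basis \<Longrightarrow> coord_proj J v \<bullet> b = (if b \<in> J then v \<bullet> b else 0)"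
  by (simp add: coord_proj_def inner_sum_Basis)

lemma coord_proj_Un:
  assumes "J \<subseteq> Basis" "K \<subseteq> Basis" "J \<inter> K = {}" "supported_on (J \<union> K) v"
  shows "v = coord_proj J v + coord_proj K v"
proof (rule euclidean_eqI)
  fix b :: 'a assume b: "b \<in> Basis"
  have 0: "v \<bullet> b = 0" if "b \<notin> J" "b \<notin> K" using assms(4) b that by (simp add: supported_on_def)
  have 1: "\<not> (b \<in> J \<and> b \<in> K)" using assms(3) by blast
  show "v \<bullet> b = (coord_proj J v + coord_proj K v) \<bullet> b"
    unfolding inner_add_left coord_proj_inner[OF assms(1) b] coord_proj_inner[OF assms(2) b]
    using 0 1 by (cases "b \<in> J"; cases "b \<in> K") simp_all
qed

lemma norm_square_supported:
  assumes "J \<subseteq> Basis" "supported_on J v"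
  shows "(norm v)\<^sup>2 = (\<Sum>b\<in>J. (v \<bullet> b)\<^sup>2)"
proof -
  have "(norm v)\<^sup>2 = (\<Sum>b\<in>Basis. (v \<bullet> b)\<^sup>2)"
    unfolding power2_norm_eq_inner by (subst euclidean_inner) (simp add: power2_eq_square)
  also have "\<dots> = (\<Sum>b\<in>J. (v \<bullet> b)\<^sup>2)"
  proof (rule sum.mono_neutral_right)
    show "\<forall>b\<in>Basis - J. (v \<bullet> b)\<^sup>2 = 0"
      using assms(2) unfolding supported_on_def by simp
  qed (use assms(1) in simp_all)
  finally show ?thesis .
qed

lemma supported_on_mono: "supported_on J v \<Longrightarrow> J \<subseteq> K \<Longrightarrow> supported_on K v"
  by (auto simp: supported_on_def)

lemma supported_on_add: "supported_on J u \<Longrightarrow> supported_on J v \<Longrightarrow> supported_on J (u + v)"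
  by (simp add: supported_on_def inner_add_left)

lemma supported_on_diff: "supported_on J u \<Longrightarrow> supported_on J v \<Longrightarrow> supported_on J (u - v)"
  by (simp add: supported_on_def inner_diff_left)

lemma supported_on_scaleR: "supported_on J u \<Longrightarrow> supported_on J (c *\<^sub>R u)"
  by (simp add: supported_on_def)

lemma sum_abs_supported_le:
  assumes "J \<subseteq> Basis" "supported_on J v"
  shows "(\<Sum>b\<in>J. \<bar>v \<bullet> b\<bar>) \<le> sqrt (card J) * norm v"
proof -
  have "(\<Sum>b\<in>J. \<bar>v \<bullet> b\<bar>)\<^sup>2 \<le> (\<Sum>b\<in>J. \<bar>v \<bullet> b\<bar>\<^sup>2) * card J" by (rule sum_squared_le_sum_of_squares)
  also have "\<dots> = (sqrt (card J) * norm v)\<^sup>2"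
    by (simp add: power_mult_distrib norm_square_supported[OF assms] mult.commute)
  finally show ?thesis by (rule power2_le_imp_le) simp
qed

section \<open>A lattice net of a coordinate ball\<close>

text \<open>The full two-sided series is \<open>(1 + q) / (1 - q)\<close>, which is 7 at
  \<open>q = 3 / 4\<close>. The subtracted term makes the induction close:
  \<open>2 * q - 6 \<le> - 6 * q\<close> holds exactly for \<open>q \<le> 3 / 4\<close>.\<close>

lemma sum_geometric_int_le:
  fixes q :: real
  assumes "0 \<le> q" "q \<le> 3 / 4"
  shows "(\<Sum>z\<in>{- int n..int n}. q ^ nat \<bar>z\<bar>) \<le> 7 - 6 * q ^ n"
proof (induction n)
  case (Suc n)
  have "{- int (Suc n)..int (Suc n)} = insert (- int (Suc n)) (insert (int (Suc n)) {- int n..int n})"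
    by auto
  then have "(\<Sum>z\<in>{- int (Suc n)..int (Suc n)}. q ^ nat \<bar>z\<bar>) = 2 * q ^ Suc n + (\<Sum>z\<in>{- int n..int n}. q ^ nat \<bar>z\<bar>)"
    by (simp add: nat_add_distrib)
  also have "\<dots> \<le> 7 + (2 * q - 6) * q ^ n" using Suc by (simp add: algebra_simps)
  also have "\<dots> \<le> 7 + (- 6 * q) * q ^ n" using assms by (intro add_left_mono mult_right_mono) auto
  finally show ?case by (simp add: mult.assoc)
qed simp

text \<open>Each lattice point of the ball has weight \<open>(\<Prod>b\<in>J. exp (1 - \<bar>z b\<bar> / 3)) \<ge> 1\<close>, and each coordinate
  contributes a factor of at most \<open>7 * exp 1 \<le> 21\<close> to the total weight.\<close>

lemma card_lattice_l1_ball_le: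
  assumes J: "finite J"
  shows "card {z \<in> PiE J (\<lambda>_. {- int n..int n}). (\<Sum>b\<in>J. \<bar>z b\<bar>) \<le> 3 * int (card J)} \<le> 21 ^ card J"
    (is "card ?Z \<le> _")
proof -
  \<comment> \<open>Three properties fix this value: \<open>q \<le> 3 / 4\<close> for the geometric
    sum, \<open>q ^ (3 * k) = exp (- real k)\<close> to offset the factors \<open>exp 1\<close> at
    the radius of the ball, and \<open>7 * exp 1 \<le> 21\<close>. The box only ensures finiteness;
    the bound does not depend on \<open>n\<close>.\<close>
  define q where "q = exp (- 1 / 3 :: real)"
  have e: "4 / 3 \<le> exp (1 / 3 :: real)" using exp_ge_add_one_self[of "1 / 3"] by simp
  then have q: "0 \<le> q" "q \<le> 3 / 4" by (simp_all add: q_def exp_minus field_simps)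
  have q3: "q ^ (3 * k) = exp (- real k)" for k
    by (simp add: q_def exp_of_nat_mult[symmetric])
  have fin: "finite (PiE J (\<lambda>_. {- int n..int n}))" using J by (intro finite_PiE) auto
  have "real (card ?Z) = (\<Sum>z\<in>?Z. 1)" by simp
  also have "\<dots> \<le> (\<Sum>z\<in>?Z. \<Prod>b\<in>J. exp 1 * q ^ nat \<bar>z b\<bar>)"
  proof (rule sum_mono)
    fix z assume "z \<in> ?Z"
    then have "(\<Sum>b\<in>J. \<bar>z b\<bar>) \<le> 3 * int (card J)" by simp
    moreover have "int (\<Sum>b\<in>J. nat \<bar>z b\<bar>) = (\<Sum>b\<in>J. \<bar>z b\<bar>)" by simp
    ultimately have "(\<Sum>b\<in>J. nat \<bar>z b\<bar>) \<le> 3 * card J" by linarith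
    then have "q ^ (3 * card J) \<le> q ^ (\<Sum>b\<in>J. nat \<bar>z b\<bar>)" using q by (intro power_decreasing) auto
    then have "exp (real (card J)) * exp (- real (card J)) \<le> exp (real (card J)) * q ^ (\<Sum>b\<in>J. nat \<bar>z b\<bar>)"
      by (simp add: q3)
    moreover have "(\<Prod>b\<in>J. exp 1 * q ^ nat \<bar>z b\<bar>) = exp (real (card J)) * q ^ (\<Sum>b\<in>J. nat \<bar>z b\<bar>)"
      by (simp add: prod.distrib power_sum exp_of_nat_mult[symmetric])
    ultimately show "1 \<le> (\<Prod>b\<in>J. exp 1 * q ^ nat \<bar>z b\<bar>)" by (simp add: exp_minus)
  qed
  also have "\<dots> \<le> (\<Sum>z\<in>PiE J (\<lambda>_. {- int n..int n}). \<Prod>b\<in>J. exp 1 * q ^ nat \<bar>z b\<bar>)"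
    using q fin by (intro sum_mono2) (auto intro!: prod_nonneg)
  also have "\<dots> = (\<Prod>b\<in>J. \<Sum>z\<in>{- int n..int n}. exp 1 * q ^ nat \<bar>z\<bar>)"
    by (rule prod_sum_PiE[symmetric]) (use J in simp_all)
  also have "\<dots> \<le> (\<Prod>b\<in>J. 21)"
  proof (intro prod_mono conjI)
    have "(\<Sum>z\<in>{- int n..int n}. exp 1 * q ^ nat \<bar>z\<bar>) = exp 1 * (\<Sum>z\<in>{- int n..int n}. q ^ nat \<bar>z\<bar>)"
      by (simp add: sum_distrib_left)
    also have "\<dots> \<le> 3 * 7"
      using e_less_272 sum_geometric_int_le[OF q, of n] q
      by (intro mult_mono order_trans[OF sum_geometric_int_le[OF q]] sum_nonneg) auto
    finally show "(\<Sum>z\<in>{- int n..int n}. exp 1 * q ^ nat \<bar>z\<bar>) \<le> 21" by simp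
  qed (use q in \<open>auto intro!: sum_nonneg\<close>)
  finally have "real (card ?Z) \<le> real (21 ^ card J)" by simp
  then show ?thesis by (simp only: of_nat_le_iff)
qed

text \<open>The net consists of the points of a scaled integer lattice that lie in the ball. The
  Cauchy-Schwarz inequality places the points needed in an l1 ball of the lattice, where they have
  been counted.\<close>

lemma exists_coordinate_net:
  fixes J :: "'a::euclidean_space set"
  assumes J: "J \<subseteq> Basis"
  obtains N where "finite N" "card N \<le> 21 ^ card J" "\<And>u. u \<in> N \<Longrightarrow> supported_on J u \<and> norm u \<le> 1"
    "\<And>v. supported_on J v \<Longrightarrow> norm v \<le> 1 \<Longrightarrow> \<exists>u\<in>N. norm (v - u) \<le> 1 / 3"
proof -
  have finJ: "finite J" using J finite_Basis by (rule finite_subset)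
  show thesis
  proof (cases "J = {}")
    \<comment> \<open>For empty \<open>J\<close> the mesh used below would be a division by
      zero.\<close>
    case True
    have "norm (v - 0) \<le> 1 / 3" if "supported_on J v" for v
      using norm_square_supported[OF J that] True by simp
    moreover have "supported_on J (0 :: 'a)" by (simp add: supported_on_def)
    ultimately show thesis by (intro that[of "{0}"]) (simp_all del: diff_0_right)
  next
    case False
    define m where "m = card J"
    \<comment> \<open>Coordinatewise rounding then has error at most
      \<open>sqrt (real m) * h = 1 / 3\<close>, and \<open>sqrt (real m) / h = 3 * real m\<close> is
      the radius of the l1 ball.\<close>
    define h where "h = 1 / (3 * sqrt (real m))"
    have m: "m > 0" using False finJ by (simp add: m_def card_gt_0_iff)
    then have h: "h > 0" and mh: "real m * h\<^sup>2 = 1 / 9" by (simp_all add: h_def power_divide power_mult_distrib)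
    define Z where "Z = {z \<in> PiE J (\<lambda>_. {- int (3 * m)..int (3 * m)}). (\<Sum>b\<in>J. \<bar>z b\<bar>) \<le> 3 * int (card J)}"
    define pt :: "('a \<Rightarrow> int) \<Rightarrow> 'a" where "pt z = (\<Sum>b\<in>J. (h * of_int (z b)) *\<^sub>R b)" for z
    define N where "N = {u \<in> pt ` Z. norm u \<le> 1}"
    have finZ: "finite Z" unfolding Z_def using finJ by (auto intro!: finite_PiE)
    have ptJ: "supported_on J (pt z)" for z using J by (auto simp: supported_on_def pt_def inner_sum_Basis)
    have pt_inner: "pt z \<bullet> b = h * of_int (z b)" if "b \<in> J" for z b
      using J that by (subst pt_def, subst inner_sum_Basis) auto
    show thesis
    proof (rule that[of N])
      show "finite N" using finZ by (simp add: N_def)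
      have "card N \<le> card Z" unfolding N_def using finZ
        by (intro order_trans[OF card_mono card_image_le]) auto
      also have "\<dots> \<le> 21 ^ card J" unfolding Z_def by (rule card_lattice_l1_ball_le[OF finJ])
      finally show "card N \<le> 21 ^ card J" .
      show "supported_on J u \<and> norm u \<le> 1" if "u \<in> N" for u using that ptJ by (auto simp: N_def)
      fix v :: 'a assume v: "supported_on J v" "norm v \<le> 1"
      \<comment> \<open>Rounding goes towards zero: no coordinate grows in absolute value, so the
        rounded point stays in the unit ball and in the l1 ball.\<close>
      define t :: "real \<Rightarrow> int" where "t x = (if x \<ge> 0 then \<lfloor>x\<rfloor> else \<lceil>x\<rceil>)" for x
      have t: "\<bar>of_int (t x)\<bar> \<le> \<bar>x\<bar>" "\<bar>x - of_int (t x)\<bar> \<le> 1" for x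
      proof -
        have "0 \<le> real_of_int \<lfloor>x\<rfloor>" if "x \<ge> 0" using that by simp
        moreover have "real_of_int \<lceil>x\<rceil> \<le> 0" if "\<not> x \<ge> 0" using that by simp
        ultimately show "\<bar>of_int (t x)\<bar> \<le> \<bar>x\<bar>" "\<bar>x - of_int (t x)\<bar> \<le> 1"
          using floor_correct[of x] ceiling_correct[of x] unfolding t_def by (cases "x \<ge> 0"; simp; linarith)+
      qed
      define z where "z = restrict (\<lambda>b. t ((v \<bullet> b) / h)) J"
      have z: "\<bar>h * of_int (z b)\<bar> \<le> \<bar>v \<bullet> b\<bar>" "\<bar>v \<bullet> b - h * of_int (z b)\<bar> \<le> h" if "b \<in> J" for b
      proof -
        have *: "v \<bullet> b - h * of_int (z b) = h * ((v \<bullet> b) / h - of_int (t ((v \<bullet> b) / h)))"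
          using h that by (simp add: z_def right_diff_distrib)
        show "\<bar>h * of_int (z b)\<bar> \<le> \<bar>v \<bullet> b\<bar>"
          using t(1)[of "(v \<bullet> b) / h"] h that by (simp add: z_def abs_mult field_simps)
        show "\<bar>v \<bullet> b - h * of_int (z b)\<bar> \<le> h"
          unfolding * abs_mult using t(2)[of "(v \<bullet> b) / h"] h by simp
      qed
      have "h * real_of_int (\<Sum>b\<in>J. \<bar>z b\<bar>) = (\<Sum>b\<in>J. \<bar>h * of_int (z b)\<bar>)"
        using h by (simp add: sum_distrib_left abs_mult)
      also have "\<dots> \<le> (\<Sum>b\<in>J. \<bar>v \<bullet> b\<bar>)" by (intro sum_mono z)
      also have "\<dots> \<le> sqrt m * norm v" unfolding m_def by (rule sum_abs_supported_le[OF J v(1)])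
      also have "\<dots> \<le> sqrt m * 1" using v(2) by (intro mult_left_mono) auto
      also have "\<dots> = h * (3 * m)" using m by (simp add: h_def real_div_sqrt)
      finally have "real_of_int (\<Sum>b\<in>J. \<bar>z b\<bar>) \<le> 3 * m" using h by (simp only: mult_le_cancel_left_pos)
      then have "real_of_int (\<Sum>b\<in>J. \<bar>z b\<bar>) \<le> real_of_int (3 * int (card J))" by (simp add: m_def)
      then have s: "(\<Sum>b\<in>J. \<bar>z b\<bar>) \<le> 3 * int (card J)" by (simp only: of_int_le_iff)
      have "z b \<in> {- int (3 * m)..int (3 * m)}" if "b \<in> J" for b
      proof -
        have "\<bar>z b\<bar> \<le> (\<Sum>b\<in>J. \<bar>z b\<bar>)" using that finJ by (intro member_le_sum) auto
        then show ?thesis using s by (simp add: m_def abs_le_iff)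
      qed
      then have "z \<in> PiE J (\<lambda>_. {- int (3 * m)..int (3 * m)})"
        unfolding PiE_iff z_def by simp
      then have zZ: "z \<in> Z" unfolding Z_def using s by simp
      have "(norm (pt z))\<^sup>2 \<le> (norm v)\<^sup>2"
        unfolding norm_square_supported[OF J ptJ] norm_square_supported[OF J v(1)]
        using z(1) by (intro sum_mono) (simp add: pt_inner abs_le_square_iff[symmetric])
      then have "norm (pt z) \<le> 1" using v(2) by (simp add: power2_le_iff_abs_le)
      then have "pt z \<in> N" using zZ by (simp add: N_def)
      moreover have "norm (v - pt z) \<le> 1 / 3"
      proof (rule power2_le_imp_le)
        have "(norm (v - pt z))\<^sup>2 = (\<Sum>b\<in>J. (v \<bullet> b - h * of_int (z b))\<^sup>2)"
          unfolding norm_square_supported[OF J supported_on_diff[OF v(1) ptJ]]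
          by (intro sum.cong) (simp_all add: inner_diff_left pt_inner)
        also have "\<dots> \<le> (\<Sum>b\<in>J. h\<^sup>2)"
          using z(2) h by (intro sum_mono) (auto simp: abs_le_square_iff[symmetric])
        also have "\<dots> = (1 / 3)\<^sup>2" using mh by (simp add: m_def power2_eq_square)
        finally show "(norm (v - pt z))\<^sup>2 \<le> (1 / 3)\<^sup>2" .
      qed simp
      ultimately show "\<exists>u\<in>N. norm (v - u) \<le> 1 / 3" by blast
    qed
  qed
qed

section \<open>Quadratic forms on approximately sparse vectors\<close>

text \<open>After normalising \<open>a\<close> and \<open>b\<close>, \<open>4 * D a' b'\<close> is
  the difference of the values of the form at \<open>a' + b'\<close> and \<open>a' - b'\<close>, and
  by the parallelogram law their squared norms add up to 4. The bound is required only on the span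
  of \<open>a\<close> and \<open>b\<close>, as it will be known only for sparse vectors.\<close>

lemma bilinear_polarization_bound:
  fixes D :: "'a::real_inner \<Rightarrow> 'a \<Rightarrow> real"
  assumes D: "bilinear D" and sym: "\<And>x y. D x y = D y x"
    and le: "\<And>c d. \<bar>D (c *\<^sub>R a + d *\<^sub>R b) (c *\<^sub>R a + d *\<^sub>R b)\<bar> \<le> S * (norm (c *\<^sub>R a + d *\<^sub>R b))\<^sup>2"
  shows "\<bar>D a b\<bar> \<le> S * norm a * norm b"
proof (cases "a = 0 \<or> b = 0")
  case True
  then show ?thesis using D by (auto simp: bilinear_lzero bilinear_rzero)
next
  case False
  define a' b' where "a' = (1 / norm a) *\<^sub>R a" and "b' = (1 / norm b) *\<^sub>R b"
  have n: "norm a' = 1" "norm b' = 1" using False by (simp_all add: a'_def b'_def)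
  have "4 * D a' b' = D (a' + b') (a' + b') - D (a' - b') (a' - b')"
    using sym[of b' a'] by (simp add: bilinear_ladd[OF D] bilinear_radd[OF D] bilinear_lsub[OF D] bilinear_rsub[OF D])
  moreover have "\<bar>D (a' + b') (a' + b')\<bar> \<le> S * (norm (a' + b'))\<^sup>2"
    using le[of "1 / norm a" "1 / norm b"] by (simp add: a'_def b'_def)
  moreover have "\<bar>D (a' - b') (a' - b')\<bar> \<le> S * (norm (a' - b'))\<^sup>2"
    using le[of "1 / norm a" "- 1 / norm b"] by (simp add: a'_def b'_def)
  moreover have "S * (norm (a' + b'))\<^sup>2 + S * (norm (a' - b'))\<^sup>2 = S * (2 * (norm a')\<^sup>2 + 2 * (norm b')\<^sup>2)"
    by (simp add: power2_norm_eq_inner inner_add inner_diff inner_commute algebra_simps)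
  ultimately have "\<bar>D a' b'\<bar> \<le> S" by (simp add: n)
  moreover have "D a b = norm a * norm b * D a' b'"
    using False by (simp add: a'_def b'_def bilinear_lmul[OF D] bilinear_rmul[OF D])
  ultimately show ?thesis
    using mult_left_mono[of "\<bar>D a' b'\<bar>" S "norm a * norm b"] by (simp add: abs_mult mult_ac)
qed

text \<open>For the supremum \<open>S\<close> over the unit ball,
  \<open>D w w - D u u = D (w - u) (w + u)\<close> is at most \<open>S * (1 / 3) * 2\<close> in
  absolute value when \<open>u\<close> is the net point next to \<open>w\<close>. Hence
  \<open>S \<le> x + 2 / 3 * S\<close>, which can be solved for \<open>S\<close> because
  \<open>S\<close> is finite.\<close>

lemma bilinear_bound_from_net:
  fixes D :: "'a::euclidean_space \<Rightarrow> 'a \<Rightarrow> real"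
  assumes D: "bilinear D" and sym: "\<And>x y. D x y = D y x"
    and N: "\<And>u. u \<in> N \<Longrightarrow> supported_on J u \<and> \<bar>D u u\<bar> \<le> x"
    and net: "\<And>v. supported_on J v \<Longrightarrow> norm v \<le> 1 \<Longrightarrow> \<exists>u\<in>N. norm (v - u) \<le> 1 / 3 \<and> norm u \<le> 1"
    and v: "supported_on J v"
  shows "\<bar>D v v\<bar> \<le> 3 * x * (norm v)\<^sup>2"
proof -
  define Q where "Q = {\<bar>D v v\<bar> |v. supported_on J v \<and> norm v \<le> 1}"
  define S where "S = Sup Q"
  obtain B where B: "B > 0" "\<And>x y. norm (D x y) \<le> B * norm x * norm y"
    using bilinear_bounded_pos[OF D] by blast
  have bdd: "bdd_above Q"
  proof (rule bdd_aboveI)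
    fix r assume "r \<in> Q"
    then obtain w where w: "r = \<bar>D w w\<bar>" "norm w \<le> 1" by (auto simp: Q_def)
    have "B * norm w * norm w \<le> B * 1 * 1" using w B by (intro mult_mono) auto
    then show "r \<le> B" using B(2)[of w w] w by simp
  qed
  have ne: "Q \<noteq> {}" by (auto simp: Q_def intro!: exI[of _ 0] simp: supported_on_def)
  have S1: "\<bar>D w w\<bar> \<le> S" if "supported_on J w" "norm w \<le> 1" for w
    unfolding S_def using that by (intro cSup_upper bdd) (auto simp: Q_def)
  have S2: "\<bar>D w w\<bar> \<le> S * (norm w)\<^sup>2" if "supported_on J w" for w
  proof (cases "w = 0")
    case False
    have "\<bar>D ((1 / norm w) *\<^sub>R w) ((1 / norm w) *\<^sub>R w)\<bar> \<le> S"
      using False that by (intro S1 supported_on_scaleR) auto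
    then show ?thesis using False
      by (simp add: bilinear_lmul[OF D] bilinear_rmul[OF D] power2_eq_square field_simps)
  qed (simp add: bilinear_lzero[OF D])
  have S3: "\<bar>D a b\<bar> \<le> S * norm a * norm b" if "supported_on J a" "supported_on J b" for a b
    using D sym by (rule bilinear_polarization_bound) (intro S2 supported_on_add supported_on_scaleR that)
  have S0: "S \<ge> 0" using S1[of 0] by (simp add: supported_on_def)
  have "S \<le> x + 2 / 3 * S"
    unfolding S_def
  proof (rule cSup_least[OF ne], fold S_def)
    fix r assume "r \<in> Q"
    then obtain w where w: "r = \<bar>D w w\<bar>" "supported_on J w" "norm w \<le> 1" by (auto simp: Q_def)
    obtain u where u: "u \<in> N" "norm (w - u) \<le> 1 / 3" "norm u \<le> 1" using net[OF w(2,3)] by blast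
    have uJ: "supported_on J u" using N[OF u(1)] by blast
    have "D w w = D u u + D (w - u) (w + u)"
      using sym[of u w] by (simp add: bilinear_lsub[OF D] bilinear_radd[OF D])
    moreover have "\<bar>D (w - u) (w + u)\<bar> \<le> S * norm (w - u) * norm (w + u)"
      by (intro S3 supported_on_diff supported_on_add w uJ)
    moreover have "S * norm (w - u) * norm (w + u) \<le> S * (1 / 3) * 2"
      using u w S0 norm_triangle_ineq[of w u] by (intro mult_mono) auto
    moreover have "\<bar>D u u\<bar> \<le> x" using N[OF u(1)] by blast
    ultimately show "r \<le> x + 2 / 3 * S" using w(1) by linarith
  qed
  then have "S \<le> 3 * x" by simp
  then show ?thesis using S2[OF v] mult_right_mono[of S "3 * x" "(norm v)\<^sup>2"] by simp
qed

lemma exists_largest_subset: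
  fixes f :: "'b \<Rightarrow> real"
  assumes "finite U" "s \<le> card U"
  shows "\<exists>T\<subseteq>U. card T = s \<and> (\<forall>b\<in>T. \<forall>b'\<in>U - T. f b' \<le> f b)"
  using assms(2)
proof (induction s)
  case (Suc s)
  then obtain T where T: "T \<subseteq> U" "card T = s" "\<forall>b\<in>T. \<forall>b'\<in>U - T. f b' \<le> f b" by auto
  have finT: "finite T" using T(1) assms(1) by (rule finite_subset)
  have "U \<noteq> T" using T(2) Suc.prems by auto
  then have ne: "f ` (U - T) \<noteq> {}" using T(1) by auto
  have fin: "finite (f ` (U - T))" using assms(1) by simp
  obtain c where c: "c \<in> U - T" "f c = Max (f ` (U - T))" using Max_in[OF fin ne] by auto
  have max: "f b' \<le> f c" if "b' \<in> U - T" for b' using that fin c(2) by simp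
  show ?case
  proof (intro exI[of _ "insert c T"] conjI ballI)
    show "insert c T \<subseteq> U" "card (insert c T) = Suc s" using T(1,2) c(1) finT by auto
    show "f b' \<le> f b" if "b \<in> insert c T" "b' \<in> U - insert c T" for b b'
      using that T(3) max[of b'] by blast
  qed
qed auto

text \<open>The coordinates are peeled off in blocks of the \<open>s\<close> largest remaining ones. The entries of
  a block are at most the average of the previous block, so the norms of all blocks but the first
  sum up to at most the \<open>\<ell>\<^sub>1\<close> norm divided by \<open>sqrt s\<close>.\<close>

lemma subadditive_block_bound:
  fixes F :: "'a::euclidean_space \<Rightarrow> real"
  assumes sub: "\<And>u v. F (u + v) \<le> F u + F v"
    and sparse: "\<And>u J. J \<subseteq> Basis \<Longrightarrow> card J \<le> s \<Longrightarrow> supported_on J u \<Longrightarrow> F u \<le> c * norm u"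
    and s: "s \<ge> 1" and c: "c \<ge> 0"
  shows "U \<subseteq> Basis \<Longrightarrow> supported_on U v \<Longrightarrow> (\<And>b. b \<in> U \<Longrightarrow> \<bar>v \<bullet> b\<bar> \<le> \<beta>) \<Longrightarrow> \<beta> \<ge> 0 \<Longrightarrow>
    F v \<le> c * (sqrt s * \<beta> + (\<Sum>b\<in>U. \<bar>v \<bullet> b\<bar>) / sqrt s)"
proof (induction "card U" arbitrary: U v \<beta> rule: less_induct)
  case less
  note U = less.prems(1) and vU = less.prems(2) and v\<beta> = less.prems(3) and \<beta> = less.prems(4)
  have finU: "finite U" using U finite_Basis by (rule finite_subset)
  have block: "norm w \<le> sqrt s * \<beta>" if "T \<subseteq> Basis" "card T \<le> s" "supported_on T w" "\<And>b. b \<in> T \<Longrightarrow> \<bar>w \<bullet> b\<bar> \<le> \<beta>" for T w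
  proof (rule power2_le_imp_le)
    have "(norm w)\<^sup>2 \<le> (\<Sum>b\<in>T. \<beta>\<^sup>2)"
      unfolding norm_square_supported[OF that(1,3)]
      using that(4) \<beta> by (intro sum_mono) (auto simp: abs_le_square_iff[symmetric])
    also have "\<dots> \<le> s * \<beta>\<^sup>2" using that(2) by (auto intro!: mult_right_mono)
    finally show "(norm w)\<^sup>2 \<le> (sqrt s * \<beta>)\<^sup>2" by (simp add: power_mult_distrib)
  qed (use \<beta> in simp)
  show ?case
  proof (cases "card U \<le> s")
    case True
    have "F v \<le> c * norm v" by (rule sparse[OF U True vU])
    also have "\<dots> \<le> c * (sqrt s * \<beta> + (\<Sum>b\<in>U. \<bar>v \<bullet> b\<bar>) / sqrt s)"
      using block[OF U True vU v\<beta>] c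
      by (intro mult_left_mono add_increasing2 divide_nonneg_nonneg sum_nonneg) auto
    finally show ?thesis .
  next
    case False
    then obtain T where T: "T \<subseteq> U" "card T = s" "\<And>b b'. b \<in> T \<Longrightarrow> b' \<in> U - T \<Longrightarrow> \<bar>v \<bullet> b'\<bar> \<le> \<bar>v \<bullet> b\<bar>"
      using exists_largest_subset[OF finU, of s "\<lambda>b. \<bar>v \<bullet> b\<bar>"] by auto
    define v1 v2 where "v1 = coord_proj T v" and "v2 = coord_proj (U - T) v"
    define \<beta>' where "\<beta>' = (\<Sum>b\<in>T. \<bar>v \<bullet> b\<bar>) / s"
    have TB: "T \<subseteq> Basis" "U - T \<subseteq> Basis" using T U by auto
    have v: "v = v1 + v2" unfolding v1_def v2_def
      using T TB vU by (intro coord_proj_Un) (auto simp: Un_absorb1)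
    have "F v1 \<le> c * norm v1"
      unfolding v1_def using T TB by (intro sparse[of T] supported_on_coord_proj) auto
    also have "norm v1 \<le> sqrt s * \<beta>"
      unfolding v1_def using T TB v\<beta> U by (intro block[of T] supported_on_coord_proj) (auto simp: coord_proj_inner subset_iff)
    finally have 1: "F v1 \<le> c * (sqrt s * \<beta>)" using c by (simp add: mult_left_mono)
    have \<beta>': "\<bar>v2 \<bullet> b'\<bar> \<le> \<beta>'" if "b' \<in> U - T" for b'
    proof -
      have "real s * \<bar>v \<bullet> b'\<bar> = (\<Sum>b\<in>T. \<bar>v \<bullet> b'\<bar>)" using T(2) by simp
      also have "\<dots> \<le> (\<Sum>b\<in>T. \<bar>v \<bullet> b\<bar>)" by (intro sum_mono T(3) that)
      finally show ?thesis
        using s that TB U by (auto simp: \<beta>'_def v2_def coord_proj_inner subset_iff field_simps)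
    qed
    have "card (U - T) < card U"
      using T s finU False by (simp add: card_Diff_subset finite_subset)
    moreover have "supported_on (U - T) v2" "\<beta>' \<ge> 0"
      using TB(2) by (simp_all add: v2_def supported_on_coord_proj \<beta>'_def sum_nonneg)
    ultimately have "F v2 \<le> c * (sqrt s * \<beta>' + (\<Sum>b\<in>U - T. \<bar>v2 \<bullet> b\<bar>) / sqrt s)"
      using TB(2) \<beta>' by (intro less.hyps)
    also have "(\<Sum>b\<in>U - T. \<bar>v2 \<bullet> b\<bar>) = (\<Sum>b\<in>U - T. \<bar>v \<bullet> b\<bar>)"
      using TB(2) by (intro sum.cong) (auto simp: v2_def coord_proj_inner subset_iff)
    also have "sqrt s * \<beta>' = (\<Sum>b\<in>T. \<bar>v \<bullet> b\<bar>) / sqrt s"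
      using s by (simp add: \<beta>'_def field_simps flip: real_sqrt_mult_self[of "real s"])
    also have "(\<Sum>b\<in>T. \<bar>v \<bullet> b\<bar>) / sqrt s + (\<Sum>b\<in>U - T. \<bar>v \<bullet> b\<bar>) / sqrt s = (\<Sum>b\<in>U. \<bar>v \<bullet> b\<bar>) / sqrt s"
      using T(1) finU by (simp add: sum.subset_diff[of T U] add_divide_distrib)
    finally have 2: "F v2 \<le> c * ((\<Sum>b\<in>U. \<bar>v \<bullet> b\<bar>) / sqrt s)" .
    have "F v \<le> F v1 + F v2" using sub[of v1 v2] v by simp
    also have "\<dots> \<le> c * (sqrt s * \<beta> + (\<Sum>b\<in>U. \<bar>v \<bullet> b\<bar>) / sqrt s)" using 1 2 by (simp add: distrib_left)
    finally show ?thesis .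
  qed
qed

text \<open>The condition of \<open>sparse_cone\<close>, apart from the exclusion of zero, in the
  coordinates of an arbitrary Euclidean space.\<close>

definition approx_sparse :: "nat \<Rightarrow> real \<Rightarrow> 'a::euclidean_space \<Rightarrow> bool" where
  "approx_sparse s c0 v \<longleftrightarrow> (\<exists>J\<subseteq>Basis. card J = s \<and>
     (\<forall>b\<in>J. \<forall>b'\<in>Basis - J. \<bar>v \<bullet> b'\<bar> \<le> \<bar>v \<bullet> b\<bar>) \<and>
     (\<Sum>b\<in>Basis. \<bar>v \<bullet> b\<bar>) \<le> (1 + c0) * (\<Sum>b\<in>J. \<bar>v \<bullet> b\<bar>))"

text \<open>The block of the \<open>s\<close> largest entries contributes \<open>c * norm v\<close>.
  The remaining blocks contribute at most \<open>c / sqrt s\<close> times the full l1 norm, which by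
  the cone condition and Cauchy-Schwarz is at most
  \<open>(1 + c0) * sqrt s * norm v\<close>.\<close>

lemma subadditive_approx_sparse_bound:
  fixes F :: "'a::euclidean_space \<Rightarrow> real"
  assumes sub: "\<And>u v. F (u + v) \<le> F u + F v"
    and sparse: "\<And>u J. J \<subseteq> Basis \<Longrightarrow> card J \<le> s \<Longrightarrow> supported_on J u \<Longrightarrow> F u \<le> c * norm u"
    and s: "s \<ge> 1" and c: "c \<ge> 0" and c0: "c0 > 0" and v: "approx_sparse s c0 v"
  shows "F v \<le> c * (2 + c0) * norm v"
proof -
  obtain J where J: "J \<subseteq> Basis" "card J = s" "\<And>b b'. b \<in> J \<Longrightarrow> b' \<in> Basis - J \<Longrightarrow> \<bar>v \<bullet> b'\<bar> \<le> \<bar>v \<bullet> b\<bar>"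
    and l1: "(\<Sum>b\<in>Basis. \<bar>v \<bullet> b\<bar>) \<le> (1 + c0) * (\<Sum>b\<in>J. \<bar>v \<bullet> b\<bar>)"
    using v unfolding approx_sparse_def by blast
  define v1 v2 where "v1 = coord_proj J v" and "v2 = coord_proj (Basis - J) v"
  define \<beta> where "\<beta> = (\<Sum>b\<in>J. \<bar>v \<bullet> b\<bar>) / s"
  have v12: "v = v1 + v2" unfolding v1_def v2_def
    using J by (intro coord_proj_Un) (auto simp: supported_on_def)
  have v1J: "supported_on J v1" using J by (simp add: v1_def supported_on_coord_proj)
  have v1_inner: "v1 \<bullet> b = v \<bullet> b" if "b \<in> J" for b using that J by (auto simp: v1_def coord_proj_inner subset_iff)
  have v1_le: "norm v1 \<le> norm v"
  proof (rule power2_le_imp_le)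
    have "(norm v1)\<^sup>2 = (\<Sum>b\<in>J. (v \<bullet> b)\<^sup>2)"
      unfolding norm_square_supported[OF J(1) v1J] by (simp add: v1_inner)
    also have "\<dots> \<le> (\<Sum>b\<in>Basis. (v \<bullet> b)\<^sup>2)" using J by (intro sum_mono2) auto
    also have "\<dots> = (norm v)\<^sup>2" by (rule norm_square_supported[symmetric]) (simp_all add: supported_on_def)
    finally show "(norm v1)\<^sup>2 \<le> (norm v)\<^sup>2" .
  qed simp
  have \<beta>: "\<bar>v2 \<bullet> b'\<bar> \<le> \<beta>" if "b' \<in> Basis - J" for b'
  proof -
    have "real s * \<bar>v \<bullet> b'\<bar> = (\<Sum>b\<in>J. \<bar>v \<bullet> b'\<bar>)" using J(2) by simp
    also have "\<dots> \<le> (\<Sum>b\<in>J. \<bar>v \<bullet> b\<bar>)" by (intro sum_mono J(3) that)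
    finally show ?thesis
      using s that by (auto simp: \<beta>_def v2_def coord_proj_inner field_simps)
  qed
  have "F v2 \<le> c * (sqrt s * \<beta> + (\<Sum>b\<in>Basis - J. \<bar>v2 \<bullet> b\<bar>) / sqrt s)"
    using \<beta> by (intro subadditive_block_bound[OF sub sparse s c])
      (auto simp: v2_def supported_on_coord_proj \<beta>_def sum_nonneg)
  also have "(\<Sum>b\<in>Basis - J. \<bar>v2 \<bullet> b\<bar>) = (\<Sum>b\<in>Basis - J. \<bar>v \<bullet> b\<bar>)"
    by (intro sum.cong) (auto simp: v2_def coord_proj_inner)
  also have "sqrt s * \<beta> = (\<Sum>b\<in>J. \<bar>v \<bullet> b\<bar>) / sqrt s"
    using s by (simp add: \<beta>_def field_simps flip: real_sqrt_mult_self[of "real s"])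
  also have "(\<Sum>b\<in>J. \<bar>v \<bullet> b\<bar>) / sqrt s + (\<Sum>b\<in>Basis - J. \<bar>v \<bullet> b\<bar>) / sqrt s = (\<Sum>b\<in>Basis. \<bar>v \<bullet> b\<bar>) / sqrt s"
    using J(1) by (simp add: sum.subset_diff[of J Basis] add_divide_distrib)
  also have "\<dots> \<le> (1 + c0) * norm v"
  proof -
    have "(\<Sum>b\<in>J. \<bar>v \<bullet> b\<bar>) = (\<Sum>b\<in>J. \<bar>v1 \<bullet> b\<bar>)" by (simp add: v1_inner)
    also have "\<dots> \<le> sqrt s * norm v1" using sum_abs_supported_le[OF J(1) v1J] J(2) by simp
    also have "\<dots> \<le> sqrt s * norm v" using v1_le by (intro mult_left_mono) auto
    finally have "(1 + c0) * (\<Sum>b\<in>J. \<bar>v \<bullet> b\<bar>) \<le> (1 + c0) * (sqrt s * norm v)"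
      using c0 by (intro mult_left_mono) auto
    with l1 have "(\<Sum>b\<in>Basis. \<bar>v \<bullet> b\<bar>) \<le> (1 + c0) * (sqrt s * norm v)" by linarith
    then show ?thesis using s by (simp add: divide_le_eq mult_ac)
  qed
  finally have 2: "F v2 \<le> c * ((1 + c0) * norm v)" using c by (simp add: mult_left_mono)
  have "F v1 \<le> c * norm v1" using J by (intro sparse[OF J(1) _ v1J]) simp
  also have "\<dots> \<le> c * norm v" using v1_le c by (rule mult_left_mono)
  finally show ?thesis using 2 sub[of v1 v2] by (simp add: v12[symmetric] algebra_simps)
qed

text \<open>The block bound is applied to one argument of \<open>D\<close> at a time, hence the
  square of \<open>2 + c0\<close>. Polarizing two \<open>s\<close>-sparse vectors produces vectors
  on the union of their supports, hence the sparsity \<open>2 * s\<close> in the hypothesis.\<close>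

lemma bilinear_approx_sparse_bound:
  fixes D :: "'a::euclidean_space \<Rightarrow> 'a \<Rightarrow> real"
  assumes D: "bilinear D" and sym: "\<And>x y. D x y = D y x"
    and sparse: "\<And>u J. J \<subseteq> Basis \<Longrightarrow> card J \<le> 2 * s \<Longrightarrow> supported_on J u \<Longrightarrow> \<bar>D u u\<bar> \<le> S * (norm u)\<^sup>2"
    and S: "S \<ge> 0" and s: "s \<ge> 1" and c0: "c0 > 0" and v: "approx_sparse s c0 v"
  shows "\<bar>D v v\<bar> \<le> S * (2 + c0)\<^sup>2 * (norm v)\<^sup>2"
proof -
  have 1: "\<bar>D w u\<bar> \<le> S * norm w * norm u"
    if "J \<subseteq> Basis" "card J \<le> s" "supported_on J w" "K \<subseteq> Basis" "card K \<le> s" "supported_on K u" for w u J K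
  proof (rule bilinear_polarization_bound[OF D sym])
    fix c d
    show "\<bar>D (c *\<^sub>R w + d *\<^sub>R u) (c *\<^sub>R w + d *\<^sub>R u)\<bar> \<le> S * (norm (c *\<^sub>R w + d *\<^sub>R u))\<^sup>2"
    proof (rule sparse[of "J \<union> K"])
      show "supported_on (J \<union> K) (c *\<^sub>R w + d *\<^sub>R u)"
        using supported_on_mono[OF that(3), of "J \<union> K"] supported_on_mono[OF that(6), of "J \<union> K"]
        by (intro supported_on_add supported_on_scaleR) auto
    qed (use that card_Un_le[of J K] in auto)
  qed
  have 2: "\<bar>D w v\<bar> \<le> S * norm w * (2 + c0) * norm v" if "J \<subseteq> Basis" "card J \<le> s" "supported_on J w" for w J
    using S s c0 v 1[OF that]
    by (intro subadditive_approx_sparse_bound[of "\<lambda>u. \<bar>D w u\<bar>"]) (auto simp: bilinear_radd[OF D])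
  have "\<bar>D v v\<bar> \<le> (S * (2 + c0) * norm v) * (2 + c0) * norm v"
    using S s c0 v 2
    by (intro subadditive_approx_sparse_bound[of "\<lambda>u. \<bar>D u v\<bar>"]) (auto simp: bilinear_ladd[OF D] mult_ac)
  then show ?thesis by (simp add: power2_eq_square mult_ac)
qed

text \<open>The order of choices matters: \<open>N\<close> is fixed before \<open>D\<close>, so a
  union bound over \<open>N\<close> is possible when \<open>D\<close> is random.\<close>

lemma exists_sparse_test_set:
  assumes "s \<ge> 1" "c0 > 0"
  obtains N :: "'a::euclidean_space set" where "finite N"
    "card N \<le> (DIM('a) choose min (2 * s) DIM('a)) * 21 ^ min (2 * s) DIM('a)"
    "\<And>u. u \<in> N \<Longrightarrow> norm u \<le> 1"
    "\<And>(D :: 'a \<Rightarrow> 'a \<Rightarrow> real) x v. bilinear D \<Longrightarrow> (\<And>x y. D x y = D y x) \<Longrightarrow> x \<ge> 0 \<Longrightarrow> (\<And>u. u \<in> N \<Longrightarrow> \<bar>D u u\<bar> \<le> x) \<Longrightarrow>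
      approx_sparse s c0 v \<Longrightarrow> \<bar>D v v\<bar> \<le> 3 * x * (2 + c0)\<^sup>2 * (norm v)\<^sup>2"
proof -
  \<comment> \<open>If \<open>2 * s\<close> exceeds the dimension, the whole basis is the only
    support. Smaller supports are enlarged to size \<open>m\<close>, so that supports of a single
    size are counted.\<close>
  define m where "m = min (2 * s) DIM('a)"
  define \<J> where "\<J> = {J. J \<subseteq> (Basis :: 'a set) \<and> card J = m}"
  have "\<forall>J. \<exists>N. J \<subseteq> (Basis :: 'a set) \<longrightarrow> finite N \<and> card N \<le> 21 ^ card J \<and> (\<forall>u\<in>N. supported_on J u \<and> norm u \<le> 1) \<and>
      (\<forall>v. supported_on J v \<longrightarrow> norm v \<le> 1 \<longrightarrow> (\<exists>u\<in>N. norm (v - u) \<le> 1 / 3))"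
    by (metis exists_coordinate_net)
  then obtain N where N: "\<And>J. J \<subseteq> (Basis :: 'a set) \<Longrightarrow> finite (N J) \<and> card (N J) \<le> 21 ^ card J \<and> (\<forall>u\<in>N J. supported_on J u \<and> norm u \<le> 1) \<and>
      (\<forall>v. supported_on J v \<longrightarrow> norm v \<le> 1 \<longrightarrow> (\<exists>u\<in>N J. norm (v - u) \<le> 1 / 3))"
    by metis
  have fin: "finite \<J>" unfolding \<J>_def by (rule finite_subset[of _ "Pow Basis"]) auto
  show thesis
  proof (rule that[of "\<Union>J\<in>\<J>. N J"])
    show "finite (\<Union>J\<in>\<J>. N J)" using fin N by (auto simp: \<J>_def)
    have "card (\<Union>J\<in>\<J>. N J) \<le> (\<Sum>J\<in>\<J>. card (N J))" by (rule card_UN_le[OF fin])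
    also have "\<dots> \<le> (\<Sum>J\<in>\<J>. 21 ^ m)" using N by (intro sum_mono) (auto simp: \<J>_def)
    also have "\<dots> = (DIM('a) choose m) * 21 ^ m" unfolding \<J>_def by (simp add: n_subsets)
    finally show "card (\<Union>J\<in>\<J>. N J) \<le> (DIM('a) choose min (2 * s) DIM('a)) * 21 ^ min (2 * s) DIM('a)"
      by (simp add: m_def)
    show "norm u \<le> 1" if "u \<in> (\<Union>J\<in>\<J>. N J)" for u using that N by (auto simp: \<J>_def)
    fix D :: "'a \<Rightarrow> 'a \<Rightarrow> real" and x :: real and v :: 'a
    assume D: "bilinear D" "\<And>x y. D x y = D y x" and x: "x \<ge> 0"
      and le: "\<And>u. u \<in> (\<Union>J\<in>\<J>. N J) \<Longrightarrow> \<bar>D u u\<bar> \<le> x" and v: "approx_sparse s c0 v"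
    have sp: "\<bar>D u u\<bar> \<le> 3 * x * (norm u)\<^sup>2" if JB: "J \<subseteq> Basis" and that: "card J \<le> 2 * s" "supported_on J u" for J u
    proof -
      have "card J \<le> m" using JB that card_mono[OF finite_Basis JB] by (simp add: m_def)
      moreover have "m \<le> card (Basis :: 'a set)" by (simp add: m_def)
      ultimately obtain K where K: "J \<subseteq> K" "K \<subseteq> Basis" "card K = m"
        using exists_subset_between[OF _ _ JB finite_Basis] by blast
      have "supported_on K u" using that(2) K(1) by (rule supported_on_mono)
      then show ?thesis
        using N[OF K(2)] le K by (intro bilinear_bound_from_net[OF D, of "N K" K]) (auto simp: \<J>_def)
    qed
    show "\<bar>D v v\<bar> \<le> 3 * x * (2 + c0)\<^sup>2 * (norm v)\<^sup>2"
      using x by (intro bilinear_approx_sparse_bound[OF D sp _ assms v]) auto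
  qed
qed

text \<open>For \<open>m = 2 * s \<le> n\<close>,
  \<open>(n choose m) \<le> n ^ m / fact m \<le> (exp 1 * n / m) ^ m\<close>, the last step by
  keeping one term of the series of \<open>exp m\<close>. Otherwise the left side is
  \<open>21 ^ n\<close>, and \<open>s \<le> n\<close> gives
  \<open>ln (n / (2 * s)) \<ge> - ln 2 \<ge> - 1\<close>, so the bracket multiplying
  \<open>2 * s\<close> is still at least \<open>ln 21\<close>.\<close>

lemma test_set_card_le:
  assumes s: "1 \<le> s" "s \<le> n"
  shows "real ((n choose min (2 * s) n) * 21 ^ min (2 * s) n)
    \<le> exp (2 * real s * ln (real n) - 2 * real s * (ln (2 * real s / 21) - 1))"
proof -
  have n: "real n > 0" using s by simp
  have s0: "real s > 0" using s by simp
  have rhs: "2 * real s * ln (real n) - 2 * real s * (ln (2 * real s / 21) - 1)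
      = 2 * real s * (ln 21 + 1 + ln (real n / (2 * real s)))"
    using n s0 by (simp add: ln_div ln_mult algebra_simps)
  show ?thesis
  proof (cases "2 * s \<le> n")
    case True
    define m where "m = 2 * s"
    have m: "real m > 0" "real m = 2 * real s" using s by (simp_all add: m_def)
    have "real (n choose m) \<le> real n ^ m / fact m"
    proof -
      have "m \<le> n" using True by (simp add: m_def)
      then have "fact n = fact (n - m) * (fact m * (n choose m))"
        using binomial_fact_lemma[of m n] by (simp add: mult_ac)
      then have "fact m * (n choose m) = fact n div fact (n - m)" by simp
      also have "\<dots> \<le> n ^ m" using \<open>m \<le> n\<close> by (rule fact_div_fact_le_pow)
      finally have "real (fact m * (n choose m)) \<le> real (n ^ m)" by (simp only: of_nat_le_iff)
      then show ?thesis by (simp add: field_simps)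
    qed
    also have "\<dots> \<le> real n ^ m * (exp m / real m ^ m)"
    proof -
      have "(\<Sum>k\<in>{m}. real m ^ k /\<^sub>R fact k) \<le> (\<Sum>k. real m ^ k /\<^sub>R fact k)"
        by (rule sum_le_suminf[OF summable_exp_generic]) auto
      then have "real m ^ m / fact m \<le> exp m" by (simp add: exp_def divide_inverse mult.commute)
      then have "1 / fact m \<le> exp m / real m ^ m" using m(1) by (simp add: field_simps)
      then show ?thesis using mult_left_mono[of "1 / fact m" "exp m / real m ^ m" "real n ^ m"] by simp
    qed
    also have "\<dots> = exp m * (real n / real m) ^ m" by (simp add: power_divide)
    finally have "real ((n choose m) * 21 ^ m) \<le> exp m * (real n / real m) ^ m * 21 ^ m"
      by (simp add: mult_right_mono)
    also have "\<dots> = exp (m * (ln 21 + 1 + ln (real n / real m)))"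
    proof -
      have "real n / real m > 0" using m n by simp
      then show ?thesis by (simp add: distrib_left exp_add exp_of_nat_mult mult_ac)
    qed
    finally show ?thesis using True m unfolding rhs by (simp add: m_def[symmetric] min_def)
  next
    case False
    have "ln (real n / (2 * real s)) \<ge> ln (1 / 2)" using s n by (intro ln_mono) (auto simp: field_simps)
    moreover have "ln (1 / 2 :: real) \<ge> - 1" using ln_2_less_1 by (simp add: ln_div)
    ultimately have "ln 21 \<le> ln 21 + 1 + ln (real n / (2 * real s))" by simp
    moreover have "(0::real) \<le> ln 21" by simp
    ultimately have "real n * ln 21 \<le> 2 * real s * (ln 21 + 1 + ln (real n / (2 * real s)))"
      using False by (intro mult_mono) auto
    moreover have "real ((n choose min (2 * s) n) * 21 ^ min (2 * s) n) = exp (real n * ln 21)"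
      using False by (simp add: exp_of_nat_mult)
    ultimately show ?thesis unfolding rhs by simp
  qed
qed

section \<open>Matrix exponentials of diagonalisable matrices\<close>

text \<open>The inverse \<open>Q\<close> is an argument of its own, so that transposition stays
  within the notion, with \<open>transpose Q\<close> and \<open>transpose P\<close> as the new
  pair.\<close>

definition diag_by :: "complex ^ 'd ^ 'd \<Rightarrow> complex ^ 'd ^ 'd \<Rightarrow> ('d \<Rightarrow> complex) \<Rightarrow> real ^ 'd ^ 'd \<Rightarrow> bool" where
  "diag_by P Q \<theta> A \<longleftrightarrow> P ** Q = mat 1 \<and> Q ** P = mat 1 \<and>
     (\<forall>i j. complex_of_real (A $ i $ j) = (\<Sum>k\<in>UNIV. P $ i $ k * \<theta> k * Q $ k $ j))"

lemma diag_by_entry: "diag_by P Q \<theta> A \<Longrightarrow> complex_of_real (A $ i $ j) = (\<Sum>k\<in>UNIV. P $ i $ k * \<theta> k * Q $ k $ j)"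
  by (simp add: diag_by_def)

lemma diag_by_inv: "diag_by P Q \<theta> A \<Longrightarrow> (\<Sum>i\<in>UNIV. Q $ k $ i * P $ i $ l) = (if k = l then 1 else 0)"
  by (simp add: diag_by_def matrix_matrix_mult_def mat_def vec_eq_iff)

lemma diagonalises_diag_by:
  assumes "diagonalises P \<theta> (A :: real ^ 'd ^ 'd)"
  shows "diag_by P (matrix_inv P) \<theta> A"
proof -
  have "\<exists>Q. P ** Q = mat 1 \<and> Q ** P = mat 1" using assms by (simp add: diagonalises_def invertible_def)
  then have inv: "P ** matrix_inv P = mat 1 \<and> matrix_inv P ** P = mat 1"
    unfolding matrix_inv_def by (rule someI_ex)
  have "map_matrix complex_of_real A = P ** diag_matrix \<theta> ** matrix_inv P"
    using assms by (simp add: diagonalises_def)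
  then have "complex_of_real (A $ i $ j) = (P ** diag_matrix \<theta> ** matrix_inv P) $ i $ j" for i j
    by (metis nth_map_matrix)
  moreover have "(P ** diag_matrix \<theta>) $ i $ k = P $ i $ k * \<theta> k" for i k
    by (simp add: matrix_matrix_mult_def diag_matrix_def if_distrib cong: if_cong)
  ultimately show ?thesis using inv by (simp add: diag_by_def matrix_matrix_mult_def[of "P ** diag_matrix \<theta>"])
qed

lemma diag_by_mult:
  assumes A: "diag_by P Q \<theta> A" and B: "diag_by P Q \<eta> B"
  shows "diag_by P Q (\<lambda>k. \<theta> k * \<eta> k) (A ** B)"
proof -
  have "complex_of_real ((A ** B) $ i $ j) = (\<Sum>k\<in>UNIV. P $ i $ k * (\<theta> k * \<eta> k) * Q $ k $ j)" for i j
  proof -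
    have "complex_of_real ((A ** B) $ i $ j)
      = (\<Sum>m\<in>UNIV. (\<Sum>k\<in>UNIV. P $ i $ k * \<theta> k * Q $ k $ m) * (\<Sum>l\<in>UNIV. P $ m $ l * \<eta> l * Q $ l $ j))"
      by (simp add: matrix_matrix_mult_def diag_by_entry[OF A] diag_by_entry[OF B])
    also have "\<dots> = (\<Sum>m\<in>UNIV. \<Sum>k\<in>UNIV. \<Sum>l\<in>UNIV. (P $ i $ k * \<theta> k * \<eta> l * Q $ l $ j) * (Q $ k $ m * P $ m $ l))"
      unfolding sum_product by (simp add: mult_ac)
    also have "\<dots> = (\<Sum>k\<in>UNIV. \<Sum>l\<in>UNIV. \<Sum>m\<in>UNIV. (P $ i $ k * \<theta> k * \<eta> l * Q $ l $ j) * (Q $ k $ m * P $ m $ l))"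
      by (subst sum.swap, rule sum.cong[OF refl], rule sum.swap)
    also have "\<dots> = (\<Sum>k\<in>UNIV. \<Sum>l\<in>UNIV. (P $ i $ k * \<theta> k * \<eta> l * Q $ l $ j) * (if k = l then 1 else 0))"
      by (simp only: sum_distrib_left[symmetric] diag_by_inv[OF A])
    also have "\<dots> = (\<Sum>k\<in>UNIV. P $ i $ k * (\<theta> k * \<eta> k) * Q $ k $ j)"
      by (simp add: if_distrib mult_ac cong: if_cong)
    finally show ?thesis .
  qed
  then show ?thesis using A by (simp add: diag_by_def)
qed

text \<open>Identities between matrix exponentials, such as the semigroup law and the rule for
  transposes, reduce by this to identities between their eigenvalues; no power series are
  multiplied.\<close>

lemma diag_by_unique: "diag_by P Q \<theta> A \<Longrightarrow> diag_by P Q \<theta> B \<Longrightarrow> A = B"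
proof -
  assume A: "diag_by P Q \<theta> A" and B: "diag_by P Q \<theta> B"
  have "complex_of_real (A $ i $ j) = complex_of_real (B $ i $ j)" for i j
    unfolding diag_by_entry[OF A] diag_by_entry[OF B] ..
  then show "A = B" by (simp add: vec_eq_iff)
qed

lemma diag_by_mat_1:
  assumes "diag_by P Q \<theta> A"
  shows "diag_by P Q (\<lambda>_. 1) (mat 1)"
proof -
  have "(P ** Q) $ i $ j = (mat 1 :: complex ^ 'a ^ 'a) $ i $ j" for i j using assms by (simp add: diag_by_def)
  then show ?thesis using assms by (simp add: diag_by_def matrix_matrix_mult_def mat_def)
qed

lemma diag_by_scaleR: "diag_by P Q \<theta> A \<Longrightarrow> diag_by P Q (\<lambda>k. of_real c * \<theta> k) (c *\<^sub>R A)"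
  by (simp add: diag_by_def sum_distrib_left mult_ac)

lemma diag_by_transpose:
  assumes "diag_by P Q \<theta> A"
  shows "diag_by (transpose Q) (transpose P) \<theta> (transpose A)"
proof -
  have "transpose (P ** Q) = mat 1" "transpose (Q ** P) = mat 1" using assms by (simp_all add: diag_by_def)
  then show ?thesis using assms
    by (simp add: diag_by_def matrix_transpose_mul[symmetric]) (simp add: transpose_def mult_ac)
qed

lemma diag_by_matrix_power:
  assumes "diag_by P Q \<theta> A"
  shows "diag_by P Q (\<lambda>k. \<theta> k ^ n) (matrix_power A n)"
proof (induction n)
  case (Suc n)
  then show ?case using diag_by_mult[OF assms Suc] by (simp add: matrix_power_def)
qed (use diag_by_mat_1[OF assms] in \<open>simp add: matrix_power_def\<close>)

lemma diag_by_matrix_exp: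
  assumes A: "diag_by P Q \<theta> A"
  shows "diag_by P Q (\<lambda>k. exp (\<theta> k)) (matrix_exp A)"
proof -
  define c where "c i j = (\<Sum>k\<in>UNIV. P $ i $ k * exp (\<theta> k) * Q $ k $ j)" for i j
  have c: "(\<lambda>n. complex_of_real (((1 / fact n) *\<^sub>R matrix_power A n) $ i $ j)) sums c i j" for i j
  proof -
    have "(\<lambda>n. \<Sum>k\<in>UNIV. P $ i $ k * (\<theta> k ^ n /\<^sub>R fact n) * Q $ k $ j) sums c i j"
      unfolding c_def by (intro sums_sum sums_mult sums_mult2 exp_converges)
    moreover have "complex_of_real (((1 / fact n) *\<^sub>R matrix_power A n) $ i $ j)
        = (\<Sum>k\<in>UNIV. P $ i $ k * (\<theta> k ^ n /\<^sub>R fact n) * Q $ k $ j)" for n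
      by (simp add: diag_by_entry[OF diag_by_matrix_power[OF A]] sum_distrib_left scaleR_conv_of_real[where 'a = complex] divide_inverse mult_ac)
    ultimately show ?thesis by (simp only:)
  qed
  have real: "(\<lambda>n. ((1 / fact n) *\<^sub>R matrix_power A n) $ i $ j) sums Re (c i j)" for i j
    using sums_Re[OF c[of i j]] by (simp only: Re_complex_of_real)
  define B :: "real ^ 'a ^ 'a" where "B = (\<chi> i j. Re (c i j))"
  have "(\<lambda>n. (1 / fact n) *\<^sub>R matrix_power A n) sums B"
    unfolding sums_def
  proof (intro vec_tendstoI)
    fix i j
    show "(\<lambda>n. (\<Sum>n<n. (1 / fact n) *\<^sub>R matrix_power A n) $ i $ j) \<longlonglongrightarrow> B $ i $ j"
      using real[of i j] by (simp add: sums_def B_def sum_component)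
  qed
  then have "matrix_exp A = B" unfolding matrix_exp_def by (rule sums_unique[symmetric])
  \<comment> \<open>Limits of real entries are real, so the real parts taken in \<open>B\<close>
    lose nothing.\<close>
  moreover have "complex_of_real (Re (c i j)) = c i j" for i j
    using sums_unique2[OF c sums_of_real[OF real, where 'a = complex]] by simp
  ultimately show ?thesis using A by (simp add: diag_by_def B_def c_def)
qed

lemma norm_of_real_vec:
  fixes x :: "real ^ 'd"
  shows "norm (\<chi> i. complex_of_real (x $ i)) = norm x"
  by (simp add: norm_vec_def)

lemma norm_diag_by_mult_le:
  assumes A: "diag_by P Q \<theta> A" and \<theta>: "\<And>k. norm (\<theta> k) \<le> c"
  shows "norm (A *v x) \<le> spectral_norm P * spectral_norm Q * c * norm x"
proof -
  define z :: "complex ^ 'a" where "z = (\<chi> i. complex_of_real (x $ i))"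
  define y where "y = Q *v z"
  define w where "w = (\<chi> k. \<theta> k * y $ k)"
  have c0: "c \<ge> 0" using \<theta>[of undefined] norm_ge_zero[of "\<theta> undefined"] by linarith
  have "(\<chi> i. complex_of_real ((A *v x) $ i)) = P *v w"
  proof -
    have "complex_of_real ((A *v x) $ i) = (P *v w) $ i" for i
    proof -
      have "complex_of_real ((A *v x) $ i) = (\<Sum>j\<in>UNIV. \<Sum>k\<in>UNIV. P $ i $ k * \<theta> k * Q $ k $ j * x $ j)"
        by (simp add: matrix_vector_mult_def diag_by_entry[OF A] sum_distrib_right)
      also have "\<dots> = (P *v w) $ i"
        by (subst sum.swap) (simp add: w_def y_def z_def matrix_vector_mult_def sum_distrib_left mult_ac)
      finally show ?thesis .
    qed
    then show ?thesis by (simp add: vec_eq_iff)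
  qed
  then have "norm (A *v x) = norm (P *v w)" using norm_of_real_vec[of "A *v x"] by simp
  also have "\<dots> \<le> spectral_norm P * norm w"
    unfolding spectral_norm_def by (rule onorm) simp
  finally have 1: "norm (A *v x) \<le> spectral_norm P * norm w" .
  have 2: "norm w \<le> c * norm y"
  proof -
    have "norm w \<le> L2_set (\<lambda>k. c * norm (y $ k)) UNIV"
      unfolding norm_vec_def w_def using \<theta> by (intro L2_set_mono) (auto simp: norm_mult intro!: mult_right_mono)
    also have "\<dots> = c * norm y" using c0 by (simp add: L2_set_right_distrib norm_vec_def)
    finally show ?thesis .
  qed
  have "norm y \<le> spectral_norm Q * norm x"
    unfolding spectral_norm_def y_def using onorm[of "(*v) Q" z] norm_of_real_vec[of x] by (simp add: z_def)
  with 2 c0 have "norm w \<le> c * (spectral_norm Q * norm x)" by (meson mult_left_mono order_trans)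
  then have "spectral_norm P * norm w \<le> spectral_norm P * (c * (spectral_norm Q * norm x))"
    using onorm_pos_le[of "(*v) P"] by (intro mult_left_mono) (simp_all add: spectral_norm_def)
  with 1 show ?thesis by (simp add: mult_ac)
qed

text \<open>A matrix and its transpose have the same operator norm: the squared norm of
  \<open>y v* A\<close> is \<open>y \<bullet> (A *v (y v* A))\<close>, and one factor cancels. If it
  vanishes, \<open>c \<ge> 0\<close> is extracted from the hypothesis at a nonzero vector.\<close>

lemma norm_vector_matrix_mult_le_of_bound:
  fixes A :: "real ^ 'n ^ 'm"
  assumes "\<And>x. norm (A *v x) \<le> c * norm x"
  shows "norm (y v* A) \<le> c * norm y"
proof (cases "y v* A = 0")
  case False
  have "(norm (y v* A))\<^sup>2 = y \<bullet> (A *v (y v* A))" by (simp add: power2_norm_eq_inner dot_lmul_matrix)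
  also have "\<dots> \<le> norm y * norm (A *v (y v* A))" by (rule norm_cauchy_schwarz)
  also have "\<dots> \<le> norm y * (c * norm (y v* A))" using assms by (intro mult_left_mono) auto
  finally have "norm (y v* A) * norm (y v* A) \<le> (c * norm y) * norm (y v* A)"
    by (simp add: power2_eq_square mult_ac)
  then show ?thesis by (rule mult_right_le_imp_le) (use False in simp)
next
  case True
  have "0 \<le> c * norm y"
  proof (cases "\<exists>x :: real ^ 'n. x \<noteq> 0")
    case T: True
    then obtain x :: "real ^ 'n" where "x \<noteq> 0" by blast
    then have "0 \<le> c * norm x" "norm x > 0" using order_trans[OF norm_ge_zero assms[of x]] by auto
    then have "c \<ge> 0" by (simp add: zero_le_mult_iff)
    then show ?thesis by simp
  next
    case False
    then have "(axis undefined 1 :: real ^ 'n) = 0" by blast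
    then show ?thesis by (simp add: axis_eq_0_iff)
  qed
  then show ?thesis using True by simp
qed

section \<open>Extreme eigenvalues of symmetric matrices\<close>

text \<open>The first-order condition at a maximum: for small positive \<open>t\<close> the linear
  term would dominate. It will be used with the squared norm of an eigenvalue residual as
  \<open>a\<close>.\<close>

lemma quadratic_nonpos_imp_linear_zero:
  fixes a c :: real
  assumes "\<And>t. 2 * t * a + t\<^sup>2 * c \<le> 0" "a \<ge> 0"
  shows "a = 0"
proof (rule ccontr)
  assume "a \<noteq> 0"
  define t where "t = a / (\<bar>c\<bar> + 1)"
  have t: "t > 0" using assms(2) \<open>a \<noteq> 0\<close> by (simp add: t_def)
  have "a = t * (\<bar>c\<bar> + 1)" by (simp add: t_def)
  then have "2 * t * a + t\<^sup>2 * c = t\<^sup>2 * (2 * \<bar>c\<bar> + 2 + c)" by (simp add: power2_eq_square algebra_simps)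
  also have "\<dots> > 0" using t by (intro mult_pos_pos) auto
  finally show False using assms(1)[of t] by simp
qed

text \<open>A maximiser \<open>v\<close> on the unit sphere exists by compactness; perturbing it in
  the direction of its residual \<open>S *v v - l *\<^sub>R v\<close> shows that the residual is
  zero.\<close>

lemma exists_rayleigh_max:
  fixes S :: "real ^ 'n ^ 'n"
  assumes sym: "\<And>x y. x \<bullet> (S *v y) = y \<bullet> (S *v x)"
  shows "\<exists>l v. v \<noteq> 0 \<and> S *v v = l *\<^sub>R v \<and> (\<forall>x. x \<bullet> (S *v x) \<le> l * (norm x)\<^sup>2)"
proof -
  have "(axis undefined 1 :: real ^ 'n) \<in> sphere 0 1" by simp
  then have ne: "sphere (0 :: real ^ 'n) 1 \<noteq> {}" by blast
  have "continuous_on (sphere (0 :: real ^ 'n) 1) (\<lambda>x. x \<bullet> (S *v x))" by (intro continuous_intros)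
  from continuous_attains_sup[OF compact_sphere ne this]
  obtain v where v: "norm v = 1" and max: "\<And>y. norm y = 1 \<Longrightarrow> y \<bullet> (S *v y) \<le> v \<bullet> (S *v v)" by auto
  define l where "l = v \<bullet> (S *v v)"
  have le: "x \<bullet> (S *v x) \<le> l * (norm x)\<^sup>2" for x
  proof (cases "x = 0")
    case False
    have "((1 / norm x) *\<^sub>R x) \<bullet> (S *v ((1 / norm x) *\<^sub>R x)) \<le> l"
      unfolding l_def using False by (intro max) simp
    then have "(1 / norm x)\<^sup>2 * (x \<bullet> (S *v x)) \<le> l"
      by (simp add: matrix_vector_mult_scaleR power2_eq_square)
    then show ?thesis using False by (simp add: power_divide field_simps)
  qed simp
  define w where "w = S *v v - l *\<^sub>R v"
  have "w \<bullet> w = 0"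
  proof (rule quadratic_nonpos_imp_linear_zero)
    fix t :: real
    have "(v + t *\<^sub>R w) \<bullet> (S *v (v + t *\<^sub>R w)) \<le> l * (norm (v + t *\<^sub>R w))\<^sup>2" by (rule le)
    also have "(v + t *\<^sub>R w) \<bullet> (S *v (v + t *\<^sub>R w)) = l + 2 * t * (w \<bullet> (S *v v)) + t\<^sup>2 * (w \<bullet> (S *v w))"
      using sym[of v w] by (simp add: l_def matrix_vector_right_distrib matrix_vector_mult_scaleR inner_add power2_eq_square algebra_simps)
    also have "(norm (v + t *\<^sub>R w))\<^sup>2 = 1 + 2 * t * (w \<bullet> v) + t\<^sup>2 * (w \<bullet> w)"
      using v by (simp add: power2_norm_eq_inner inner_add inner_commute[of v w] power2_eq_square[of t] norm_eq_1 algebra_simps)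
    finally have "2 * t * (w \<bullet> (S *v v) - l * (w \<bullet> v)) + t\<^sup>2 * (w \<bullet> (S *v w) - l * (w \<bullet> w)) \<le> 0"
      by (simp add: algebra_simps)
    also have "w \<bullet> (S *v v) - l * (w \<bullet> v) = w \<bullet> w" by (simp add: w_def inner_diff_right)
    finally show "2 * t * (w \<bullet> w) + t\<^sup>2 * (w \<bullet> (S *v w) - l * (w \<bullet> w)) \<le> 0" .
  qed simp
  then have "S *v v = l *\<^sub>R v" by (simp add: w_def)
  then show ?thesis using le v by (intro exI[of _ l] exI[of _ v]) auto
qed

text \<open>Eigenvectors of distinct eigenvalues are orthogonal, hence independent. Finiteness is
  what gives \<open>Min\<close> and \<open>Max\<close> in \<open>lambda_min\<close> and
  \<open>lambda_max\<close> their meaning.\<close>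

lemma finite_real_eigenvalues:
  fixes S :: "real ^ 'n ^ 'n"
  assumes sym: "\<And>x y. x \<bullet> (S *v y) = y \<bullet> (S *v x)"
  shows "finite (real_eigenvalues S)"
proof -
  define f where "f l = (SOME v. v \<noteq> 0 \<and> S *v v = l *s v)" for l
  have f: "f l \<noteq> 0" "S *v f l = l *\<^sub>R f l" if "l \<in> real_eigenvalues S" for l
  proof -
    have "\<exists>v. v \<noteq> 0 \<and> S *v v = l *s v" using that by (simp add: real_eigenvalues_def)
    from someI_ex[OF this] show "f l \<noteq> 0" "S *v f l = l *\<^sub>R f l"
      by (simp_all add: f_def scalar_mult_eq_scaleR)
  qed
  have orth: "f l \<bullet> f m = 0" if "l \<in> real_eigenvalues S" "m \<in> real_eigenvalues S" "l \<noteq> m" for l m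
  proof -
    have "m * (f l \<bullet> f m) = l * (f l \<bullet> f m)"
      using sym[of "f l" "f m"] f[OF that(1)] f[OF that(2)] by (simp add: inner_commute)
    then show ?thesis using that(3) by simp
  qed
  have "independent (f ` real_eigenvalues S)"
    using f orth by (intro pairwise_orthogonal_independent) (auto simp: pairwise_def orthogonal_def)
  then have "finite (f ` real_eigenvalues S)" by (rule independent_imp_finite)
  moreover have "inj_on f (real_eigenvalues S)"
    using f orth by (intro inj_onI) (metis inner_eq_zero_iff)
  ultimately show ?thesis by (rule finite_imageD)
qed

lemma rayleigh_le_lambda_max:
  fixes S :: "real ^ 'n ^ 'n"
  assumes sym: "\<And>x y. x \<bullet> (S *v y) = y \<bullet> (S *v x)"
  shows "x \<bullet> (S *v x) \<le> lambda_max S * (norm x)\<^sup>2"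
proof -
  obtain l v where l: "v \<noteq> 0" "S *v v = l *\<^sub>R v" "\<And>x. x \<bullet> (S *v x) \<le> l * (norm x)\<^sup>2"
    using exists_rayleigh_max[OF sym] by blast
  have "lambda_max S = l"
    unfolding lambda_max_def
  proof (rule Max_eqI[OF finite_real_eigenvalues[OF sym]])
    show "l \<in> real_eigenvalues S" using l by (auto simp: real_eigenvalues_def scalar_mult_eq_scaleR)
    fix m assume "m \<in> real_eigenvalues S"
    then obtain w where w: "w \<noteq> 0" "S *v w = m *\<^sub>R w" by (auto simp: real_eigenvalues_def scalar_mult_eq_scaleR)
    then have "m * (norm w)\<^sup>2 \<le> l * (norm w)\<^sup>2" using l(3)[of w] by (simp add: power2_norm_eq_inner)
    then show "m \<le> l" using w by simp
  qed
  then show ?thesis using l(3) by simp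
qed

text \<open>The Rayleigh maximum of \<open>- S\<close> with the sign reversed. That the bound is
  attained is what later makes \<open>lambda_min\<close> of the covariance positive.\<close>

lemma lambda_min_rayleigh:
  fixes S :: "real ^ 'n ^ 'n"
  assumes sym: "\<And>x y. x \<bullet> (S *v y) = y \<bullet> (S *v x)"
  shows "lambda_min S * (norm x)\<^sup>2 \<le> x \<bullet> (S *v x)"
    and "\<exists>v. v \<noteq> 0 \<and> v \<bullet> (S *v v) = lambda_min S * (norm v)\<^sup>2"
proof -
  have neg: "(- S) *v x = - (S *v x)" for x
    by (simp add: vec_eq_iff matrix_vector_mult_def sum_negf)
  have "\<exists>l v. v \<noteq> 0 \<and> (- S) *v v = l *\<^sub>R v \<and> (\<forall>x. x \<bullet> ((- S) *v x) \<le> l * (norm x)\<^sup>2)"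
    by (rule exists_rayleigh_max) (simp add: neg sym)
  then obtain l' v where l': "v \<noteq> 0" "(- S) *v v = l' *\<^sub>R v" "\<And>x. x \<bullet> ((- S) *v x) \<le> l' * (norm x)\<^sup>2"
    by blast
  define l where "l = - l'"
  have l: "S *v v = l *\<^sub>R v" "\<And>x. l * (norm x)\<^sup>2 \<le> x \<bullet> (S *v x)"
  proof -
    show "S *v v = l *\<^sub>R v" using l'(2) by (simp add: l_def neg minus_equation_iff[of "S *v v"])
    show "l * (norm x)\<^sup>2 \<le> x \<bullet> (S *v x)" for x using l'(3)[of x] by (simp add: l_def neg)
  qed
  have "lambda_min S = l"
    unfolding lambda_min_def
  proof (rule Min_eqI[OF finite_real_eigenvalues[OF sym]])
    show "l \<in> real_eigenvalues S" using l l' by (auto simp: real_eigenvalues_def scalar_mult_eq_scaleR)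
    fix m assume "m \<in> real_eigenvalues S"
    then obtain w where w: "w \<noteq> 0" "S *v w = m *\<^sub>R w" by (auto simp: real_eigenvalues_def scalar_mult_eq_scaleR)
    then have "l * (norm w)\<^sup>2 \<le> m * (norm w)\<^sup>2" using l(2)[of w] by (simp add: power2_norm_eq_inner)
    then show "l \<le> m" using w by simp
  qed
  then show "lambda_min S * (norm x)\<^sup>2 \<le> x \<bullet> (S *v x)"
    and "\<exists>v. v \<noteq> 0 \<and> v \<bullet> (S *v v) = lambda_min S * (norm v)\<^sup>2"
    using l l'(1) by (auto intro!: exI[of _ v] simp: power2_norm_eq_inner)
qed

section \<open>The stationary covariance\<close>

lemma integrable_matrix:
  fixes f :: "'a \<Rightarrow> real ^ 'n ^ 'm"
  assumes "\<And>i j. integrable M (\<lambda>x. f x $ i $ j)"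
  shows "integrable M f"
proof -
  have "f x = (\<Sum>i\<in>UNIV. \<Sum>j\<in>UNIV. f x $ i $ j *\<^sub>R axis i (axis j 1))" for x
  proof -
    have row: "(\<Sum>l\<in>UNIV. f x $ k $ l *\<^sub>R axis k (axis l 1)) $ i $ j = (if k = i then f x $ k $ j else 0)" for i j k
      by (cases "k = i") (simp_all add: axis_def if_distrib[of "\<lambda>y. _ * y"] cong: if_cong)
    have "(\<Sum>k\<in>UNIV. \<Sum>l\<in>UNIV. f x $ k $ l *\<^sub>R axis k (axis l 1)) $ i $ j = f x $ i $ j" for i j
      unfolding sum_component[of _ UNIV] using row by simp
    then show ?thesis by (simp add: vec_eq_iff)
  qed
  then have eq: "f = (\<lambda>x. \<Sum>i\<in>UNIV. \<Sum>j\<in>UNIV. f x $ i $ j *\<^sub>R axis i (axis j 1))" by (rule ext)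
  show ?thesis
    by (subst eq) (intro Bochner_Integration.integrable_sum integrable_scaleR_left assms)
qed

lemma integrable_exp_decay:
  assumes "u > 0"
  shows "integrable lborel (\<lambda>x. indicator {0..} x * exp (- (u * x)) :: real)"
proof -
  have "(\<lambda>x. indicator {0} x *\<^sub>R exp (- (x * u))) = (indicator {0} :: real \<Rightarrow> real)"
    by (auto simp: indicator_def)
  then have "set_integrable lborel {0} (\<lambda>x. exp (- (x * u)))" by (simp add: set_integrable_def)
  then have "set_integrable lborel ({0} \<union> {0 <..}) (\<lambda>x. exp (- (x * u)))"
    using integrable_I0i_exp_mscale[OF assms] by (intro set_integrable_Un) auto
  also have "{0} \<union> {0 <..} = {0 :: real ..}" by auto
  finally show ?thesis by (simp add: set_integrable_def mult.commute)
qed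

locale ou_matrix =
  fixes A0 :: "real ^ 'd ^ 'd" and P0 :: "complex ^ 'd ^ 'd" and \<theta> :: "'d::finite \<Rightarrow> complex"
  assumes H: "assumption_H A0 P0 \<theta>"
begin

abbreviation "r0 \<equiv> min_Re \<theta>"
abbreviation "p0 \<equiv> condition_number P0"
abbreviation "C \<equiv> C_inf A0"

definition drift_semigroup :: "real \<Rightarrow> real ^ 'd ^ 'd" where
  "drift_semigroup s = matrix_exp (- (s *\<^sub>R A0))"

lemma r0_pos: "r0 > 0" using H by (simp add: assumption_H_def)

lemma diag_by_A0: "diag_by P0 (matrix_inv P0) \<theta> A0"
  using H by (intro diagonalises_diag_by) (simp add: assumption_H_def)

lemma diag_by_drift_semigroup: "diag_by P0 (matrix_inv P0) (\<lambda>k. exp (of_real (- s) * \<theta> k)) (drift_semigroup s)"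
  using diag_by_matrix_exp[OF diag_by_scaleR[OF diag_by_A0, of "- s"]] by (simp add: drift_semigroup_def)

lemma drift_semigroup_mult: "drift_semigroup s ** drift_semigroup t = drift_semigroup (s + t)"
proof (rule diag_by_unique[OF _ diag_by_drift_semigroup])
  show "diag_by P0 (matrix_inv P0) (\<lambda>k. exp (of_real (- (s + t)) * \<theta> k)) (drift_semigroup s ** drift_semigroup t)"
    using diag_by_mult[OF diag_by_drift_semigroup[of s] diag_by_drift_semigroup[of t]]
    by (simp add: exp_add[symmetric] algebra_simps)
qed

lemma drift_semigroup_0: "drift_semigroup 0 = mat 1"
  using diag_by_unique[OF diag_by_drift_semigroup[of 0]] diag_by_mat_1[OF diag_by_A0] by simp

lemma transpose_drift_semigroup: "matrix_exp (- (s *\<^sub>R transpose A0)) = transpose (drift_semigroup s)"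
proof (rule diag_by_unique[OF _ diag_by_transpose[OF diag_by_drift_semigroup]])
  show "diag_by (transpose (matrix_inv P0)) (transpose P0) (\<lambda>k. exp (of_real (- s) * \<theta> k)) (matrix_exp (- (s *\<^sub>R transpose A0)))"
    using diag_by_matrix_exp[OF diag_by_scaleR[OF diag_by_transpose[OF diag_by_A0], of "- s"]] by simp
qed

lemma continuous_on_drift_semigroup: "continuous_on UNIV drift_semigroup"
proof -
  have "drift_semigroup s $ i $ j = Re (\<Sum>k\<in>UNIV. P0 $ i $ k * exp (of_real (- s) * \<theta> k) * matrix_inv P0 $ k $ j)" for s i j
    using diag_by_entry[OF diag_by_drift_semigroup[of s], of i j] by (metis Re_complex_of_real)
  then have "drift_semigroup = (\<lambda>s. \<chi> i j. Re (\<Sum>k\<in>UNIV. P0 $ i $ k * exp (of_real (- s) * \<theta> k) * matrix_inv P0 $ k $ j))"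
    by (simp add: fun_eq_iff vec_eq_iff)
  then show ?thesis by (simp only:) (intro continuous_intros)
qed

lemma measurable_drift_semigroup [measurable]: "drift_semigroup \<in> borel_measurable borel"
  by (rule borel_measurable_continuous_onI[OF continuous_on_drift_semigroup])

lemma norm_drift_semigroup_le:
  assumes "s \<ge> 0"
  shows "norm (drift_semigroup s *v x) \<le> p0 * exp (- r0 * s) * norm x"
  unfolding condition_number_def
proof (rule norm_diag_by_mult_le[OF diag_by_drift_semigroup])
  fix k
  have "r0 \<le> Re (\<theta> k)" unfolding min_Re_def by (intro Min_le) auto
  then have "r0 * s \<le> Re (\<theta> k) * s" using assms by (rule mult_right_mono)
  then show "norm (exp (of_real (- s) * \<theta> k)) \<le> exp (- r0 * s)"
    by (simp add: norm_exp_eq_Re mult.commute)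
qed

text \<open>The transposed semigroup, the exponential of \<open>- s\<close> times the transpose of
  \<open>A0\<close>: testing the moving average \<open>X t\<close> with \<open>x\<close> moves the
  semigroup onto \<open>x\<close> in this form.\<close>

definition flow :: "real \<Rightarrow> real ^ 'd \<Rightarrow> real ^ 'd" where
  "flow s x = x v* drift_semigroup s"

lemma flow_add: "flow s (flow t x) = flow (s + t) x"
  by (simp add: flow_def vector_matrix_mul_assoc drift_semigroup_mult add.commute)

lemma flow_0: "flow 0 x = x" by (simp add: flow_def drift_semigroup_0)

lemma norm_flow_le: "s \<ge> 0 \<Longrightarrow> norm (flow s x) \<le> p0 * exp (- r0 * s) * norm x"
  unfolding flow_def by (intro norm_vector_matrix_mult_le_of_bound norm_drift_semigroup_le)

lemma p0_pos: "p0 > 0"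
proof -
  have "norm (axis undefined 1 :: real ^ 'd) \<le> p0 * norm (axis undefined 1 :: real ^ 'd)"
    using norm_flow_le[of 0 "axis undefined 1"] by (simp add: flow_0)
  then show ?thesis by simp
qed

lemma measurable_flow [measurable]: "(\<lambda>s. flow s x) \<in> borel_measurable borel"
  unfolding flow_def by measurable

lemma abs_inner_flow_le:
  assumes "s \<ge> 0"
  shows "\<bar>flow s x \<bullet> flow s y\<bar> \<le> p0\<^sup>2 * norm x * norm y * exp (- (2 * r0 * s))"
proof -
  have "\<bar>flow s x \<bullet> flow s y\<bar> \<le> norm (flow s x) * norm (flow s y)" by (rule Cauchy_Schwarz_ineq2)
  also have "\<dots> \<le> (p0 * exp (- r0 * s) * norm x) * (p0 * exp (- r0 * s) * norm y)"
    using assms p0_pos by (intro mult_mono norm_flow_le) auto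
  also have "\<dots> = p0\<^sup>2 * norm x * norm y * (exp (- r0 * s) * exp (- r0 * s))" by (simp add: power2_eq_square)
  also have "exp (- r0 * s) * exp (- r0 * s) = exp (- (2 * r0 * s))" by (simp add: exp_add[symmetric])
  finally show ?thesis .
qed

lemma integrable_inner_flow: "integrable lborel (\<lambda>s. indicator {0..} s * (flow s x \<bullet> flow s y))"
proof (rule Bochner_Integration.integrable_bound)
  show "integrable lborel (\<lambda>s. (p0\<^sup>2 * norm x * norm y) * (indicator {0..} s * exp (- ((2 * r0) * s))))"
    using r0_pos by (intro integrable_mult_right integrable_exp_decay) simp
  show "AE s in lborel. norm (indicator {0..} s * (flow s x \<bullet> flow s y))
      \<le> norm ((p0\<^sup>2 * norm x * norm y) * (indicator {0..} s * exp (- ((2 * r0) * s))))"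
    using abs_inner_flow_le[of _ x y] p0_pos by (intro AE_I2) (auto simp: indicator_def abs_mult)
qed measurable

lemma inner_C: "x \<bullet> (C *v y) = (LINT s|lborel. indicator {0..} s * (flow s x \<bullet> flow s y))"
proof -
  define G where "G s = indicator {0..} s *\<^sub>R (drift_semigroup s ** transpose (drift_semigroup s))" for s :: real
  have form: "x \<bullet> ((A ** transpose A) *v y) = (x v* A) \<bullet> (y v* A)" for A :: "real ^ 'd ^ 'd" and x y
    by (simp add: matrix_vector_mul_assoc[symmetric] dot_lmul_matrix)
  have entry: "M $ i $ j = axis i 1 \<bullet> (M *v axis j 1)" for M :: "real ^ 'd ^ 'd" and i j
    by (simp add: matrix_vector_mult_basis column_def inner_axis')
  have G: "x \<bullet> (G s *v y) = indicator {0..} s * (flow s x \<bullet> flow s y)" for s x y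
    by (simp add: G_def flow_def form scaleR_matrix_vector_assoc[symmetric])
  have int: "integrable lborel G"
    by (rule integrable_matrix) (simp only: entry G integrable_inner_flow)
  have bl: "bounded_linear (\<lambda>M :: real ^ 'd ^ 'd. x \<bullet> (M *v y))"
    unfolding linear_conv_bounded_linear[symmetric]
    by (rule linearI) (simp_all add: matrix_vector_mult_add_rdistrib inner_add_right scaleR_matrix_vector_assoc[symmetric])
  have "C = (LINT s|lborel. G s)"
    unfolding C_inf_def set_lebesgue_integral_def G_def transpose_drift_semigroup drift_semigroup_def[symmetric] ..
  then show ?thesis using integral_bounded_linear[OF bl int] by (simp add: G)
qed

lemma C_sym: "x \<bullet> (C *v y) = y \<bullet> (C *v x)"
  by (simp add: inner_C inner_commute)

lemma lambda_max_C: "x \<bullet> (C *v x) \<le> lambda_max C * (norm x)\<^sup>2"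
  by (rule rayleigh_le_lambda_max) (rule C_sym)

lemma lambda_min_C: "lambda_min C * (norm x)\<^sup>2 \<le> x \<bullet> (C *v x)"
  by (rule lambda_min_rayleigh) (rule C_sym)

text \<open>\<open>flow (- s)\<close> inverts \<open>flow s\<close> and is bounded for
  \<open>s\<close> in the unit interval, so the integrand of the covariance form is at least
  \<open>(norm x / B)\<^sup>2\<close> there.\<close>

lemma C_pos:
  assumes "x \<noteq> 0"
  shows "x \<bullet> (C *v x) > 0"
proof -
  have "continuous_on {0..1} (\<lambda>s. norm (drift_semigroup (- s)))"
    by (intro continuous_intros continuous_on_compose2[OF continuous_on_drift_semigroup]) auto
  then have "bounded ((\<lambda>s. norm (drift_semigroup (- s))) ` {0..1})"
    by (intro compact_imp_bounded compact_continuous_image) auto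
  then obtain B where B: "B > 0" "\<And>s. s \<in> {0..1} \<Longrightarrow> norm (drift_semigroup (- s)) \<le> B"
    unfolding bounded_pos by auto
  have le: "(norm x / B)\<^sup>2 * indicator {0..1} s \<le> indicator {0..} s * (flow s x \<bullet> flow s x)" for s
  proof (cases "s \<in> {0..1}")
    case True
    have "norm x = norm (flow (- s) (flow s x))" by (simp add: flow_add flow_0)
    also have "\<dots> \<le> norm (drift_semigroup (- s)) * norm (flow s x)"
      unfolding flow_def[of "- s"] by (rule norm_vector_matrix_mult_le)
    also have "\<dots> \<le> B * norm (flow s x)" using B True by (intro mult_right_mono) auto
    finally have "norm x / B \<le> norm (flow s x)" using B by (simp add: divide_le_eq mult.commute)
    then have "(norm x / B)\<^sup>2 \<le> (norm (flow s x))\<^sup>2" using B by (intro power_mono) auto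
    then show ?thesis using True by (simp add: power2_norm_eq_inner)
  qed (simp add: indicator_def)
  have "(LINT s|lborel. (norm x / B)\<^sup>2 * indicator {0..1::real} s) \<le> x \<bullet> (C *v x)"
    unfolding inner_C using le by (intro integral_mono integrable_inner_flow) auto
  moreover have "(LINT s|lborel. (norm x / B)\<^sup>2 * indicator {0..1::real} s) = (norm x / B)\<^sup>2"
    by (simp add: content_real)
  moreover have "0 < (norm x / B)\<^sup>2" using assms B by simp
  ultimately show ?thesis by linarith
qed

lemma lambda_min_pos: "lambda_min C > 0"
proof -
  obtain v where "v \<noteq> 0" "v \<bullet> (C *v v) = lambda_min C * (norm v)\<^sup>2"
    using lambda_min_rayleigh(2)[of C] C_sym by blast
  then show ?thesis using C_pos[of v] by (simp add: zero_less_mult_iff)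
qed

lemma lambda_max_pos: "lambda_max C > 0"
  using C_pos[of "axis undefined 1"] lambda_max_C[of "axis undefined 1"] by simp

lemma abs_inner_C_le: "\<bar>x \<bullet> (C *v y)\<bar> \<le> lambda_max C * norm x * norm y"
proof (rule bilinear_polarization_bound)
  show "bilinear (\<lambda>x y. x \<bullet> (C *v y))"
    by (auto simp: bilinear_def algebra_simps inner_add_right intro!: linearI)
  show "x \<bullet> (C *v y) = y \<bullet> (C *v x)" for x y by (rule C_sym)
  have "0 \<le> z \<bullet> (C *v z)" for z using C_pos[of z] by (cases "z = 0") auto
  then show "\<bar>z \<bullet> (C *v z)\<bar> \<le> lambda_max C * (norm z)\<^sup>2" for z
    using lambda_max_C[of z] by simp
qed

text \<open>The kernel of the Wiener integral representing \<open>x \<bullet> X t\<close>.\<close>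

definition ou_kernel :: "real \<Rightarrow> real ^ 'd \<Rightarrow> real \<Rightarrow> real ^ 'd" where
  "ou_kernel t x u = indicator {..t} u *\<^sub>R flow (t - u) x"

lemma ou_kernel_eq:
  "x v* (indicator {..t} u *\<^sub>R matrix_exp (- ((t - u) *\<^sub>R A0))) = ou_kernel t x u"
  by (simp add: ou_kernel_def flow_def drift_semigroup_def indicator_def)

lemma ou_kernel_covariance:
  assumes "s \<le> t"
  shows "integrable lborel (\<lambda>u. ou_kernel t x u \<bullet> ou_kernel s y u)"
    and "(LINT u|lborel. ou_kernel t x u \<bullet> ou_kernel s y u) = flow (t - s) x \<bullet> (C *v y)"
proof -
  \<comment> \<open>The substitution is \<open>v = s - u\<close>; for \<open>u \<le> s\<close> the
    semigroup law splits \<open>t - u\<close> into \<open>t - s\<close> and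
    \<open>v\<close>.\<close>
  define g where "g v = indicator {0..} v * (flow v (flow (t - s) x) \<bullet> flow v y)" for v :: real
  have eq: "ou_kernel t x u \<bullet> ou_kernel s y u = g (s + (-1) * u)" for u
    using assms by (auto simp: ou_kernel_def g_def indicator_def flow_add)
  have g: "integrable lborel g" unfolding g_def[abs_def] by (rule integrable_inner_flow)
  show "integrable lborel (\<lambda>u. ou_kernel t x u \<bullet> ou_kernel s y u)"
    unfolding eq by (rule lborel_integrable_real_affine[OF g]) simp
  show "(LINT u|lborel. ou_kernel t x u \<bullet> ou_kernel s y u) = flow (t - s) x \<bullet> (C *v y)"
    unfolding eq using lborel_integral_real_affine[of "-1" g s] by (simp add: inner_C g_def)
qed

lemma integrable_ou_kernel_inner: "integrable lborel (\<lambda>u. ou_kernel t x u \<bullet> ou_kernel s y u)"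
proof (cases "s \<le> t")
  case False
  then show ?thesis using ou_kernel_covariance(1)[of t s y x] by (simp add: inner_commute)
qed (rule ou_kernel_covariance)

text \<open>Only the flow over the gap between the two times is estimated by its decay; the rest
  stays inside \<open>C\<close>. So \<open>p0\<close> enters to the first power, although it bounds
  the flow of each of the two kernels.\<close>

lemma abs_ou_kernel_covariance_le:
  "\<bar>LINT u|lborel. ou_kernel t x u \<bullet> ou_kernel s y u\<bar> \<le> p0 * lambda_max C * exp (- r0 * \<bar>t - s\<bar>) * norm x * norm y"
proof -
  have *: "\<bar>LINT u|lborel. ou_kernel t x u \<bullet> ou_kernel s y u\<bar> \<le> p0 * lambda_max C * exp (- r0 * \<bar>t - s\<bar>) * norm x * norm y"
    if "s \<le> t" for s t x y
  proof -
    have "\<bar>flow (t - s) x \<bullet> (C *v y)\<bar> \<le> lambda_max C * norm (flow (t - s) x) * norm y"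
      by (rule abs_inner_C_le)
    also have "\<dots> \<le> lambda_max C * (p0 * exp (- r0 * (t - s)) * norm x) * norm y"
      using that lambda_max_pos by (intro mult_left_mono mult_right_mono norm_flow_le) auto
    finally show ?thesis using that by (simp add: ou_kernel_covariance(2) mult_ac)
  qed
  show ?thesis
  proof (cases "s \<le> t")
    case False
    then show ?thesis using *[of t s y x] by (simp add: inner_commute abs_minus_commute mult_ac)
  qed (rule *)
qed

lemma integral_ou_kernel_square: "(LINT u|lborel. ou_kernel t x u \<bullet> ou_kernel t x u) = x \<bullet> (C *v x)"
  by (simp add: ou_kernel_covariance flow_0)

end

section \<open>Riemann sums and geometric sums\<close>

lemma riemann_sum_error:
  fixes g :: "real \<Rightarrow> real" and T :: real and m n :: nat
  assumes T: "T > 0" and n: "n > 0" and g: "continuous_on {0..T} g"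
    and e: "\<And>t u. t \<in> {0..T} \<Longrightarrow> u \<in> {0..T} \<Longrightarrow> \<bar>t - u\<bar> \<le> T / real n \<Longrightarrow> \<bar>g t - g u\<bar> \<le> e"
  shows "m \<le> n \<Longrightarrow> \<bar>integral {0..T * m / n} g - (\<Sum>k<m. T / n * g (T * real k / real n))\<bar> \<le> e * (T * m / n)"
proof (induction m)
  case (Suc m)
  define a b where "a = T * m / n" and "b = T * Suc m / n"
  have ba: "b - a = T / n" using n by (simp add: a_def b_def field_simps)
  have mn: "real (Suc m) \<le> real n" using Suc.prems by simp
  have a0: "0 \<le> a" using T by (simp add: a_def)
  have ab: "a \<le> b" using ba T by (metis diff_ge_0_iff_ge divide_nonneg_nonneg less_imp_le of_nat_0_le_iff)
  have "T * real (Suc m) \<le> T * real n" using mn T by (intro mult_left_mono) auto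
  then have bT: "b \<le> T" using n by (simp add: b_def divide_le_eq)
  have ga: "continuous_on {a..b} g" by (rule continuous_on_subset[OF g]) (use a0 bT in auto)
  have g0: "g integrable_on {0..b}"
    by (rule integrable_continuous_interval, rule continuous_on_subset[OF g]) (use bT in auto)
  have split: "integral {0..b} g = integral {0..a} g + integral {a..b} g"
    using Henstock_Kurzweil_Integration.integral_combine[OF a0 ab g0] by simp
  have "integral {a..b} (\<lambda>t. g t - g a) = integral {a..b} g - T / n * g a"
    using ab ba ga by (subst Henstock_Kurzweil_Integration.integral_diff) (auto intro: integrable_continuous_interval simp: content_real)
  moreover have "norm (integral {a..b} (\<lambda>t. g t - g a)) \<le> e * (b - a)"
  proof (rule integral_bound[OF ab])
    show "continuous_on {a..b} (\<lambda>t. g t - g a)" by (intro continuous_intros ga)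
    show "norm (g t - g a) \<le> e" if "t \<in> {a..b}" for t
      using that a0 bT ab ba by (auto intro!: e)
  qed
  ultimately have "\<bar>integral {a..b} g - T / n * g a\<bar> \<le> e * (T / n)" by (simp add: ba)
  moreover have "\<bar>integral {0..a} g - (\<Sum>k<m. T / n * g (T * real k / real n))\<bar> \<le> e * a"
    using Suc by (simp add: a_def)
  ultimately have "\<bar>integral {0..b} g - (\<Sum>k<Suc m. T / n * g (T * real k / real n))\<bar> \<le> e * a + e * (T / n)"
    by (simp add: split a_def[symmetric])
  also have "\<dots> = e * b"
  proof -
    have "b = a + T / n" using ba by simp
    then show ?thesis by (simp add: distrib_left)
  qed
  finally show ?case by (simp add: b_def)
qed simp

lemma tendsto_riemann_sum:
  fixes g :: "real \<Rightarrow> real" and T :: real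
  assumes T: "T > 0" and g: "continuous_on {0..T} g"
  shows "(\<lambda>n :: nat. (\<Sum>k<n. g (T * real k / real n)) / n) \<longlonglongrightarrow> 1 / T * (LINT t:{0..T}|lborel. g t)"
proof (rule metric_LIMSEQ_I)
  fix r :: real assume r: "r > 0"
  have "uniformly_continuous_on {0..T} g" by (rule compact_uniformly_continuous[OF g]) simp
  then obtain d where d: "d > 0" "\<And>t u. t \<in> {0..T} \<Longrightarrow> u \<in> {0..T} \<Longrightarrow> dist u t < d \<Longrightarrow> dist (g u) (g t) < r / 2"
    unfolding uniformly_continuous_on_def using r by (metis half_gt_zero)
  obtain N where N: "real N > T / d" using reals_Archimedean2 by blast
  have int: "(LINT t:{0..T}|lborel. g t) = integral {0..T} g"
    by (rule set_borel_integral_eq_integral(2)[OF borel_integrable_atLeastAtMost'[OF g]])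
  show "\<exists>N. \<forall>n\<ge>(N::nat). dist ((\<Sum>k<n. g (T * real k / real n)) / real n) (1 / T * (LINT t:{0..T}|lborel. g t)) < r"
  proof (intro exI[of _ "max 1 N"] allI impI)
    fix n :: nat assume "max 1 N \<le> n"
    then have n: "n > 0" "real n > T / d" using N by (auto intro: less_le_trans)
    have Tn: "T / real n < d" using n d(1) by (simp add: field_simps)
    have "\<bar>integral {0..T * n / n} g - (\<Sum>k<n. T / n * g (T * real k / real n))\<bar> \<le> r / 2 * (T * n / n)"
    proof (rule riemann_sum_error[OF T n(1) g])
      fix t u assume tu: "t \<in> {0..T}" "u \<in> {0..T}" "\<bar>t - u\<bar> \<le> T / real n"
      then have "dist (g t) (g u) < r / 2" using Tn by (intro d(2)) (auto simp: dist_real_def)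
      then show "\<bar>g t - g u\<bar> \<le> r / 2" by (simp add: dist_real_def)
    qed simp
    then have "\<bar>integral {0..T} g - T * ((\<Sum>k<n. g (T * real k / real n)) / n)\<bar> \<le> r / 2 * T"
      using n by (simp add: sum_distrib_left sum_divide_distrib)
    moreover have "T * \<bar>(\<Sum>k<n. g (T * real k / real n)) / n - 1 / T * integral {0..T} g\<bar>
        = \<bar>T * ((\<Sum>k<n. g (T * real k / real n)) / n) - integral {0..T} g\<bar>"
      using T by (subst abs_of_pos[OF T, symmetric], subst abs_mult[symmetric]) (simp add: right_diff_distrib)
    ultimately have "T * \<bar>(\<Sum>k<n. g (T * real k / real n)) / n - 1 / T * integral {0..T} g\<bar> \<le> T * (r / 2)"
      by (simp only: abs_minus_commute mult.commute)
    then have "\<bar>(\<Sum>k<n. g (T * real k / real n)) / n - 1 / T * integral {0..T} g\<bar> \<le> r / 2" using T by simp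
    then show "dist ((\<Sum>k<n. g (T * real k / real n)) / n) (1 / T * (LINT t:{0..T}|lborel. g t)) < r"
      using r by (simp add: dist_real_def int)
  qed
qed

section \<open>Row sums of an exponentially decaying kernel and Schur's test\<close>

lemma sum_geometric_two_sided_le:
  fixes q :: real
  assumes q: "0 \<le> q" "q < 1" and k: "k < n"
  shows "(\<Sum>l<n. q ^ nat \<bar>int k - int l\<bar>) \<le> (1 + q) / (1 - q)"
proof -
  have 1: "(\<Sum>l<k. q ^ (k - l)) * (1 - q) = q - q ^ Suc k" for k
  proof (induction k)
    case (Suc k)
    have "(\<Sum>l<Suc k. q ^ (Suc k - l)) = q * (\<Sum>l<k. q ^ (k - l)) + q"
      by (simp add: sum_distrib_left Suc_diff_le)
    then have "(\<Sum>l<Suc k. q ^ (Suc k - l)) * (1 - q) = q * ((\<Sum>l<k. q ^ (k - l)) * (1 - q)) + q * (1 - q)"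
      by (simp only: distrib_right mult.assoc)
    then show ?case unfolding Suc by (simp add: algebra_simps)
  qed simp
  have 2: "k \<le> m \<Longrightarrow> (\<Sum>l=k..<m. q ^ (l - k)) * (1 - q) = 1 - q ^ (m - k)" for m
  proof (induction m rule: dec_induct)
    case (step m)
    have "(\<Sum>l=k..<Suc m. q ^ (l - k)) * (1 - q) = (\<Sum>l=k..<m. q ^ (l - k)) * (1 - q) + q ^ (m - k) * (1 - q)"
      using step.hyps by (simp add: distrib_right)
    also have "\<dots> = 1 - q ^ (m - k) + q ^ (m - k) * (1 - q)" by (simp only: step.IH)
    also have "\<dots> = 1 - q ^ (Suc m - k)" using step.hyps by (simp add: Suc_diff_le algebra_simps)
    finally show ?case .
  qed simp
  have "(\<Sum>l<n. q ^ nat \<bar>int k - int l\<bar>) = (\<Sum>l<k. q ^ nat \<bar>int k - int l\<bar>) + (\<Sum>l=k..<n. q ^ nat \<bar>int k - int l\<bar>)"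
    using sum.atLeastLessThan_concat[of 0 k n "\<lambda>l. q ^ nat \<bar>int k - int l\<bar>"] k by (simp only: lessThan_atLeast0)
  also have "(\<Sum>l<k. q ^ nat \<bar>int k - int l\<bar>) = (\<Sum>l<k. q ^ (k - l))"
    by (intro sum.cong refl arg_cong2[where f = power]) auto
  also have "(\<Sum>l=k..<n. q ^ nat \<bar>int k - int l\<bar>) = (\<Sum>l=k..<n. q ^ (l - k))"
    by (intro sum.cong refl arg_cong2[where f = power]) auto
  finally have "(\<Sum>l<n. q ^ nat \<bar>int k - int l\<bar>) * (1 - q) = q - q ^ Suc k + (1 - q ^ (n - k))"
    using 1[of k] 2[of n] k by (simp add: distrib_right)
  also have "\<dots> \<le> 1 + q" using zero_le_power[OF q(1), of "Suc k"] zero_le_power[OF q(1), of "n - k"] by linarith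
  finally show ?thesis using q by (simp add: pos_le_divide_eq)
qed

text \<open>With \<open>q = exp (- r)\<close> the two-sided series is
  \<open>1 + 2 * q / (1 - q)\<close>. The 1 is the diagonal term, which fades as the time grid is
  refined; \<open>2 / r\<close> is the integral of the kernel over the real line.\<close>

lemma exp_decay_row_sum_le:
  assumes r: "r > 0" and k: "k < n"
  shows "(\<Sum>l<n. exp (- r * \<bar>real k - real l\<bar>)) \<le> 1 + 2 / r"
proof -
  define q where "q = exp (- r)"
  have q: "0 < q" "q < 1" using r by (simp_all add: q_def)
  have e: "exp (- r * \<bar>real k - real l\<bar>) = q ^ nat \<bar>int k - int l\<bar>" for l
  proof -
    have "\<bar>real k - real l\<bar> = real (nat \<bar>int k - int l\<bar>)" by simp
    then show ?thesis by (simp only: q_def exp_of_nat_mult[symmetric] mult.commute)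
  qed
  have "1 + r \<le> 1 / q" using exp_ge_add_one_self[of r] by (simp add: q_def exp_minus inverse_eq_divide)
  then have "q * r \<le> 1 - q" using q by (simp add: field_simps)
  then have "2 * q / (1 - q) \<le> 2 / r" using q r by (simp add: field_simps)
  moreover have "(1 + q) / (1 - q) = 1 + 2 * q / (1 - q)" using q by (simp add: field_simps)
  ultimately show ?thesis
    using sum_geometric_two_sided_le[of q k n] q k unfolding e by linarith
qed

lemma schur_test:
  fixes e :: "nat \<Rightarrow> nat \<Rightarrow> real"
  assumes sym: "\<And>k l. e k l = e l k" and e0: "\<And>k l. e k l \<ge> 0"
    and row: "\<And>k. k < n \<Longrightarrow> (\<Sum>l<n. e k l) \<le> B"
  shows "(\<Sum>k<n. \<Sum>l<n. e k l * (a k * a l)) \<le> B * (\<Sum>k<n. (a k)\<^sup>2)"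
proof -
  have "(\<Sum>k<n. \<Sum>l<n. e k l * (a k * a l)) \<le> (\<Sum>k<n. \<Sum>l<n. e k l * (a k)\<^sup>2 / 2 + e k l * (a l)\<^sup>2 / 2)"
  proof (intro sum_mono)
    fix k l
    have "a k * a l \<le> ((a k)\<^sup>2 + (a l)\<^sup>2) / 2" using sum_squares_bound[of "a k" "a l"] by simp
    then have "e k l * (a k * a l) \<le> e k l * (((a k)\<^sup>2 + (a l)\<^sup>2) / 2)" by (rule mult_left_mono[OF _ e0])
    then show "e k l * (a k * a l) \<le> e k l * (a k)\<^sup>2 / 2 + e k l * (a l)\<^sup>2 / 2" by (simp add: distrib_left add_divide_distrib)
  qed
  also have "\<dots> = (\<Sum>k<n. \<Sum>l<n. e k l * (a k)\<^sup>2 / 2) + (\<Sum>k<n. \<Sum>l<n. e k l * (a l)\<^sup>2 / 2)"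
    by (simp add: sum.distrib)
  also have "(\<Sum>k<n. \<Sum>l<n. e k l * (a l)\<^sup>2 / 2) = (\<Sum>k<n. \<Sum>l<n. e k l * (a k)\<^sup>2 / 2)"
    by (subst sum.swap) (simp add: sym)
  also have "(\<Sum>k<n. \<Sum>l<n. e k l * (a k)\<^sup>2 / 2) + (\<Sum>k<n. \<Sum>l<n. e k l * (a k)\<^sup>2 / 2) = (\<Sum>k<n. (\<Sum>l<n. e k l) * (a k)\<^sup>2)"
    by (simp add: sum_distrib_right sum.distrib[symmetric])
  also have "\<dots> \<le> (\<Sum>k<n. B * (a k)\<^sup>2)" by (intro sum_mono mult_right_mono row) auto
  finally show ?thesis by (simp add: sum_distrib_left)
qed

section \<open>Concentration of the empirical quadratic form\<close>

locale ou_process = ou_matrix A0 P0 \<theta> + prob_space M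
  for A0 :: "real ^ 'd ^ 'd" and P0 :: "complex ^ 'd ^ 'd" and \<theta> :: "'d::finite \<Rightarrow> complex"
    and M :: "'a measure" +
  fixes W X :: "real \<Rightarrow> 'a \<Rightarrow> real ^ 'd"
  assumes W: "two_sided_brownian_motion M W" and X: "stationary_OU M A0 W X"
begin

lemma linear_flow: "linear (flow s)"
  by (rule linearI) (simp_all add: flow_def vector_matrix_left_distrib scaleR_vector_matrix_assoc)

lemma continuous_path: "\<omega> \<in> space M \<Longrightarrow> continuous_on {0..T} (\<lambda>t. X t \<omega>)"
  using X by (auto simp: stationary_OU_def intro: continuous_on_subset)

lemma measurable_OU [measurable]: "t \<ge> 0 \<Longrightarrow> X t \<in> borel_measurable M"
  using X by (simp add: stationary_OU_def has_wiener_integral_def)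

lemma integral_ou_kernel_sum_square:
  "integrable lborel (\<lambda>u. (norm (\<Sum>k\<in>K. ou_kernel (\<tau> k) (x k) u))\<^sup>2)"
  "(LINT u|lborel. (norm (\<Sum>k\<in>K. ou_kernel (\<tau> k) (x k) u))\<^sup>2)
    = (\<Sum>k\<in>K. \<Sum>l\<in>K. LINT u|lborel. ou_kernel (\<tau> k) (x k) u \<bullet> ou_kernel (\<tau> l) (x l) u)"
  unfolding power2_norm_eq_inner inner_sum_left inner_sum_right
  by (intro Bochner_Integration.integrable_sum integrable_ou_kernel_inner,
      simp add: Bochner_Integration.integral_sum integrable_ou_kernel_inner, rule sum.swap)

lemma integral_iexp_X:
  assumes "\<And>k. k \<in> K \<Longrightarrow> \<tau> k \<ge> 0" "finite K"
  shows "(LINT \<omega>|M. iexp (\<Sum>k\<in>K. x k \<bullet> X (\<tau> k) \<omega>))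
    = exp (- (LINT u|lborel. (norm (\<Sum>k\<in>K. ou_kernel (\<tau> k) (x k) u))\<^sup>2) / 2)"
proof -
  let ?f = "\<lambda>k u. indicator {..\<tau> k} u *\<^sub>R matrix_exp (- ((\<tau> k - u) *\<^sub>R A0))"
  have "has_wiener_integral M W (?f k) (X (\<tau> k))" if "k \<in> K" for k
    using X assms that by (simp add: stationary_OU_def)
  from integral_iexp_wiener[OF W assms(2), where f = ?f and Y = "\<lambda>k. X (\<tau> k)" and x = x, OF this,
      unfolded ou_kernel_eq, OF _ integral_ou_kernel_sum_square(1)]
  show ?thesis by blast
qed

text \<open>The trace of \<open>U\<close> times \<open>C\<close> times the transpose of
  \<open>V\<close>, which is the expectation of \<open>(U *v X t) \<bullet> (V *v X t)\<close> under
  the stationary law.\<close>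

definition stationary_form :: "real ^ 'd ^ 'd \<Rightarrow> real ^ 'd ^ 'd \<Rightarrow> real" where
  "stationary_form U V = (\<Sum>i\<in>UNIV. (U $ i) \<bullet> (C *v (V $ i)))"

lemma norm_square_rows: "(norm (V :: real ^ 'd ^ 'd))\<^sup>2 = (\<Sum>i\<in>UNIV. (norm (V $ i))\<^sup>2)"
  by (simp add: norm_vec_def[of V] L2_set_def sum_nonneg)

lemma stationary_form_between:
  "lambda_min C * (norm V)\<^sup>2 \<le> stationary_form V V" "stationary_form V V \<le> lambda_max C * (norm V)\<^sup>2"
  unfolding norm_square_rows stationary_form_def sum_distrib_left
  by (auto intro!: sum_mono lambda_min_C lambda_max_C)

text \<open>The Riemann sum is the squared norm of the Gaussian vector \<open>G\<close>, indexed by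
  grid point and row of \<open>V\<close>. The trace of its covariance is
  \<open>stationary_form V V\<close> by stationarity. Schur's test with decay
  \<open>r0 * T / n\<close> per grid step, times the weight \<open>1 / n\<close>, gives
  \<open>L\<close>.\<close>

lemma nn_integral_exp_riemann_sum_le:
  fixes V :: "real ^ 'd ^ 'd" and n :: nat
  assumes T: "T > 0" and n: "n > 0" and V: "norm V \<le> 1"
    and L: "L = p0 * lambda_max C * (1 / n + 2 / (r0 * T))" and \<mu>: "2 * \<mu> * L < 1"
  shows "(\<integral>\<^sup>+ \<omega>. ennreal (exp (\<mu> * ((\<Sum>k<n. (V *v X (T * real k / real n) \<omega>) \<bullet> (V *v X (T * real k / real n) \<omega>)) / n))) \<partial>M)
    \<le> ennreal (exp (\<mu> * stationary_form V V / (1 - 2 * \<mu> * L)))"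
proof -
  define I :: "(nat \<times> 'd) set" where "I = {..<n} \<times> UNIV"
  define c where "c = 1 / sqrt n"
  have c2: "c\<^sup>2 = 1 / n" by (simp add: c_def power_divide)
  define \<tau> where "\<tau> k = T * real k / n" for k
  have \<tau>: "\<tau> k \<ge> 0" for k using T by (simp add: \<tau>_def)
  define G where "G = (\<lambda>(k, i) \<omega>. c * ((V $ i) \<bullet> X (\<tau> k) \<omega>))"
  define \<phi> where "\<phi> = (\<lambda>(k, i) u. ou_kernel (\<tau> k) (c *\<^sub>R (V $ i)) u)"
  define A where "A a b = (LINT u|lborel. \<phi> a u \<bullet> \<phi> b u)" for a b
  \<comment> \<open>Summing over the rows first turns a linear form in \<open>G\<close> into one in
    the vectors \<open>X (\<tau> k)\<close>. Since \<open>norm V \<le> 1\<close>, this costs only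
    the factor \<open>1 / n\<close> in squared norm and no factor for the dimension.\<close>
  define x where "x h k = (\<Sum>i\<in>UNIV. h (k, i) *\<^sub>R (c *\<^sub>R (V $ i)))" for h :: "nat \<times> 'd \<Rightarrow> real" and k
  have finI: "finite I" by (simp add: I_def)
  have sum_I: "(\<Sum>a\<in>I. f a) = (\<Sum>k<n. \<Sum>i\<in>UNIV. f (k, i))" for f :: "nat \<times> 'd \<Rightarrow> 'e::comm_monoid_add"
    unfolding I_def by (simp add: sum.cartesian_product)
  have kernel_sum: "ou_kernel t (x h k) u = (\<Sum>i\<in>UNIV. h (k, i) *\<^sub>R ou_kernel t (c *\<^sub>R (V $ i)) u)" for t h k u
    unfolding ou_kernel_def x_def linear_sum[OF linear_flow]
    by (simp add: linear_scale[OF linear_flow] scaleR_sum_right mult_ac)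
  have q: "quad_form I A h = (LINT u|lborel. (norm (\<Sum>k<n. ou_kernel (\<tau> k) (x h k) u))\<^sup>2)" for h
  proof -
    have "(\<Sum>k<n. ou_kernel (\<tau> k) (x h k) u) = (\<Sum>a\<in>I. h a *\<^sub>R \<phi> a u)" for u
      by (simp add: kernel_sum sum_I \<phi>_def)
    then have "(norm (\<Sum>k<n. ou_kernel (\<tau> k) (x h k) u))\<^sup>2 = (\<Sum>a\<in>I. \<Sum>b\<in>I. h a * h b * (\<phi> a u \<bullet> \<phi> b u))" for u
      by (simp add: power2_norm_eq_inner inner_sum_left inner_sum_right sum_distrib_left inner_commute mult_ac)
    moreover have "integrable lborel (\<lambda>u. \<phi> a u \<bullet> \<phi> b u)" for a b
      by (simp add: \<phi>_def case_prod_beta integrable_ou_kernel_inner)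
    ultimately show ?thesis
      by (simp add: quad_form_def A_def Bochner_Integration.integral_sum mult_ac)
  qed
  have pos: "0 \<le> quad_form I A h" for h unfolding q by (intro integral_nonneg_AE) simp
  have upp: "quad_form I A h \<le> L * (\<Sum>a\<in>I. (h a)\<^sup>2)" for h
  proof -
    define e where "e k l = exp (- (r0 * T / n) * \<bar>real k - real l\<bar>)" for k l :: nat
    have dist: "- r0 * \<bar>\<tau> k - \<tau> l\<bar> = - (r0 * T / n) * \<bar>real k - real l\<bar>" for k l
    proof -
      have "\<tau> k - \<tau> l = T / n * (real k - real l)" by (simp add: \<tau>_def right_diff_distrib diff_divide_distrib)
      then show ?thesis using T by (simp add: abs_mult)
    qed
    have "quad_form I A h = (\<Sum>k<n. \<Sum>l<n. LINT u|lborel. ou_kernel (\<tau> k) (x h k) u \<bullet> ou_kernel (\<tau> l) (x h l) u)"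
      unfolding q by (rule integral_ou_kernel_sum_square)
    also have "\<dots> \<le> (\<Sum>k<n. \<Sum>l<n. p0 * lambda_max C * (e k l * (norm (x h k) * norm (x h l))))"
    proof (intro sum_mono)
      fix k l
      show "(LINT u|lborel. ou_kernel (\<tau> k) (x h k) u \<bullet> ou_kernel (\<tau> l) (x h l) u)
        \<le> p0 * lambda_max C * (e k l * (norm (x h k) * norm (x h l)))"
        using abs_ou_kernel_covariance_le[of "\<tau> k" "x h k" "\<tau> l" "x h l"]
        unfolding dist e_def[symmetric] by (simp add: mult_ac)
    qed
    also have "\<dots> = p0 * lambda_max C * (\<Sum>k<n. \<Sum>l<n. e k l * (norm (x h k) * norm (x h l)))"
      by (simp add: sum_distrib_left)
    also have "\<dots> \<le> p0 * lambda_max C * ((1 + 2 / (r0 * T / n)) * (\<Sum>k<n. (norm (x h k))\<^sup>2))"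
    proof (rule mult_left_mono)
      show "(\<Sum>k<n. \<Sum>l<n. e k l * (norm (x h k) * norm (x h l))) \<le> (1 + 2 / (r0 * T / n)) * (\<Sum>k<n. (norm (x h k))\<^sup>2)"
      proof (rule schur_test[where e = e and a = "\<lambda>k. norm (x h k)"])
        show "(\<Sum>l<n. e k l) \<le> 1 + 2 / (r0 * T / n)" if "k < n" for k
          unfolding e_def using r0_pos T n that by (intro exp_decay_row_sum_le) auto
        show "e k l = e l k" for k l unfolding e_def abs_minus_commute[of "real k" "real l"] ..
        show "0 \<le> e k l" for k l unfolding e_def by (rule exp_ge_zero)
      qed
    qed (use p0_pos lambda_max_pos in simp)
    also have "\<dots> \<le> p0 * lambda_max C * ((1 + 2 / (r0 * T / n)) * (1 / n * (\<Sum>a\<in>I. (h a)\<^sup>2)))"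
    proof -
      have "(norm (x h k))\<^sup>2 \<le> 1 / n * (\<Sum>i\<in>UNIV. (h (k, i))\<^sup>2)" for k
      proof -
        define w :: "real ^ 'd" where "w = (\<chi> i. h (k, i))"
        have "x h k = c *\<^sub>R (w v* V)"
          unfolding x_def w_def vector_matrix_mult_def
          by (simp add: vec_eq_iff sum_distrib_left mult_ac)
        then have "norm (x h k) \<le> c * (norm V * norm w)"
          using norm_vector_matrix_mult_le[of w V] by (simp add: c_def divide_right_mono)
        also have "\<dots> \<le> c * (1 * norm w)" using V by (intro mult_left_mono mult_right_mono) (simp_all add: c_def)
        finally have "(norm (x h k))\<^sup>2 \<le> (c * norm w)\<^sup>2" by (intro power_mono) auto
        also have "\<dots> = 1 / n * (\<Sum>i\<in>UNIV. (h (k, i))\<^sup>2)"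
          by (simp add: power_mult_distrib c2 w_def norm_vec_def L2_set_def sum_nonneg)
        finally show ?thesis .
      qed
      then have "(\<Sum>k<n. (norm (x h k))\<^sup>2) \<le> 1 / n * (\<Sum>a\<in>I. (h a)\<^sup>2)"
        unfolding sum_I sum_distrib_left[of "1 / real n"] by (intro sum_mono)
      then show ?thesis using p0_pos lambda_max_pos r0_pos T n
        by (intro mult_left_mono) auto
    qed
    also have "\<dots> = L * (\<Sum>a\<in>I. (h a)\<^sup>2)"
      unfolding L using n T r0_pos by (simp add: field_simps)
    finally show ?thesis .
  qed
  have char: "(LINT \<omega>|M. iexp (\<Sum>a\<in>I. h a * G a \<omega>)) = exp (- quad_form I A h / 2)" for h
  proof -
    have "(\<Sum>a\<in>I. h a * G a \<omega>) = (\<Sum>k<n. x h k \<bullet> X (\<tau> k) \<omega>)" for \<omega>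
      by (simp add: sum_I G_def x_def inner_sum_left mult.assoc)
    then show ?thesis using integral_iexp_X[of "{..<n}" \<tau> "x h"] \<tau> by (simp add: q)
  qed
  have A_sym: "A a b = A b a" for a b by (simp add: A_def inner_commute)
  have "L > 0" unfolding L using p0_pos lambda_max_pos r0_pos T n by (intro mult_pos_pos add_pos_pos) auto
  moreover have "G a \<in> borel_measurable M" for a using \<tau> by (simp add: G_def case_prod_beta)
  ultimately have "(\<integral>\<^sup>+ \<omega>. ennreal (exp (\<mu> * (\<Sum>a\<in>I. (G a \<omega>)\<^sup>2))) \<partial>M) \<le> ennreal (exp (\<mu> * (\<Sum>a\<in>I. A a a) / (1 - 2 * \<mu> * L)))"
    by (intro nn_integral_exp_sum_squares_le[OF finI _ _ \<mu> A_sym pos upp char])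
  moreover have "(\<Sum>a\<in>I. (G a \<omega>)\<^sup>2) = (\<Sum>k<n. (V *v X (T * real k / real n) \<omega>) \<bullet> (V *v X (T * real k / real n) \<omega>)) / n" for \<omega>
  proof -
    have "(V *v y) \<bullet> (V *v y) = (\<Sum>i\<in>UNIV. ((V $ i) \<bullet> y)\<^sup>2)" for y
      by (simp add: inner_vec_def matrix_vector_mult_def power2_eq_square)
    then show ?thesis
      by (simp add: sum_I G_def power_mult_distrib c2 \<tau>_def sum_divide_distrib)
  qed
  moreover have "(\<Sum>a\<in>I. A a a) = stationary_form V V"
  proof -
    have "A (k, i) (k, i) = 1 / n * ((V $ i) \<bullet> (C *v (V $ i)))" for k i
      unfolding A_def \<phi>_def using integral_ou_kernel_square[of "\<tau> k" "c *\<^sub>R (V $ i)"]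
      by (simp add: matrix_vector_mult_scaleR c2[symmetric] power2_eq_square)
    then show ?thesis using n by (simp add: sum_I stationary_form_def sum_divide_distrib[symmetric])
  qed
  ultimately show ?thesis by simp
qed

section \<open>The empirical form in continuous time\<close>

definition empirical_form :: "real \<Rightarrow> real ^ 'd ^ 'd \<Rightarrow> real ^ 'd ^ 'd \<Rightarrow> 'a \<Rightarrow> real" where
  "empirical_form T U V \<omega> = 1 / T * (LINT t:{0..T}|lborel. (U *v X t \<omega>) \<bullet> (V *v X t \<omega>))"

lemma emp_sqnorm_eq: "emp_sqnorm T V (\<lambda>t. X t \<omega>) = empirical_form T V V \<omega>"
  by (simp add: emp_sqnorm_def empirical_form_def)

lemma continuous_on_empirical_integrand:
  assumes "\<omega> \<in> space M"
  shows "continuous_on {0..T} (\<lambda>t. (U *v X t \<omega>) \<bullet> (V *v X t \<omega>))"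
  by (intro continuous_intros continuous_path assms
      continuous_on_compose2[OF matrix_vector_mult_linear_continuous_on[of UNIV]]) auto

lemma empirical_form_riemann:
  assumes "T > 0" "\<omega> \<in> space M"
  shows "(\<lambda>n. (\<Sum>k<n. (V *v X (T * real k / real n) \<omega>) \<bullet> (V *v X (T * real k / real n) \<omega>)) / n)
    \<longlonglongrightarrow> empirical_form T V V \<omega>"
  unfolding empirical_form_def
  by (rule tendsto_riemann_sum[OF assms(1) continuous_on_empirical_integrand[OF assms(2)]])

text \<open>Continuity of the paths makes the time integral a pointwise limit of Riemann sums, so no
  joint measurability of the process in time and chance is required.\<close>

lemma measurable_empirical_form [measurable]:
  assumes T: "T > 0"
  shows "empirical_form T V V \<in> borel_measurable M"
proof (rule borel_measurable_LIMSEQ_real[OF empirical_form_riemann[OF T]])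
  fix n
  show "(\<lambda>\<omega>. (\<Sum>k<n. (V *v X (T * real k / real n) \<omega>) \<bullet> (V *v X (T * real k / real n) \<omega>)) / n) \<in> borel_measurable M"
    using T
    by (intro borel_measurable_divide borel_measurable_sum borel_measurable_inner
        borel_measurable_continuous_on[OF matrix_vector_mult_linear_continuous_on] measurable_OU) auto
qed

lemma bilinear_empirical_form:
  assumes \<omega>: "\<omega> \<in> space M"
  shows "bilinear (\<lambda>U V. empirical_form T U V \<omega>)"
proof -
  have int: "set_integrable lborel {0..T} (\<lambda>t. (U *v X t \<omega>) \<bullet> (V *v X t \<omega>))" for U V
    by (rule borel_integrable_atLeastAtMost'[OF continuous_on_empirical_integrand[OF \<omega>]])
  have left: "linear (\<lambda>U. empirical_form T U V \<omega>)" for V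
  proof (rule linearI)
    fix U U' :: "real ^ 'd ^ 'd" and c :: real
    show "empirical_form T (U + U') V \<omega> = empirical_form T U V \<omega> + empirical_form T U' V \<omega>"
      by (simp add: empirical_form_def matrix_vector_mult_add_rdistrib inner_add_left
          set_integral_add(2)[OF int int] add_divide_distrib)
    show "empirical_form T (c *\<^sub>R U) V \<omega> = c *\<^sub>R empirical_form T U V \<omega>"
      by (simp add: empirical_form_def scaleR_matrix_vector_assoc[symmetric])
  qed
  moreover have "(\<lambda>V. empirical_form T U V \<omega>) = (\<lambda>V. empirical_form T V U \<omega>)" for U
    by (simp add: empirical_form_def inner_commute)
  ultimately show ?thesis unfolding bilinear_def by simp
qed

lemma bilinear_stationary_form: "bilinear stationary_form"
  unfolding bilinear_def stationary_form_def
  by (auto intro!: linearI simp: inner_add_left inner_add_right sum.distrib sum_distrib_left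
      matrix_vector_right_distrib matrix_vector_mult_scaleR)

lemma stationary_form_sym: "stationary_form U V = stationary_form V U"
  unfolding stationary_form_def by (intro sum.cong refl C_sym)

lemma empirical_form_sym: "empirical_form T U V \<omega> = empirical_form T V U \<omega>"
  by (simp add: empirical_form_def inner_commute)

text \<open>Fatou's lemma along the Riemann sums works for either sign of \<open>\<mu>\<close>
  without uniform integrability. The bounds \<open>L' n\<close> tend to \<open>L\<close>, so the
  strict condition on \<open>\<mu>\<close> holds for all fine grids.\<close>

lemma nn_integral_exp_empirical_form_le:
  assumes T: "T > 0" and V: "norm V \<le> 1"
    and L: "L = 2 * p0 * lambda_max C / (r0 * T)" and \<mu>: "2 * \<mu> * L < 1"
  shows "(\<integral>\<^sup>+ \<omega>. ennreal (exp (\<mu> * empirical_form T V V \<omega>)) \<partial>M)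
    \<le> ennreal (exp (\<mu> * stationary_form V V / (1 - 2 * \<mu> * L)))"
proof -
  define Q where "Q n \<omega> = (\<Sum>k<n. (V *v X (T * real k / real n) \<omega>) \<bullet> (V *v X (T * real k / real n) \<omega>)) / n" for n :: nat and \<omega>
  define L' where "L' n = p0 * lambda_max C * (1 / real n + 2 / (r0 * T))" for n
  have Q_meas [measurable]: "Q n \<in> borel_measurable M" for n
    unfolding Q_def[abs_def] using T
    by (intro borel_measurable_divide borel_measurable_sum borel_measurable_inner
        borel_measurable_continuous_on[OF matrix_vector_mult_linear_continuous_on] measurable_OU) auto
  have "(\<lambda>n. p0 * lambda_max C * (1 / real n + 2 / (r0 * T))) \<longlonglongrightarrow> p0 * lambda_max C * (0 + 2 / (r0 * T))"
    by (intro tendsto_intros lim_1_over_n)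
  then have L': "L' \<longlonglongrightarrow> L" by (simp add: L'_def[abs_def] L mult_ac)
  then have "(\<lambda>n. 2 * \<mu> * L' n) \<longlonglongrightarrow> 2 * \<mu> * L" by (intro tendsto_intros)
  then have ev: "eventually (\<lambda>n. 2 * \<mu> * L' n < 1) sequentially" using \<mu> by (rule order_tendstoD)
  have lim: "(\<lambda>n. ennreal (exp (\<mu> * stationary_form V V / (1 - 2 * \<mu> * L' n)))) \<longlonglongrightarrow>
      ennreal (exp (\<mu> * stationary_form V V / (1 - 2 * \<mu> * L)))"
    using \<mu> by (intro tendsto_ennrealI tendsto_intros L') simp
  have "(\<integral>\<^sup>+ \<omega>. ennreal (exp (\<mu> * empirical_form T V V \<omega>)) \<partial>M)
      = (\<integral>\<^sup>+ \<omega>. liminf (\<lambda>n. ennreal (exp (\<mu> * Q n \<omega>))) \<partial>M)"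
  proof (rule nn_integral_cong)
    fix \<omega> assume "\<omega> \<in> space M"
    then have "(\<lambda>n. ennreal (exp (\<mu> * Q n \<omega>))) \<longlonglongrightarrow> ennreal (exp (\<mu> * empirical_form T V V \<omega>))"
      unfolding Q_def by (intro tendsto_ennrealI tendsto_intros empirical_form_riemann T)
    then show "ennreal (exp (\<mu> * empirical_form T V V \<omega>)) = liminf (\<lambda>n. ennreal (exp (\<mu> * Q n \<omega>)))"
      by (intro lim_imp_Liminf[symmetric]) simp_all
  qed
  also have "\<dots> \<le> liminf (\<lambda>n. \<integral>\<^sup>+ \<omega>. ennreal (exp (\<mu> * Q n \<omega>)) \<partial>M)"
    by (rule nn_integral_liminf) measurable
  also have "\<dots> \<le> liminf (\<lambda>n. ennreal (exp (\<mu> * stationary_form V V / (1 - 2 * \<mu> * L' n))))"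
  proof (rule Liminf_mono)
    show "eventually (\<lambda>n. (\<integral>\<^sup>+ \<omega>. ennreal (exp (\<mu> * Q n \<omega>)) \<partial>M)
      \<le> ennreal (exp (\<mu> * stationary_form V V / (1 - 2 * \<mu> * L' n)))) sequentially"
      using ev eventually_gt_at_top[of 0]
      by eventually_elim (unfold Q_def, rule nn_integral_exp_riemann_sum_le[OF T _ V], auto simp: L'_def)
  qed
  also have "\<dots> = ennreal (exp (\<mu> * stationary_form V V / (1 - 2 * \<mu> * L)))"
    by (rule lim_imp_Liminf[OF _ lim]) simp
  finally show ?thesis .
qed

text \<open>Chernoff's bound, with \<open>\<sigma> = 1\<close> for the upper and
  \<open>\<sigma> = -1\<close> for the lower tail; both exponents are estimated by the expression
  for positive \<open>\<mu>\<close>.\<close>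

lemma empirical_form_tail:
  fixes \<sigma> :: real
  assumes T: "T > 0" and V: "norm V \<le> 1" and \<sigma>: "\<bar>\<sigma>\<bar> = 1" and x: "x > 0"
    and L: "L = 2 * p0 * lambda_max C / (r0 * T)"
  shows "prob {\<omega> \<in> space M. \<sigma> * (empirical_form T V V \<omega> - stationary_form V V) \<ge> x}
    \<le> exp (- x\<^sup>2 / (4 * L * (2 * lambda_max C + x)))"
proof -
  let ?K = "lambda_max C" and ?\<tau> = "stationary_form V V"
  note meas [measurable] = measurable_empirical_form[OF T, of V]
  have L0: "L > 0" unfolding L using p0_pos lambda_max_pos r0_pos T by simp
  \<comment> \<open>The choice \<open>m = x / w\<close> gives
    \<open>1 - 2 * m * L = 4 * L * ?K / w\<close>. The second-order term of the exponent is then at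
    most \<open>m * x / 2\<close>, half of the linear gain \<open>m * x\<close>.\<close>
  define w where "w = 4 * L * ?K + 2 * L * x"
  define m where "m = x / w"
  define \<mu> where "\<mu> = \<sigma> * m"
  have w: "w > 0" unfolding w_def using L0 lambda_max_pos x by (intro add_pos_pos mult_pos_pos) auto
  have m: "m > 0" using x w by (simp add: m_def)
  have mL: "1 - 2 * m * L = 4 * L * ?K / w" using w by (simp add: m_def field_simps) (simp add: w_def)
  then have mL0: "1 - 2 * m * L > 0" using L0 lambda_max_pos w by simp
  have \<mu>m: "\<mu>\<^sup>2 = m\<^sup>2" "\<mu> \<le> m" using \<sigma> m by (auto simp: \<mu>_def abs_if power_mult_distrib split: if_splits)
  have \<mu>L: "1 - 2 * m * L \<le> 1 - 2 * \<mu> * L" using \<mu>m(2) L0 by simp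
  have \<tau>: "0 \<le> ?\<tau>" "?\<tau> \<le> ?K"
  proof -
    have "0 \<le> lambda_min C * (norm V)\<^sup>2" using lambda_min_pos by simp
    then show "0 \<le> ?\<tau>" using stationary_form_between(1)[of V] by linarith
    have "?K * (norm V)\<^sup>2 \<le> ?K * 1" using V lambda_max_pos by (intro mult_left_mono power_le_one) auto
    then show "?\<tau> \<le> ?K" using stationary_form_between(2)[of V] by linarith
  qed
  have bound: "\<mu> * ?\<tau> / (1 - 2 * \<mu> * L) - \<mu> * ?\<tau> - m * x \<le> - x\<^sup>2 / (4 * L * (2 * ?K + x))"
  proof -
    have "\<mu> * ?\<tau> / (1 - 2 * \<mu> * L) - \<mu> * ?\<tau> = 2 * \<mu>\<^sup>2 * L * ?\<tau> / (1 - 2 * \<mu> * L)"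
      using \<mu>L mL0 by (simp add: field_simps power2_eq_square)
    also have "\<dots> \<le> 2 * m\<^sup>2 * L * ?K / (1 - 2 * m * L)"
      unfolding \<mu>m(1) using \<mu>L mL0 L0 \<tau> lambda_max_pos by (intro frac_le mult_left_mono) auto
    also have "\<dots> = m * x / 2"
      unfolding mL using L0 lambda_max_pos w by (simp add: m_def field_simps power2_eq_square)
    finally have "\<mu> * ?\<tau> / (1 - 2 * \<mu> * L) - \<mu> * ?\<tau> - m * x \<le> - (m * x / 2)" by linarith
    also have "m * x / 2 = x\<^sup>2 / (4 * L * (2 * ?K + x))"
      unfolding m_def w_def by (simp add: power2_eq_square algebra_simps)
    finally show ?thesis by simp
  qed
  define A where "A = {\<omega> \<in> space M. \<sigma> * (empirical_form T V V \<omega> - ?\<tau>) \<ge> x}"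
  have A [measurable]: "A \<in> sets M" unfolding A_def by measurable
  have "ennreal (prob A) = emeasure M A" by (simp add: emeasure_eq_measure)
  also have "\<dots> = (\<integral>\<^sup>+ \<omega>. indicator A \<omega> \<partial>M)" by simp
  also have "\<dots> \<le> (\<integral>\<^sup>+ \<omega>. ennreal (exp (- \<mu> * ?\<tau> - m * x)) * ennreal (exp (\<mu> * empirical_form T V V \<omega>)) \<partial>M)"
  proof (rule nn_integral_mono)
    fix \<omega>
    show "indicator A \<omega> \<le> ennreal (exp (- \<mu> * ?\<tau> - m * x)) * ennreal (exp (\<mu> * empirical_form T V V \<omega>))"
    proof (cases "\<omega> \<in> A")
      case True
      then have "m * x \<le> m * (\<sigma> * (empirical_form T V V \<omega> - ?\<tau>))" using m by (intro mult_left_mono) (auto simp: A_def)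
      then have "0 \<le> - \<mu> * ?\<tau> - m * x + \<mu> * empirical_form T V V \<omega>" by (simp add: \<mu>_def algebra_simps)
      then have "1 \<le> exp (- \<mu> * ?\<tau> - m * x + \<mu> * empirical_form T V V \<omega>)" by simp
      then have "ennreal 1 \<le> ennreal (exp (- \<mu> * ?\<tau> - m * x) * exp (\<mu> * empirical_form T V V \<omega>))"
        by (intro ennreal_leI) (simp only: exp_add)
      then show ?thesis using True by (simp add: ennreal_mult)
    qed simp
  qed
  also have "\<dots> = ennreal (exp (- \<mu> * ?\<tau> - m * x)) * (\<integral>\<^sup>+ \<omega>. ennreal (exp (\<mu> * empirical_form T V V \<omega>)) \<partial>M)"
    by (rule nn_integral_cmult) measurable
  also have "\<dots> \<le> ennreal (exp (- \<mu> * ?\<tau> - m * x)) * ennreal (exp (\<mu> * ?\<tau> / (1 - 2 * \<mu> * L)))"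
    using \<mu>L mL0 by (intro mult_left_mono nn_integral_exp_empirical_form_le[OF T V L]) auto
  also have "\<dots> = ennreal (exp (\<mu> * ?\<tau> / (1 - 2 * \<mu> * L) - \<mu> * ?\<tau> - m * x))"
    by (simp add: ennreal_mult[symmetric] exp_add[symmetric] algebra_simps)
  also have "\<dots> \<le> ennreal (exp (- x\<^sup>2 / (4 * L * (2 * ?K + x))))"
    using bound by (intro ennreal_leI) simp
  finally show ?thesis by (simp add: A_def)
qed

lemma empirical_form_deviation:
  assumes "T > 0" "norm V \<le> 1" "x > 0" and L: "L = 2 * p0 * lambda_max C / (r0 * T)"
  shows "prob {\<omega> \<in> space M. \<bar>empirical_form T V V \<omega> - stationary_form V V\<bar> \<ge> x}
    \<le> 2 * exp (- x\<^sup>2 / (4 * L * (2 * lambda_max C + x)))"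
proof -
  note meas [measurable] = measurable_empirical_form[OF assms(1), of V]
  define A where "A \<sigma> = {\<omega> \<in> space M. \<sigma> * (empirical_form T V V \<omega> - stationary_form V V) \<ge> x}" for \<sigma> :: real
  have A: "A \<sigma> \<in> events" for \<sigma> unfolding A_def by measurable
  have "{\<omega> \<in> space M. \<bar>empirical_form T V V \<omega> - stationary_form V V\<bar> \<ge> x} = A 1 \<union> A (- 1)"
    unfolding A_def by (auto simp: abs_if split: if_splits)
  then have "prob {\<omega> \<in> space M. \<bar>empirical_form T V V \<omega> - stationary_form V V\<bar> \<ge> x} \<le> prob (A 1) + prob (A (- 1))"
    using measure_Un_le[OF A A, of 1 "-1"] by simp
  moreover have "prob (A 1) \<le> exp (- x\<^sup>2 / (4 * L * (2 * lambda_max C + x)))"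
    unfolding A_def by (rule empirical_form_tail[OF assms(1,2) _ assms(3,4)]) simp
  moreover have "prob (A (- 1)) \<le> exp (- x\<^sup>2 / (4 * L * (2 * lambda_max C + x)))"
    unfolding A_def by (rule empirical_form_tail[OF assms(1,2) _ assms(3,4)]) simp
  ultimately show ?thesis by linarith
qed

end

section \<open>The restricted eigenvalue property\<close>

lemma bij_betw_matrix_Basis:
  "bij_betw (\<lambda>(i, j). axis i (axis j 1)) UNIV (Basis :: (real ^ 'n ^ 'm) set)"
  unfolding bij_betw_def
proof
  show "inj (\<lambda>(i, j). axis i (axis j 1) :: real ^ 'n ^ 'm)"
    by (auto simp: inj_on_def axis_eq_axis)
  show "range (\<lambda>(i, j). axis i (axis j 1)) = (Basis :: (real ^ 'n ^ 'm) set)"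
    by (auto simp: Basis_vec_def)
qed

lemma sparse_cone_approx_sparse:
  fixes V :: "real ^ 'd ^ 'd"
  assumes "V \<in> sparse_cone s c0"
  shows "approx_sparse s c0 V"
proof -
  let ?\<beta> = "\<lambda>(i, j). axis i (axis j 1) :: real ^ 'd ^ 'd"
  obtain J where J: "largest_coords s V J" and l1: "l1_norm V \<le> (1 + c0) * l1_norm (restrict_matrix V J)"
    using assms by (auto simp: sparse_cone_def)
  have inner: "V \<bullet> ?\<beta> p = V $ fst p $ snd p" for p
    by (simp add: case_prod_beta inner_axis)
  have inj: "inj_on ?\<beta> A" for A
    using bij_betw_matrix_Basis by (metis bij_betw_def inj_on_subset subset_UNIV)
  have Basis: "Basis = ?\<beta> ` UNIV" using bij_betw_matrix_Basis by (metis bij_betw_def)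
  have top: "\<bar>V \<bullet> b'\<bar> \<le> \<bar>V \<bullet> b\<bar>" if "b \<in> ?\<beta> ` J" "b' \<in> Basis - ?\<beta> ` J" for b b'
  proof -
    obtain p where p: "p \<in> J" "b = ?\<beta> p" using \<open>b \<in> _\<close> by blast
    have "b' \<in> range ?\<beta>" "b' \<notin> ?\<beta> ` J" using \<open>b' \<in> _\<close> Basis by auto
    then obtain p' where p': "p' \<in> - J" "b' = ?\<beta> p'" by blast
    show ?thesis unfolding p(2) p'(2) inner
      using J p(1) p'(1) by (auto simp: largest_coords_def case_prod_beta)
  qed
  have all: "(\<Sum>b\<in>Basis. \<bar>V \<bullet> b\<bar>) = l1_norm V"
    unfolding Basis sum.reindex[OF inj] comp_def inner l1_norm_def
    by (simp add: sum.cartesian_product case_prod_beta)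
  have part: "(\<Sum>b\<in>?\<beta> ` J. \<bar>V \<bullet> b\<bar>) = l1_norm (restrict_matrix V J)"
  proof -
    have "l1_norm (restrict_matrix V J) = (\<Sum>p\<in>UNIV. if p \<in> J then \<bar>V $ fst p $ snd p\<bar> else 0)"
      unfolding l1_norm_def restrict_matrix_def
      by (simp add: sum.cartesian_product case_prod_beta if_distrib[of abs] cong: if_cong)
    also have "\<dots> = (\<Sum>p\<in>J. \<bar>V $ fst p $ snd p\<bar>)"
      by (simp add: sum.If_cases)
    finally show ?thesis unfolding sum.reindex[OF inj] comp_def inner by simp
  qed
  show ?thesis
    unfolding approx_sparse_def
  proof (intro exI[of _ "?\<beta> ` J"] conjI ballI)
    show "card (?\<beta> ` J) = s" using J by (simp add: card_image[OF inj] largest_coords_def)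
  qed (use top l1 Basis in \<open>auto simp: all part\<close>)
qed

text \<open>An infimum of reals is informative only over a nonempty set. The indicator matrix of any
  \<open>s\<close> positions belongs to the cone.\<close>

lemma sparse_cone_nonempty:
  assumes "s \<in> {1..CARD('d)\<^sup>2}" "c0 > 0"
  shows "(sparse_cone s c0 :: (real ^ 'd::finite ^ 'd) set) \<noteq> {}"
proof -
  have "s \<le> card (UNIV :: ('d \<times> 'd) set)" using assms by (simp add: power2_eq_square)
  then obtain J :: "('d \<times> 'd) set" where J: "card J = s" using obtain_subset_with_card_n by metis
  define V :: "real ^ 'd ^ 'd" where "V = (\<chi> i j. if (i, j) \<in> J then 1 else 0)"
  have "J \<noteq> {}" using J assms by auto
  then obtain i j where "(i, j) \<in> J" by auto
  then have "V $ i $ j = 1" by (simp add: V_def)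
  then have "V \<noteq> 0" by auto
  moreover have "largest_coords s V J" using J by (auto simp: largest_coords_def V_def)
  moreover have "restrict_matrix V J = V" by (simp add: restrict_matrix_def V_def vec_eq_iff)
  moreover have "l1_norm V \<le> (1 + c0) * l1_norm V"
    using assms by (simp add: distrib_right l1_norm_def sum_nonneg)
  ultimately have "V \<in> sparse_cone s c0" unfolding sparse_cone_def by auto
  then show ?thesis by blast
qed

text \<open>The deviation level \<open>x\<close> is chosen so that the passage from the test set to the cone costs
  exactly half of the smallest eigenvalue; the constants in the horizon then leave room.\<close>

lemma deviation_exponent_ge:
  fixes k K a p r T :: real
  assumes "k > 0" "K > 0" "a > 0" "p > 0" "r > 0" "T > 0"
  defines "x \<equiv> k / (6 * a)" and "L \<equiv> 2 * p * K / (r * T)"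
  shows "T / (144 * p * K * a * (k + 18 * a * K) / (r * k\<^sup>2)) \<le> x\<^sup>2 / (4 * L * (2 * K + x))"
proof -
  have "T / (144 * p * K * a * (k + 18 * a * K) / (r * k\<^sup>2)) = (T * r * k\<^sup>2 / (p * K)) * (1 / (144 * a * (k + 18 * a * K)))"
    using assms(1-6) by (simp add: field_simps)
  \<comment> \<open>The chosen \<open>x\<close> and \<open>L\<close> give exactly 48 and 12 where
    the horizon has 144 and 18.\<close>
  also have "\<dots> \<le> (T * r * k\<^sup>2 / (p * K)) * (1 / (48 * a * (k + 12 * a * K)))"
  proof (rule mult_left_mono)
    have "48 * a * (k + 12 * a * K) \<le> 144 * a * (k + 18 * a * K)"
      using assms(1-6) by (intro mult_mono add_mono) auto
    then show "1 / (144 * a * (k + 18 * a * K)) \<le> 1 / (48 * a * (k + 12 * a * K))"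
      using assms(1-6) by (intro divide_left_mono mult_pos_pos add_pos_pos) auto
  qed (use assms(1-6) in simp)
  also have "\<dots> = x\<^sup>2 / (4 * L * (2 * K + x))"
  proof -
    have "2 * K + x = (k + 12 * a * K) / (6 * a)" using assms(3) by (simp add: x_def field_simps)
    then show ?thesis
      using assms(1-6) add_pos_pos[of k "12 * a * K"]
      by (simp add: x_def L_def power_divide field_simps power2_eq_square)
  qed
  finally show ?thesis .
qed

context ou_process
begin

text \<open>Nonnegativity of the empirical form bounds the quotients below, so the real infimum can
  be unfolded; multiplying by the squared norm leaves a condition that is closed in
  \<open>V\<close>.\<close>

lemma cone_event_iff:
  fixes S :: "(real ^ 'd ^ 'd) set"
  assumes S: "S \<noteq> {}" "0 \<notin> S" and T: "T > 0"
  shows "(INF V\<in>S. emp_sqnorm T V (\<lambda>t. X t \<omega>) / (norm V)\<^sup>2) \<ge> l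
    \<longleftrightarrow> (\<forall>V\<in>S. l * (norm V)\<^sup>2 \<le> empirical_form T V V \<omega>)"
proof -
  let ?f = "\<lambda>V. emp_sqnorm T V (\<lambda>t. X t \<omega>) / (norm V)\<^sup>2"
  have nonneg: "0 \<le> empirical_form T V V \<omega>" for V
    using T unfolding empirical_form_def set_lebesgue_integral_def
    by (intro mult_nonneg_nonneg integral_nonneg_AE) auto
  have "bdd_below (?f ` S)" using nonneg by (intro bdd_belowI[of _ 0]) (auto simp: emp_sqnorm_eq)
  then have "l \<le> (INF V\<in>S. ?f V) \<longleftrightarrow> (\<forall>V\<in>S. l \<le> ?f V)" using S(1) by (rule le_cINF_iff[rotated])
  also have "\<dots> \<longleftrightarrow> (\<forall>V\<in>S. l * (norm V)\<^sup>2 \<le> empirical_form T V V \<omega>)"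
    using S(2) by (intro ball_cong refl) (metis emp_sqnorm_eq pos_le_divide_eq zero_less_norm_iff zero_less_power)
  finally show ?thesis .
qed

text \<open>For a fixed path the condition is closed in \<open>V\<close>, so it may be checked on a
  countable dense subset of \<open>S\<close>. Measurability is what allows passing to the complement
  of the event.\<close>

lemma measurable_cone_event:
  fixes S :: "(real ^ 'd ^ 'd) set"
  assumes T: "T > 0"
  shows "{\<omega> \<in> space M. \<forall>V\<in>S. l * (norm V)\<^sup>2 \<le> empirical_form T V V \<omega>} \<in> events"
proof -
  note meas [measurable] = measurable_empirical_form[OF T]
  obtain D where D: "countable D" "D \<subseteq> S" "S \<subseteq> closure D" using separable by blast
  have "(\<forall>V\<in>S. l * (norm V)\<^sup>2 \<le> empirical_form T V V \<omega>) \<longleftrightarrow> (\<forall>V\<in>D. l * (norm V)\<^sup>2 \<le> empirical_form T V V \<omega>)"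
    if \<omega>: "\<omega> \<in> space M" for \<omega>
  proof
    assume *: "\<forall>V\<in>D. l * (norm V)\<^sup>2 \<le> empirical_form T V V \<omega>"
    have "bounded_bilinear (\<lambda>U V. empirical_form T U V \<omega>)"
      using bilinear_empirical_form[OF \<omega>] by (simp add: bilinear_conv_bounded_bilinear)
    then have "continuous_on UNIV (\<lambda>V. empirical_form T V V \<omega>)"
      by (rule bounded_bilinear.continuous_on) (intro continuous_intros)+
    then have "closed {V. l * (norm V)\<^sup>2 \<le> empirical_form T V V \<omega>}"
      by (intro closed_Collect_le continuous_intros)
    then have "closure D \<subseteq> {V. l * (norm V)\<^sup>2 \<le> empirical_form T V V \<omega>}"
      using * by (intro closure_minimal) auto
    then show "\<forall>V\<in>S. l * (norm V)\<^sup>2 \<le> empirical_form T V V \<omega>" using D(3) by blast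
  qed (use D(2) in blast)
  then have "{\<omega> \<in> space M. \<forall>V\<in>S. l * (norm V)\<^sup>2 \<le> empirical_form T V V \<omega>}
      = {\<omega> \<in> space M. \<forall>V\<in>D. l * (norm V)\<^sup>2 \<le> empirical_form T V V \<omega>}" by blast
  also have "\<dots> \<in> events"
    by (intro sets.sets_Collect_countable_All'[OF _ D(1)]) measurable
  finally show ?thesis .
qed

lemma restricted_eigenvalue:
  assumes T: "T > 0" and s: "s \<in> {1..CARD('d)\<^sup>2}" and c0: "c0 > 0" and \<epsilon>: "0 < \<epsilon>"
    and horizon: "T \<ge> horizon A0 P0 \<theta> \<epsilon> s c0"
  shows "prob {\<omega> \<in> space M. \<forall>V\<in>sparse_cone s c0. lambda_min C / 2 * (norm V)\<^sup>2 \<le> empirical_form T V V \<omega>} \<ge> 1 - \<epsilon>"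
    (is "prob ?E \<ge> _")
proof -
  note meas [measurable] = measurable_empirical_form[OF T]
  let ?k = "lambda_min C" and ?K = "lambda_max C" and ?d = "CARD('d)"
  define a where "a = (c0 + 2)\<^sup>2"
  define x where "x = ?k / (6 * a)"
  define L where "L = 2 * p0 * ?K / (r0 * T)"
  define F where "F = horizon_factor A0 P0 \<theta> c0"
  have a: "a > 0" using c0 by (simp add: a_def)
  have x: "x > 0" using lambda_min_pos a by (simp add: x_def)
  have F_eq: "F = 144 * p0 * ?K * a * (?k + 18 * a * ?K) / (r0 * ?k\<^sup>2)"
    by (simp add: F_def horizon_factor_def a_def)
  have F: "F > 0"
    unfolding F_eq using p0_pos lambda_max_pos lambda_min_pos r0_pos a
    by (intro divide_pos_pos mult_pos_pos add_pos_pos zero_less_power) auto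
  have dim: "DIM(real ^ 'd ^ 'd) = ?d\<^sup>2" by (simp add: power2_eq_square)
  have s1: "1 \<le> s" "s \<le> DIM(real ^ 'd ^ 'd)" using s unfolding dim by auto
  obtain N :: "(real ^ 'd ^ 'd) set" where N: "finite N"
    "card N \<le> (DIM(real ^ 'd ^ 'd) choose min (2 * s) DIM(real ^ 'd ^ 'd)) * 21 ^ min (2 * s) DIM(real ^ 'd ^ 'd)"
    "\<And>u. u \<in> N \<Longrightarrow> norm u \<le> 1"
    and test: "\<And>(D :: real ^ 'd ^ 'd \<Rightarrow> real ^ 'd ^ 'd \<Rightarrow> real) x v. bilinear D \<Longrightarrow> (\<And>x y. D x y = D y x) \<Longrightarrow> x \<ge> 0 \<Longrightarrow>
      (\<And>u. u \<in> N \<Longrightarrow> \<bar>D u u\<bar> \<le> x) \<Longrightarrow> approx_sparse s c0 v \<Longrightarrow> \<bar>D v v\<bar> \<le> 3 * x * (2 + c0)\<^sup>2 * (norm v)\<^sup>2"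
    using exists_sparse_test_set[OF s1(1) c0] by metis
  define B where "B u = {\<omega> \<in> space M. \<bar>empirical_form T u u \<omega> - stationary_form u u\<bar> \<ge> x}" for u :: "real ^ 'd ^ 'd"
  have B: "B u \<in> events" for u unfolding B_def by measurable
  have E: "?E \<in> events" by (rule measurable_cone_event[OF T])
  \<comment> \<open>This inclusion is deterministic: on a path where the deviation \<open>D\<close>
    is below \<open>x\<close> on the whole test set, it is at most half of
    \<open>lambda_min C\<close> times the squared norm on the cone.\<close>
  have "space M - ?E \<subseteq> (\<Union>u\<in>N. B u)"
  proof (rule ccontr)
    assume "\<not> space M - ?E \<subseteq> (\<Union>u\<in>N. B u)"
    then obtain \<omega> where \<omega>: "\<omega> \<in> space M" "\<omega> \<notin> ?E" "\<And>u. u \<in> N \<Longrightarrow> \<omega> \<notin> B u" by blast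
    define D where "D U V = empirical_form T U V \<omega> - stationary_form U V" for U V
    have bil: "bilinear D"
      using bilinear_empirical_form[OF \<omega>(1), of T] bilinear_stationary_form
      unfolding D_def bilinear_def by (auto intro!: linear_compose_sub)
    have sym: "D U V = D V U" for U V
      unfolding D_def using empirical_form_sym stationary_form_sym by metis
    have D_N: "\<bar>D u u\<bar> \<le> x" if "u \<in> N" for u
      using \<omega>(1) \<omega>(3)[OF that] by (simp add: B_def D_def)
    have "lambda_min C / 2 * (norm V)\<^sup>2 \<le> empirical_form T V V \<omega>" if "V \<in> sparse_cone s c0" for V
    proof -
      have "\<bar>D V V\<bar> \<le> 3 * x * (2 + c0)\<^sup>2 * (norm V)\<^sup>2"
        by (rule test[OF bil sym less_imp_le[OF x] D_N sparse_cone_approx_sparse[OF that]])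
      also have "3 * x * (2 + c0)\<^sup>2 = ?k / 2" using a by (simp add: x_def a_def add.commute)
      finally show ?thesis using stationary_form_between(1)[of V] unfolding D_def by linarith
    qed
    then show False using \<omega>(1,2) by blast
  qed
  then have "prob (space M - ?E) \<le> prob (\<Union>u\<in>N. B u)" using N(1) B by (intro finite_measure_mono) auto
  also have "\<dots> \<le> (\<Sum>u\<in>N. prob (B u))" using N(1) B by (intro finite_measure_subadditive_finite) auto
  also have "\<dots> \<le> (\<Sum>u\<in>N. 2 * exp (- x\<^sup>2 / (4 * L * (2 * ?K + x))))"
    unfolding B_def using N(3) by (intro sum_mono empirical_form_deviation T x L_def)
  also have "\<dots> = real (card N) * (2 * exp (- x\<^sup>2 / (4 * L * (2 * ?K + x))))" by simp
  also have "\<dots> \<le> exp (4 * real s * ln ?d - 2 * real s * (ln (2 * real s / 21) - 1)) * (2 * exp (- (T / F)))"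
  proof (rule mult_mono)
    have "real (card N) \<le> exp (2 * real s * ln (real (DIM(real ^ 'd ^ 'd))) - 2 * real s * (ln (2 * real s / 21) - 1))"
      by (rule order_trans[OF of_nat_mono[OF N(2)] test_set_card_le[OF s1]])
    also have "2 * real s * ln (real (DIM(real ^ 'd ^ 'd))) = 4 * real s * ln ?d"
      unfolding dim by (simp add: ln_realpow)
    finally show "real (card N) \<le> exp (4 * real s * ln ?d - 2 * real s * (ln (2 * real s / 21) - 1))" .
    have "T / F \<le> x\<^sup>2 / (4 * L * (2 * ?K + x))"
      unfolding F_eq x_def L_def
      by (rule deviation_exponent_ge[OF lambda_min_pos lambda_max_pos a p0_pos r0_pos T])
    then show "2 * exp (- x\<^sup>2 / (4 * L * (2 * ?K + x))) \<le> 2 * exp (- (T / F))" by simp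
  qed auto
  also have "\<dots> \<le> \<epsilon>"
  proof -
    \<comment> \<open>The exponential of \<open>h\<close> bounds the size of the test set. The
      horizon is at least \<open>F * (h + ln (2 / \<epsilon>))\<close>, with the 2 accounting for
      the two tails.\<close>
    define h where "h = 4 * real s * ln ?d - 2 * real s * (ln (2 * real s / 21) - 1)"
    have "(4 * real s + 1) * ln ?d - 2 * real s * (ln (2 * real s / 21) - 1) + ln (2 / \<epsilon>) = h + ln ?d + ln (2 / \<epsilon>)"
      by (simp add: h_def algebra_simps)
    then have "h + ln ?d + ln (2 / \<epsilon>) \<le> T / F"
      using horizon unfolding horizon_def F_def[symmetric] pos_le_divide_eq[OF F] by (simp only: mult.commute)
    moreover have "0 \<le> ln (real ?d)" by simp
    ultimately have "h - T / F \<le> - ln (2 / \<epsilon>)" by linarith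
    then have "exp (h - T / F) \<le> exp (- ln (2 / \<epsilon>))" by simp
    also have "\<dots> = \<epsilon> / 2" using \<epsilon> by (simp add: exp_minus)
    finally have "2 * exp (h - T / F) \<le> \<epsilon>" by simp
    then show ?thesis unfolding h_def[symmetric] by (simp add: exp_diff exp_minus divide_inverse mult_ac)
  qed
  finally have "prob (space M - ?E) \<le> \<epsilon>" .
  then show ?thesis using prob_compl[OF E] by linarith
qed

end

theorem theorem3p3:
  fixes M :: "'a measure"
    and W X :: "real \<Rightarrow> 'a \<Rightarrow> real ^ 'd"
    and A0 :: "real ^ 'd ^ 'd"
    and P0 :: "complex ^ 'd ^ 'd"
    and \<theta> :: "'d::finite \<Rightarrow> complex"
    and s :: nat
    and c0 :: real
  assumes "prob_space M"
    and "two_sided_brownian_motion M W"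
    and "assumption_H A0 P0 \<theta>"
    and "stationary_OU M A0 W X"
    and "s \<in> {1..CARD('d)\<^sup>2}"
    and "c0 > 0"
  shows "lambda_min (C_inf A0) > 0 \<and>
    (\<forall>\<epsilon>0 T. 0 < \<epsilon>0 \<and> \<epsilon>0 < 1 \<and> T > 0 \<and> T \<ge> horizon A0 P0 \<theta> \<epsilon>0 s c0 \<longrightarrow>
       measure M {\<omega> \<in> space M.
         (INF V\<in>sparse_cone s c0. emp_sqnorm T V (\<lambda>t. X t \<omega>) / (norm V)\<^sup>2)
           \<ge> lambda_min (C_inf A0) / 2}
       \<ge> 1 - \<epsilon>0)"
proof -
  interpret prob_space M by (rule assms(1))
  interpret ou_process A0 P0 \<theta> M W X
    using assms(2-4) by unfold_locales
  have cone: "sparse_cone s c0 \<noteq> ({} :: (real ^ 'd ^ 'd) set)" "0 \<notin> (sparse_cone s c0 :: (real ^ 'd ^ 'd) set)"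
    using sparse_cone_nonempty[OF assms(5,6)] by (auto simp: sparse_cone_def)
  show ?thesis
  proof (intro conjI allI impI)
    fix \<epsilon>0 T :: real
    assume *: "0 < \<epsilon>0 \<and> \<epsilon>0 < 1 \<and> T > 0 \<and> T \<ge> horizon A0 P0 \<theta> \<epsilon>0 s c0"
    then have T: "T > 0" by simp
    show "1 - \<epsilon>0 \<le> measure M {\<omega> \<in> space M. lambda_min C / 2
        \<le> (INF V\<in>sparse_cone s c0. emp_sqnorm T V (\<lambda>t. X t \<omega>) / (norm V)\<^sup>2)}"
      unfolding cone_event_iff[OF cone T] using * by (intro restricted_eigenvalue assms(5,6)) auto
  qed (rule lambda_min_pos)
qed

end
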